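(* Let $G$ be a locally compact second countable topological group, $\mu$ a spread-out probability measure on $G$, and $\phi : G \to \mathbb{R}$ a Borel measurable quasimorphism which is square-integrable with respect to $\mu$. Then $\phi$ satisfies the central limit theorem with respect to $\mu$. The central limit theorem is non-degenerate if and only if $\phi$ is not $\mu$-tame. In this case (i.e. if $\phi$ is not $\mu$-tame), $\phi$ also satisfies the law of the iterated logarithm with respect to $\mu$.
   Context: All probability measures on topological groups are regular Borel probability measures. $\mu^{*n}$ denotes the $n$-th convolution power of $\mu$. A probability measure $\mu$ on a locally compact group $G$ is spread out if some convolution power $\mu^{*n}$ is non-singular with respect to Haar measure on $G$. A function $\phi : G \to \mathbb{R}$ is a quasimorphism if $\sup_{g,h \in G} |\phi(gh)-\phi(g)-\phi(h)| < \infty$. For a $\mu$-integrable quasimorphism $\phi$, its $\mu$-distortion is $\ell_\mu(\phi) = \lim_{n\to\infty} \frac1n \int_G \phi \, d\mu^{*n}$. The quasimorphism $\phi$ is $\mu$-tame if there is a constant $C$ such that for all $n \ge 1$, $|\phi(g) - n\ell_\mu(\phi)| \le C$ for $\mu^{*n}$-almost every $g$. A random walk on $G$ with $\mu$-distributed increments is a sequence $z_n = \omega_0 \omega_1\cdots \omega_{n-1}$ ($n \ge 1$), where $(\omega_k)_{k \ge 0}$ are independent $\mu$-distributed $G$-valued random variables on some probability space. $\phi$ satisfies the central limit theorem with respect to $\mu$ if there is a constant $\sigma \ge 0$ such that $\frac{\phi(z_n) - n\ell_\mu(\phi)}{\sqrt n}$ converges in distribution to the centered Gaussian distribution with variance $\sigma^2$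 (the point mass at $0$ if $\sigma = 0$). The central limit theorem is non-degenerate if $\sigma > 0$. $\phi$ satisfies the law of the iterated logarithm with respect to $\mu$ if, with the same constant $\sigma$ as in the central limit theorem, $\limsup_{n\to\infty} \frac{\phi(z_n) - n\ell_\mu(\phi)}{\sqrt{2n \log\log n}} = \sigma > 0$ almost surely. *)

theory Defs
  imports "HOL-Probability.Probability"
begin

text \<open>
  Groups are written additively but are not assumed commutative: the class
  \<^class>\<open>topological_group_add\<close> extends \<^class>\<open>group_add\<close>, not \<^class>\<open>ab_group_add\<close>.
  Thus \<open>g + h\<close> is the group product, \<open>0\<close> the neutral element, and the order of summands matters.
\<close>

definition regular_borel_measure :: "'a::topological_space measure \<Rightarrow> bool" where
  "regular_borel_measure M \<longleftrightarrow>
     sets M = sets borel \<and>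
     (\<forall>K. compact K \<longrightarrow> emeasure M K < \<infinity>) \<and>
     (\<forall>A \<in> sets borel. emeasure M A = (INF U \<in> {U. open U \<and> A \<subseteq> U}. emeasure M U)) \<and>
     (\<forall>U. open U \<longrightarrow> emeasure M U = (SUP K \<in> {K. compact K \<and> K \<subseteq> U}. emeasure M K))"

text \<open>Left Haar measures. Left and right Haar measures have the same null sets, so the choice
  of side does not affect singularity below.\<close>

definition haar_measure :: "'a::topological_group_add measure \<Rightarrow> bool" where
  "haar_measure L \<longleftrightarrow>
     regular_borel_measure L \<and>
     emeasure L UNIV \<noteq> 0 \<and>
     (\<forall>g. \<forall>A \<in> sets borel. emeasure L ((\<lambda>x. g + x) ` A) = emeasure L A)"

definition mutually_singular :: "'a::topological_space measure \<Rightarrow> 'a measure \<Rightarrow> bool" where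
  "mutually_singular M N \<longleftrightarrow>
     (\<exists>A \<in> sets borel. emeasure M A = 0 \<and> emeasure N (- A) = 0)"

text \<open>The library's \<^const>\<open>convolution\<close> is restricted to ordered Euclidean spaces.\<close>

definition group_convolution ::
    "'a::topological_group_add measure \<Rightarrow> 'a measure \<Rightarrow> 'a measure" where
  "group_convolution M N = distr (M \<Otimes>\<^sub>M N) borel (\<lambda>(x, y). x + y)"

primrec convolution_power :: "'a::topological_group_add measure \<Rightarrow> nat \<Rightarrow> 'a measure" where
  "convolution_power \<mu> 0 = return borel 0"
| "convolution_power \<mu> (Suc n) = group_convolution (convolution_power \<mu> n) \<mu>"

text \<open>Haar measure on a locally compact group exists and is unique up to a positive factor, so it
  does not matter which Haar measure is taken.\<close>

definition spread_out :: "'a::topological_group_add measure \<Rightarrow> bool" where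
  "spread_out \<mu> \<longleftrightarrow>
     (\<exists>L. haar_measure L \<and> (\<exists>n\<ge>1. \<not> mutually_singular (convolution_power \<mu> n) L))"

definition quasimorphism :: "('a::group_add \<Rightarrow> real) \<Rightarrow> bool" where
  "quasimorphism \<phi> \<longleftrightarrow> (\<exists>D. \<forall>g h. \<bar>\<phi> (g + h) - \<phi> g - \<phi> h\<bar> \<le> D)"

definition distortion :: "'a::topological_group_add measure \<Rightarrow> ('a \<Rightarrow> real) \<Rightarrow> real" where
  "distortion \<mu> \<phi> = lim (\<lambda>n. (\<integral>g. \<phi> g \<partial>(convolution_power \<mu> n)) / real n)"

definition tame :: "'a::topological_group_add measure \<Rightarrow> ('a \<Rightarrow> real) \<Rightarrow> bool" where
  "tame \<mu> \<phi> \<longleftrightarrow>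
     (\<exists>C. \<forall>n\<ge>1. AE g in convolution_power \<mu> n. \<bar>\<phi> g - real n * distortion \<mu> \<phi>\<bar> \<le> C)"

text \<open>\<open>\<omega>\<close> is an i.i.d. sequence of \<open>\<mu>\<close>-distributed random elements on the probability space \<open>P\<close>.\<close>

definition iid_increments ::
    "'a::topological_group_add measure \<Rightarrow> 'w measure \<Rightarrow> (nat \<Rightarrow> 'w \<Rightarrow> 'a) \<Rightarrow> bool" where
  "iid_increments \<mu> P \<omega> \<longleftrightarrow>
     prob_space P \<and>
     prob_space.indep_vars P (\<lambda>_. borel) \<omega> UNIV \<and>
     (\<forall>k. distr P borel (\<omega> k) = \<mu>)"

text \<open>\<open>z\<^sub>n = \<omega>\<^sub>0 + \<dots> + \<omega>\<^sub>n\<^sub>-\<^sub>1\<close>, summed in this order; a list sum since the group need not be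
  commutative.\<close>

definition walk :: "(nat \<Rightarrow> 'w \<Rightarrow> 'a::group_add) \<Rightarrow> nat \<Rightarrow> 'w \<Rightarrow> 'a" where
  "walk \<omega> n x = sum_list (map (\<lambda>k. \<omega> k x) [0..<n])"

definition centered_gaussian :: "real \<Rightarrow> real measure" where
  "centered_gaussian \<sigma> =
     (if \<sigma> = 0 then return borel 0 else density lborel (\<lambda>x. ennreal (normal_density 0 \<sigma> x)))"

definition central_limit ::
    "'a::topological_group_add measure \<Rightarrow> ('a \<Rightarrow> real) \<Rightarrow> 'w measure \<Rightarrow> (nat \<Rightarrow> 'w \<Rightarrow> 'a) \<Rightarrow> real \<Rightarrow> bool" where
  "central_limit \<mu> \<phi> P \<omega> \<sigma> \<longleftrightarrow>
     weak_conv_m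
       (\<lambda>n. distr P borel (\<lambda>x. (\<phi> (walk \<omega> n x) - real n * distortion \<mu> \<phi>) / sqrt (real n)))
       (centered_gaussian \<sigma>)"

text \<open>For small \<open>n\<close> the normalization takes junk values; these do not affect the limes superior.\<close>

definition iterated_logarithm ::
    "'a::topological_group_add measure \<Rightarrow> ('a \<Rightarrow> real) \<Rightarrow> 'w measure \<Rightarrow> (nat \<Rightarrow> 'w \<Rightarrow> 'a) \<Rightarrow> real \<Rightarrow> bool" where
  "iterated_logarithm \<mu> \<phi> P \<omega> \<sigma> \<longleftrightarrow>
     \<sigma> > 0 \<and>
     (AE x in P. limsup (\<lambda>n. ereal ((\<phi> (walk \<omega> n x) - real n * distortion \<mu> \<phi>)
                                     / sqrt (2 * real n * ln (ln (real n))))) = ereal \<sigma>)"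

end

theory Submission
  imports Defs "HOL-Real_Asymp.Real_Asymp"
begin

text \<open>
  Let \<open>D\<close> bound the defect of the quasimorphism \<open>\<phi>\<close>, and let \<open>e\<^sub>n\<close> and \<open>v\<^sub>n\<close> be the mean and the variance
  of \<open>\<phi>\<close> under the \<open>n\<close>-th convolution power. Fix a horizon \<open>n\<close>. The conditional expectation of
  \<open>\<phi>(z\<^sub>n)\<close> given the first \<open>k\<close> steps is \<open>forward (n - k)\<close> evaluated at \<open>z\<^sub>k\<close>, so it is a martingale in \<open>k\<close>
  that ends in \<open>\<phi>(z\<^sub>n)\<close>. The point of the whole proof is \<open>jump_bound\<close>: its increment over a
  block with product \<open>h\<close> of \<open>m\<close> steps differs from \<open>\<phi> h - e\<^sub>m\<close> by at most \<open>4 D\<close>, whatever the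
  starting point. Blocks of length \<open>m\<close> thus behave like independent summands up to a bounded error,
  which for large \<open>m\<close> is negligible against \<open>sqrt m\<close>, the scale of their fluctuations.

  Orthogonality of the increments gives \<open>v\<^sub>p\<^sub>m = p v\<^sub>m + O(p sqrt m)\<close>, hence \<open>v\<^sub>n / n\<close> converges to some
  \<open>\<sigma>\<^sup>2\<close> (\<open>var_sigma2\<close>). If \<open>\<sigma> = 0\<close>, then no block can have \<open>\<bar>\<phi> h - e\<^sub>m\<bar> > 4 D\<close> with positive probability,
  since each occurrence would contribute a fixed amount to the variance; this is tameness
  (\<open>tame_iff\<close>).

  For the central limit theorem, each block multiplies the characteristic function of the rescaled
  martingale by almost the same factor, that of a Gaussian with variance \<open>m \<sigma>\<^sup>2\<close> on the same scale; the
  number of blocks tends to infinity first and their length afterwards (\<open>conv_char_tendsto\<close>).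

  The upper half of the law of the iterated logarithm follows the pattern of Hartman and Wintner.
  At times up to \<open>r\<^sup>k\<close>, every step on which \<open>\<bar>\<phi>\<bar> + 3 D\<close> exceeds a small multiple of \<open>sqrt (r\<^sup>k / ln k)\<close>
  is replaced by the neutral element. This changes \<open>\<phi>\<close> along the walk by at most the sum of the
  values of \<open>\<bar>\<phi>\<bar> + 3 D\<close> on these steps, and a second moment makes the total of these changes summable over the scales
  (\<open>weighted_excess_summable\<close>). The truncated walk has bounded block increments, so exponential moments
  (\<open>exponential_tail\<close>), a maximal inequality (\<open>maximal_inequality\<close>) and the Borel--Cantelli lemma
  apply.

  The lower half follows the idea of de Acosta. A stretch of time is split into about \<open>ln k / \<theta>\<close> blocks.
  By the central limit theorem each of them exceeds its share of the target with probability at least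
  \<open>exp (- \<theta>)\<close> (\<open>block_tail_eventually\<close>), so all do with probability of order \<open>1 / k\<close>. These events
  are independent for disjoint stretches, hence infinitely many of them occur.
\<close>

section \<open>Convolution powers\<close>

lemma borel_measurable_plus_pair [measurable]:
  "(\<lambda>(x, y). x + y :: 'a::{topological_group_add, second_countable_topology})
     \<in> borel \<Otimes>\<^sub>M borel \<rightarrow>\<^sub>M borel"
  unfolding case_prod_beta by measurable

lemma sets_convolution_power [simp, measurable_cong]:
  "sets (convolution_power \<mu> n) = sets borel"
  by (cases n) (simp_all add: group_convolution_def)

lemma space_convolution_power [simp]: "space (convolution_power \<mu> n) = UNIV"
  using sets_eq_imp_space_eq[OF sets_convolution_power] by simp

lemma prob_space_group_convolution:
  fixes M N :: "'a::{topological_group_add, second_countable_topology} measure"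
  assumes "prob_space M" "prob_space N" and [measurable_cong]: "sets M = sets borel" "sets N = sets borel"
  shows "prob_space (group_convolution M N)"
proof -
  interpret M: prob_space M by fact
  interpret N: prob_space N by fact
  interpret pair_prob_space M N ..
  show ?thesis unfolding group_convolution_def by (rule prob_space_distr) simp
qed

lemma prob_space_convolution_power:
  fixes \<mu> :: "'a::{topological_group_add, second_countable_topology} measure"
  assumes "prob_space \<mu>" "sets \<mu> = sets borel"
  shows "prob_space (convolution_power \<mu> n)"
proof (induction n)
  case 0
  then show ?case by (simp add: prob_space_return)
next
  case (Suc n)
  then show ?case using assms by (simp add: prob_space_group_convolution)
qed

lemma nn_integral_group_convolution:
  fixes M N :: "'a::{topological_group_add, second_countable_topology} measure"
  assumes "prob_space M" "prob_space N" and [measurable_cong]: "sets M = sets borel" "sets N = sets borel"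
    and [measurable]: "f \<in> borel_measurable borel"
  shows "(\<integral>\<^sup>+z. f z \<partial>group_convolution M N) = (\<integral>\<^sup>+x. \<integral>\<^sup>+y. f (x + y) \<partial>N \<partial>M)"
proof -
  interpret N: prob_space N by fact
  show ?thesis unfolding group_convolution_def
    by (subst nn_integral_distr) (simp_all add: case_prod_beta N.nn_integral_fst[symmetric])
qed

lemma nn_integral_convolution_power_add:
  fixes \<mu> :: "'a::{topological_group_add, second_countable_topology} measure"
  assumes p: "prob_space \<mu>" and s: "sets \<mu> = sets borel"
    and f: "f \<in> borel_measurable borel"
  shows "(\<integral>\<^sup>+z. f z \<partial>convolution_power \<mu> (m + n)) =
         (\<integral>\<^sup>+x. \<integral>\<^sup>+y. f (x + y) \<partial>convolution_power \<mu> n \<partial>convolution_power \<mu> m)"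
  using f
proof (induction n arbitrary: f)
  case 0
  then show ?case by (simp add: nn_integral_return)
next
  case (Suc n)
  note [measurable] = Suc.prems and [measurable_cong] = s
  note pc = prob_space_convolution_power[OF p s]
  interpret prob_space \<mu> by fact
  have "(\<integral>\<^sup>+z. f z \<partial>convolution_power \<mu> (m + Suc n)) =
        (\<integral>\<^sup>+z. \<integral>\<^sup>+h. f (z + h) \<partial>\<mu> \<partial>convolution_power \<mu> (m + n))"
    using nn_integral_group_convolution[OF pc p _ s Suc.prems] by simp
  also have "\<dots> = (\<integral>\<^sup>+x. \<integral>\<^sup>+y. \<integral>\<^sup>+h. f (x + y + h) \<partial>\<mu> \<partial>convolution_power \<mu> n \<partial>convolution_power \<mu> m)"
    by (rule Suc.IH) measurable
  also have "\<dots> = (\<integral>\<^sup>+x. \<integral>\<^sup>+y. f (x + y) \<partial>convolution_power \<mu> (Suc n) \<partial>convolution_power \<mu> m)"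
    by (simp add: nn_integral_group_convolution[OF pc p sets_convolution_power s] add.assoc)
  finally show ?case .
qed

lemma convolution_power_add:
  fixes \<mu> :: "'a::{topological_group_add, second_countable_topology} measure"
  assumes p: "prob_space \<mu>" and s: "sets \<mu> = sets borel"
  shows "convolution_power \<mu> (m + n) = group_convolution (convolution_power \<mu> m) (convolution_power \<mu> n)"
proof (rule measure_eqI)
  fix A assume "A \<in> sets (convolution_power \<mu> (m + n))"
  then have A: "A \<in> sets borel" by simp
  have "(\<integral>\<^sup>+z. indicator A z \<partial>convolution_power \<mu> (m + n)) =
    (\<integral>\<^sup>+z. indicator A z \<partial>group_convolution (convolution_power \<mu> m) (convolution_power \<mu> n))"
    using A by (subst nn_integral_convolution_power_add[OF p s], simp,
        subst nn_integral_group_convolution) (simp_all add: prob_space_convolution_power[OF p s])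
  then show "emeasure (convolution_power \<mu> (m + n)) A =
      emeasure (group_convolution (convolution_power \<mu> m) (convolution_power \<mu> n)) A"
    using A by (simp add: group_convolution_def)
qed (simp add: group_convolution_def)

lemma integral_convolution_power_add:
  fixes \<mu> :: "'a::{topological_group_add, second_countable_topology} measure"
    and f :: "'a \<Rightarrow> 'b::{banach, second_countable_topology}"
  assumes p: "prob_space \<mu>" and s: "sets \<mu> = sets borel"
    and f: "integrable (convolution_power \<mu> (m + n)) f"
  shows "(\<integral>z. f z \<partial>convolution_power \<mu> (m + n)) =
        (\<integral>x. (\<integral>y. f (x + y) \<partial>convolution_power \<mu> n) \<partial>convolution_power \<mu> m)"
proof -
  note pc = prob_space_convolution_power[OF p s]
  interpret M: prob_space "convolution_power \<mu> m" by (rule pc)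
  interpret N: prob_space "convolution_power \<mu> n" by (rule pc)
  interpret pair_prob_space "convolution_power \<mu> m" "convolution_power \<mu> n" ..
  have fm[measurable]: "f \<in> borel_measurable borel"
    using borel_measurable_integrable[OF f] by (simp cong: measurable_cong_sets)
  have i: "integrable (convolution_power \<mu> m \<Otimes>\<^sub>M convolution_power \<mu> n) (\<lambda>(x, y). f (x + y))"
    using f unfolding convolution_power_add[OF p s] group_convolution_def
    by (subst (asm) integrable_distr_eq) (simp_all add: case_prod_beta')
  show "(\<integral>z. f z \<partial>convolution_power \<mu> (m + n)) =
        (\<integral>x. (\<integral>y. f (x + y) \<partial>convolution_power \<mu> n) \<partial>convolution_power \<mu> m)"
    unfolding convolution_power_add[OF p s] group_convolution_def
    by (subst integral_distr) (use integral_fst'[OF i] in \<open>simp_all add: case_prod_beta'\<close>)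
qed

section \<open>Mean and variance along the convolution powers\<close>

text \<open>
  A sequence whose averages over \<open>m\<close> and over \<open>p m\<close> are close for all \<open>p\<close> has convergent averages:
  the averages over \<open>m\<close> and over \<open>p\<close> are both compared with the one over \<open>p m\<close>.
\<close>

lemma block_limit:
  fixes a :: "nat \<Rightarrow> real"
  assumes a: "\<And>m p. m \<ge> 1 \<Longrightarrow> p \<ge> 1 \<Longrightarrow> \<bar>a (p * m) / real (p * m) - a m / real m\<bar> \<le> f m"
    and f: "f \<longlonglongrightarrow> 0"
  obtains L where "(\<lambda>n. a n / real n) \<longlonglongrightarrow> L"
    and "\<And>m. m \<ge> 1 \<Longrightarrow> \<bar>a m / real m - L\<bar> \<le> f m"
proof -
  have two: "\<bar>a m / real m - a p / real p\<bar> \<le> f m + f p" if "m \<ge> 1" "p \<ge> 1" for m p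
    using a[OF that] a[OF that(2,1)] by (simp add: mult.commute)
  have "Cauchy (\<lambda>n. a n / real n)"
  proof (rule metric_CauchyI)
    fix \<epsilon> :: real assume "\<epsilon> > 0"
    then have "eventually (\<lambda>n. \<bar>f n\<bar> < \<epsilon> / 2) sequentially"
      using f by (auto dest!: tendstoD[of _ _ _ "\<epsilon> / 2"] simp: dist_real_def)
    then obtain M where M: "\<And>n. n \<ge> M \<Longrightarrow> \<bar>f n\<bar> < \<epsilon> / 2"
      by (auto simp: eventually_sequentially)
    show "\<exists>M. \<forall>m\<ge>M. \<forall>n\<ge>M. dist (a m / real m) (a n / real n) < \<epsilon>"
    proof (intro exI[of _ "max 1 M"] allI impI)
      fix m n assume "max 1 M \<le> m" "max 1 M \<le> n"
      then show "dist (a m / real m) (a n / real n) < \<epsilon>"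
        using two[of m n] M[of m] M[of n] by (auto simp: dist_real_def abs_less_iff)
    qed
  qed
  then obtain L where L: "(\<lambda>n. a n / real n) \<longlonglongrightarrow> L"
    by (auto simp: convergent_eq_Cauchy[symmetric] convergent_def dest: Cauchy_convergent)
  have "\<bar>a m / real m - L\<bar> \<le> f m" if m: "m \<ge> 1" for m
  proof (rule tendsto_upperbound)
    have "filterlim (\<lambda>p. p * m) sequentially sequentially"
      using m by (intro filterlim_subseq) (auto intro!: strict_monoI)
    from filterlim_compose[OF L this]
    show "(\<lambda>p. \<bar>a m / real m - a (p * m) / real (p * m)\<bar>) \<longlonglongrightarrow> \<bar>a m / real m - L\<bar>"
      by (intro tendsto_intros)
    show "eventually (\<lambda>p. \<bar>a m / real m - a (p * m) / real (p * m)\<bar> \<le> f m) sequentially"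
      using eventually_ge_at_top[of 1] by eventually_elim (use a[OF m] in \<open>simp add: abs_minus_commute\<close>)
  qed simp
  with L that show thesis by blast
qed

lemma (in prob_space) expectation_abs_le_sqrt:
  fixes X :: "'a \<Rightarrow> real"
  assumes [measurable]: "X \<in> borel_measurable M" and X2: "integrable M (\<lambda>x. (X x)\<^sup>2)"
  shows "expectation (\<lambda>x. \<bar>X x\<bar>) \<le> sqrt (expectation (\<lambda>x. (X x)\<^sup>2))"
proof -
  have "integrable M X" by (rule square_integrable_imp_integrable) fact+
  then have "(expectation (\<lambda>x. \<bar>X x\<bar>))\<^sup>2 \<le> expectation (\<lambda>x. \<bar>X x\<bar>\<^sup>2)"
    using variance_positive[of "\<lambda>x. \<bar>X x\<bar>"] variance_eq[of "\<lambda>x. \<bar>X x\<bar>"] X2 by simp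
  then show ?thesis by (intro real_le_rsqrt) simp
qed

lemma (in prob_space) second_moment_perturbation:
  fixes X Y :: "'a \<Rightarrow> real"
  assumes X[measurable]: "X \<in> borel_measurable M" and X2: "integrable M (\<lambda>x. (X x)\<^sup>2)"
    and Y[measurable]: "Y \<in> borel_measurable M" and c: "\<And>x. \<bar>Y x - X x\<bar> \<le> c"
  shows "integrable M (\<lambda>x. (Y x)\<^sup>2)"
    and "\<bar>(\<integral>x. (Y x)\<^sup>2 \<partial>M) - (\<integral>x. (X x)\<^sup>2 \<partial>M)\<bar> \<le> 2 * c * sqrt (\<integral>x. (X x)\<^sup>2 \<partial>M) + c\<^sup>2"
proof -
  have c0: "0 \<le> c" using c[of undefined] by linarith
  have Xi: "integrable M X" by (rule square_integrable_imp_integrable) fact+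
  have pw: "\<bar>(Y x)\<^sup>2 - (X x)\<^sup>2\<bar> \<le> 2 * c * \<bar>X x\<bar> + c\<^sup>2" for x
  proof -
    have "\<bar>(Y x)\<^sup>2 - (X x)\<^sup>2\<bar> = \<bar>Y x - X x\<bar> * \<bar>Y x + X x\<bar>"
      by (simp add: power2_eq_square abs_mult[symmetric] algebra_simps)
    also have "\<dots> \<le> c * (2 * \<bar>X x\<bar> + c)"
      using c[of x] by (intro mult_mono) auto
    finally show ?thesis by (simp add: power2_eq_square algebra_simps)
  qed
  have d: "integrable M (\<lambda>x. (Y x)\<^sup>2 - (X x)\<^sup>2)"
    by (rule Bochner_Integration.integrable_bound[of _ "\<lambda>x. 2 * c * \<bar>X x\<bar> + c\<^sup>2"])
      (use Xi pw c0 in \<open>auto intro!: AE_I2\<close>)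
  from Bochner_Integration.integrable_add[OF this X2]
  show Y2: "integrable M (\<lambda>x. (Y x)\<^sup>2)" by simp
  have a: "(\<integral>x. \<bar>X x\<bar> \<partial>M) \<le> sqrt (\<integral>x. (X x)\<^sup>2 \<partial>M)"
    by (rule expectation_abs_le_sqrt) fact+
  have "\<bar>(\<integral>x. (Y x)\<^sup>2 \<partial>M) - (\<integral>x. (X x)\<^sup>2 \<partial>M)\<bar> = \<bar>\<integral>x. (Y x)\<^sup>2 - (X x)\<^sup>2 \<partial>M\<bar>"
    using X2 Y2 by simp
  also have "\<dots> \<le> (\<integral>x. 2 * c * \<bar>X x\<bar> + c\<^sup>2 \<partial>M)"
    using d Xi pw by (intro order.trans[OF integral_abs_bound] integral_mono) auto
  also have "\<dots> = 2 * c * (\<integral>x. \<bar>X x\<bar> \<partial>M) + c\<^sup>2"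
    using Xi by (simp add: prob_space)
  also have "\<dots> \<le> 2 * c * sqrt (\<integral>x. (X x)\<^sup>2 \<partial>M) + c\<^sup>2"
    using a c0 by (intro add_mono mult_left_mono) auto
  finally show "\<bar>(\<integral>x. (Y x)\<^sup>2 \<partial>M) - (\<integral>x. (X x)\<^sup>2 \<partial>M)\<bar> \<le> 2 * c * sqrt (\<integral>x. (X x)\<^sup>2 \<partial>M) + c\<^sup>2" .
qed

lemma (in prob_space) abs_expectation_minus_le:
  fixes X :: "'a \<Rightarrow> real"
  assumes X: "integrable M X" and c: "\<And>x. \<bar>X x - a\<bar> \<le> c"
  shows "\<bar>expectation X - a\<bar> \<le> c"
proof -
  have "expectation X \<le> a + c" "a - c \<le> expectation X"
    using integral_mono[OF X, of "\<lambda>_. a + c"] integral_mono[OF _ X, of "\<lambda>_. a - c"] c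
    by (auto simp: prob_space abs_le_iff algebra_simps)
  then show ?thesis by linarith
qed

locale quasimorphism_walk = prob_space \<mu>
  for \<mu> :: "'a::{topological_group_add, second_countable_topology} measure" +
  fixes \<phi> :: "'a \<Rightarrow> real" and D :: real
  assumes sets_mu [measurable_cong]: "sets \<mu> = sets borel"
    and phi_measurable [measurable]: "\<phi> \<in> borel_measurable borel"
    and quasi: "\<And>g h. \<bar>\<phi> (g + h) - \<phi> g - \<phi> h\<bar> \<le> D"
    and square_integrable: "integrable \<mu> (\<lambda>g. (\<phi> g)\<^sup>2)"
begin

abbreviation conv :: "nat \<Rightarrow> 'a measure" where "conv n \<equiv> convolution_power \<mu> n"

lemma prob_space_conv: "prob_space (conv n)"
  by (rule prob_space_convolution_power[OF prob_space_axioms sets_mu])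

sublocale conv: prob_space "conv n" for n
  by (rule prob_space_conv)

lemma conv_1: "conv (Suc 0) = \<mu>"
proof (rule measure_eqI)
  fix A assume "A \<in> sets (conv (Suc 0))"
  then have A[measurable]: "A \<in> sets borel" by (simp only: sets_convolution_power)
  have "(\<integral>\<^sup>+z. indicator A z \<partial>conv (Suc 0)) = (\<integral>\<^sup>+z. indicator A z \<partial>\<mu>)"
    by (simp add: nn_integral_group_convolution[OF _ prob_space_axioms _ sets_mu]
        prob_space_return nn_integral_return del: nn_integral_indicator)
  then show "emeasure (conv (Suc 0)) A = emeasure \<mu> A"
    using A by (simp add: sets_mu group_convolution_def)
qed (simp add: sets_mu group_convolution_def)

lemma D_nonneg: "0 \<le> D"
  using quasi[of 0 0] by linarith

lemma phi_0: "\<bar>\<phi> 0\<bar> \<le> D"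
  using quasi[of 0 0] by simp

lemma square_integrable_conv: "integrable (conv n) (\<lambda>g. (\<phi> g)\<^sup>2)"
proof (induction n)
  case 0
  have "AE g in conv 0. norm ((\<phi> g)\<^sup>2) \<le> (\<phi> 0)\<^sup>2"
    unfolding convolution_power.simps by (subst AE_return) auto
  then show ?case
    by (rule conv.integrable_const_bound) measurable
next
  case (Suc n)
  have pw: "(\<phi> (g + h))\<^sup>2 \<le> 3 * (\<phi> g)\<^sup>2 + (3 * (\<phi> h)\<^sup>2 + 3 * D\<^sup>2)" for g h
  proof -
    have *: "(a + b + c)\<^sup>2 \<le> 3 * a\<^sup>2 + (3 * b\<^sup>2 + 3 * c\<^sup>2)" for a b c :: real
      using zero_le_power2[of "a - b"] zero_le_power2[of "a - c"] zero_le_power2[of "b - c"]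
      by (simp add: power2_eq_square algebra_simps)
    have "\<bar>\<phi> (g + h)\<bar> \<le> \<bar>\<bar>\<phi> g\<bar> + \<bar>\<phi> h\<bar> + D\<bar>"
      using quasi[of g h] D_nonneg by auto
    then have "(\<phi> (g + h))\<^sup>2 \<le> (\<bar>\<phi> g\<bar> + \<bar>\<phi> h\<bar> + D)\<^sup>2"
      by (simp only: abs_le_square_iff)
    also note *
    finally show ?thesis by simp
  qed
  have fin: "(\<integral>\<^sup>+g. ennreal (3 * (\<phi> g)\<^sup>2) \<partial>M) < \<infinity>"
    if "integrable M (\<lambda>g. (\<phi> g)\<^sup>2)" for M
    using integrable_mult_right[OF that, of 3] by (subst nn_integral_eq_integral) auto
  have "(\<integral>\<^sup>+z. ennreal ((\<phi> z)\<^sup>2) \<partial>conv (Suc n)) =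
        (\<integral>\<^sup>+g. \<integral>\<^sup>+h. ennreal ((\<phi> (g + h))\<^sup>2) \<partial>\<mu> \<partial>conv n)"
    by (simp add: nn_integral_group_convolution[OF prob_space_conv prob_space_axioms _ sets_mu])
  also have "\<dots> \<le> (\<integral>\<^sup>+g. \<integral>\<^sup>+h. ennreal (3 * (\<phi> g)\<^sup>2) + (ennreal (3 * (\<phi> h)\<^sup>2) + ennreal (3 * D\<^sup>2)) \<partial>\<mu> \<partial>conv n)"
    by (intro nn_integral_mono) (use pw in \<open>simp flip: ennreal_plus\<close>)
  also have "\<dots> = (\<integral>\<^sup>+g. ennreal (3 * (\<phi> g)\<^sup>2) \<partial>conv n) +
      ((\<integral>\<^sup>+h. ennreal (3 * (\<phi> h)\<^sup>2) \<partial>\<mu>) + ennreal (3 * D\<^sup>2))"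
    by (simp add: nn_integral_add emeasure_space_1 conv.emeasure_space_1[simplified])
  also have "\<dots> < \<infinity>"
    using fin[OF Suc] fin[OF square_integrable] by simp
  finally show ?case
    by (intro integrableI_nonneg) (auto simp del: convolution_power.simps)
qed

lemma integrable_phi_conv: "integrable (conv n) \<phi>"
  by (rule conv.square_integrable_imp_integrable[OF _ square_integrable_conv]) simp

lemma integrable_translate: "integrable (conv n) (\<lambda>h. \<phi> (g + h))"
proof (rule Bochner_Integration.integrable_bound)
  show "integrable (conv n) (\<lambda>h. \<bar>\<phi> g\<bar> + \<bar>\<phi> h\<bar> + D)"
    using integrable_phi_conv by auto
  show "AE h in conv n. norm (\<phi> (g + h)) \<le> norm (\<bar>\<phi> g\<bar> + \<bar>\<phi> h\<bar> + D)"
  proof (rule AE_I2)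
    fix h show "norm (\<phi> (g + h)) \<le> norm (\<bar>\<phi> g\<bar> + \<bar>\<phi> h\<bar> + D)"
      using quasi[of g h] D_nonneg by auto
  qed
qed measurable

definition mean :: "nat \<Rightarrow> real" where "mean n = (\<integral>g. \<phi> g \<partial>conv n)"

text \<open>The conditional expectation of the final value of \<open>\<phi>\<close>, given that the walk stands at \<open>g\<close> and has
  \<open>j\<close> steps to go.\<close>

definition forward :: "nat \<Rightarrow> 'a \<Rightarrow> real" where "forward j g = (\<integral>h. \<phi> (g + h) \<partial>conv j)"

definition jump :: "nat \<Rightarrow> nat \<Rightarrow> 'a \<Rightarrow> 'a \<Rightarrow> real" where
  "jump j m g h = forward j (g + h) - forward (m + j) g"

definition var :: "nat \<Rightarrow> real" where "var n = (\<integral>g. (\<phi> g - mean n)\<^sup>2 \<partial>conv n)"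

lemma forward_measurable [measurable]: "forward j \<in> borel_measurable borel"
  unfolding forward_def by measurable

lemma forward_0 [simp]: "forward 0 g = \<phi> g"
  unfolding forward_def by (simp add: integral_return)

lemma forward_at_0 [simp]: "forward j 0 = mean j"
  by (simp add: forward_def mean_def)

lemma forward_bound: "\<bar>forward j g - (\<phi> g + mean j)\<bar> \<le> D"
proof -
  have "\<bar>conv.expectation j (\<lambda>h. \<phi> (g + h) - \<phi> g - \<phi> h) - 0\<bar> \<le> D"
    using integrable_translate integrable_phi_conv quasi
    by (intro conv.abs_expectation_minus_le) auto
  then show ?thesis
    using integrable_translate integrable_phi_conv
    by (simp add: forward_def mean_def conv.prob_space[simplified] algebra_simps)
qed

lemma integrable_forward_translate: "integrable (conv m) (\<lambda>h. forward j (g + h))"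
proof (rule Bochner_Integration.integrable_bound)
  show "integrable (conv m) (\<lambda>h. \<bar>\<phi> (g + h)\<bar> + \<bar>mean j\<bar> + D)"
    using integrable_translate by auto
  show "AE h in conv m. norm (forward j (g + h)) \<le> norm (\<bar>\<phi> (g + h)\<bar> + \<bar>mean j\<bar> + D)"
  proof (rule AE_I2)
    fix h show "norm (forward j (g + h)) \<le> norm (\<bar>\<phi> (g + h)\<bar> + \<bar>mean j\<bar> + D)"
      using forward_bound[of j "g + h"] D_nonneg by auto
  qed
qed measurable

lemma forward_add: "forward (m + j) g = (\<integral>h. forward j (g + h) \<partial>conv m)"
  unfolding forward_def
  using integral_convolution_power_add[OF prob_space_axioms sets_mu integrable_translate]
  by (simp add: add.assoc)

lemma mean_add: "mean (m + j) = (\<integral>g. forward j g \<partial>conv m)"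
  using forward_add[of m j 0] by simp

lemma mean_quasi: "\<bar>mean (m + j) - mean m - mean j\<bar> \<le> D"
proof -
  have "\<bar>conv.expectation m (\<lambda>g. forward j g - \<phi> g) - mean j\<bar> \<le> D"
    using integrable_forward_translate[of m j 0] integrable_phi_conv forward_bound
    by (intro conv.abs_expectation_minus_le) (auto simp: algebra_simps)
  then show ?thesis
    using integrable_forward_translate[of m j 0] integrable_phi_conv
    by (simp add: mean_add mean_def[of m])
qed

lemma jump_integral: "(\<integral>h. jump j m g h \<partial>conv m) = 0"
  and jump_integrable: "integrable (conv m) (jump j m g)"
  using integrable_forward_translate
  by (auto simp: jump_def[abs_def] forward_add conv.prob_space[simplified])

text \<open>
  The key estimate. The martingale increment over a block forgets the starting point \<open>g\<close> up to
  a constant: each use of the quasimorphism inequality, in \<open>forward_bound\<close>, \<open>mean_quasi\<close> and for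
  \<open>g + h\<close>, costs one \<open>D\<close>, and \<open>forward_bound\<close> is used twice.
\<close>

lemma jump_bound: "\<bar>jump j m g h - (\<phi> h - mean m)\<bar> \<le> 4 * D"
  using forward_bound[of j "g + h"] forward_bound[of "m + j" g] quasi[of g h] mean_quasi[of m j]
  unfolding jump_def by linarith

lemma var_nonneg: "0 \<le> var n"
  unfolding var_def by simp

lemma square_integrable_centered: "integrable (conv n) (\<lambda>g. (\<phi> g - c)\<^sup>2)"
  using square_integrable_conv integrable_phi_conv by (simp add: power2_diff)

lemma jump_square_integrable: "integrable (conv m) (\<lambda>h. (jump j m g h)\<^sup>2)"
  and jump_second_moment:
    "\<bar>(\<integral>h. (jump j m g h)\<^sup>2 \<partial>conv m) - var m\<bar> \<le> 8 * D * sqrt (var m) + 16 * D\<^sup>2"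
  using conv.second_moment_perturbation[of "\<lambda>h. \<phi> h - mean m" m "jump j m g", OF _ square_integrable_centered _ jump_bound]
  by (auto simp: var_def power_mult_distrib jump_def[abs_def])

text \<open>
  The variance of the martingale for the horizon \<open>i + j\<close> after \<open>i\<close> steps; it grows from \<open>0\<close> to
  \<open>var (i + j)\<close> as \<open>i\<close> increases with \<open>i + j\<close> fixed.
\<close>

definition spread :: "nat \<Rightarrow> nat \<Rightarrow> real" where
  "spread i j = (\<integral>g. (forward j g - mean (i + j))\<^sup>2 \<partial>conv i)"

lemma spread_0 [simp]: "spread 0 j = 0" "spread i 0 = var i"
  by (simp_all add: spread_def var_def integral_return)

lemma forward_square_integrable: "integrable (conv i) (\<lambda>g. (forward j g - c)\<^sup>2)"
proof (rule conv.second_moment_perturbation(1)[where c = D])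
  show "\<bar>forward j g - c - (\<phi> g - (c - mean j))\<bar> \<le> D" for g
    using forward_bound[of j g] by linarith
qed (auto simp: square_integrable_centered)

lemma jump_second_moment_integrable:
  "integrable (conv i) (\<lambda>g. \<integral>h. (jump j m g h)\<^sup>2 \<partial>conv m)"
proof (rule conv.integrable_const_bound)
  show "AE g in conv i. norm (\<integral>h. (jump j m g h)\<^sup>2 \<partial>conv m) \<le> var m + (8 * D * sqrt (var m) + 16 * D\<^sup>2)"
  proof (rule AE_I2)
    fix g
    have "0 \<le> (\<integral>h. (jump j m g h)\<^sup>2 \<partial>conv m)" by simp
    then show "norm (\<integral>h. (jump j m g h)\<^sup>2 \<partial>conv m) \<le> var m + (8 * D * sqrt (var m) + 16 * D\<^sup>2)"
      using jump_second_moment[of m j g] by (simp add: abs_le_iff)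
  qed
  show "(\<lambda>g. \<integral>h. (jump j m g h)\<^sup>2 \<partial>conv m) \<in> borel_measurable (conv i)"
    unfolding jump_def by measurable
qed

text \<open>Orthogonality of martingale increments: the cross term vanishes by \<open>jump_integral\<close>.\<close>

lemma spread_step:
  "spread (i + m) j = spread i (m + j) + (\<integral>g. (\<integral>h. (jump j m g h)\<^sup>2 \<partial>conv m) \<partial>conv i)"
proof -
  define E where "E = mean (i + m + j)"
  have inner: "(\<integral>h. (forward j (g + h) - E)\<^sup>2 \<partial>conv m) =
      (forward (m + j) g - E)\<^sup>2 + (\<integral>h. (jump j m g h)\<^sup>2 \<partial>conv m)" for g
  proof -
    define a where "a = forward (m + j) g - E"
    have "(forward j (g + h) - E)\<^sup>2 = a\<^sup>2 + (2 * a) * jump j m g h + (jump j m g h)\<^sup>2" for h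
      by (simp add: a_def jump_def power2_eq_square algebra_simps)
    then have "(\<integral>h. (forward j (g + h) - E)\<^sup>2 \<partial>conv m) =
        (\<integral>h. a\<^sup>2 + (2 * a) * jump j m g h + (jump j m g h)\<^sup>2 \<partial>conv m)"
      by simp
    also have "\<dots> = (\<integral>h. a\<^sup>2 \<partial>conv m) + (\<integral>h. (2 * a) * jump j m g h \<partial>conv m)
        + (\<integral>h. (jump j m g h)\<^sup>2 \<partial>conv m)"
      using jump_integrable jump_square_integrable by (subst Bochner_Integration.integral_add; simp)+
    also have "\<dots> = a\<^sup>2 + (\<integral>h. (jump j m g h)\<^sup>2 \<partial>conv m)"
      by (simp add: jump_integral conv.prob_space[simplified])
    finally show ?thesis by (simp add: a_def)
  qed
  have "spread (i + m) j = (\<integral>g. (\<integral>h. (forward j (g + h) - E)\<^sup>2 \<partial>conv m) \<partial>conv i)"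
    unfolding spread_def E_def
    by (rule integral_convolution_power_add[OF prob_space_axioms sets_mu forward_square_integrable])
  also have "\<dots> = (\<integral>g. (forward (m + j) g - E)\<^sup>2 \<partial>conv i) + (\<integral>g. (\<integral>h. (jump j m g h)\<^sup>2 \<partial>conv m) \<partial>conv i)"
    unfolding inner
    by (intro Bochner_Integration.integral_add forward_square_integrable jump_second_moment_integrable)
  finally show ?thesis by (simp add: spread_def E_def add.assoc)
qed

lemma spread_bounds:
  assumes "\<And>j g. lo \<le> (\<integral>h. (jump j m g h)\<^sup>2 \<partial>conv m)" "\<And>j g. (\<integral>h. (jump j m g h)\<^sup>2 \<partial>conv m) \<le> hi"
  shows "real p * lo \<le> spread (p * m) j \<and> spread (p * m) j \<le> real p * hi"
proof (induction p arbitrary: j)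
  case (Suc p)
  have "lo \<le> (\<integral>g. (\<integral>h. (jump j m g h)\<^sup>2 \<partial>conv m) \<partial>conv (p * m))"
    using integral_mono[OF _ jump_second_moment_integrable, of "p * m" "\<lambda>_. lo" m j] assms
    by (simp add: conv.prob_space[simplified])
  moreover have "(\<integral>g. (\<integral>h. (jump j m g h)\<^sup>2 \<partial>conv m) \<partial>conv (p * m)) \<le> hi"
    using integral_mono[OF jump_second_moment_integrable, of "p * m" "\<lambda>_. hi" m j] assms
    by (simp add: conv.prob_space[simplified])
  ultimately show ?case
    using Suc.IH[of "m + j"] spread_step[of "p * m" m j] by (simp add: algebra_simps)
qed simp

lemma var_bounds:
  assumes "\<And>j g. lo \<le> (\<integral>h. (jump j m g h)\<^sup>2 \<partial>conv m)" "\<And>j g. (\<integral>h. (jump j m g h)\<^sup>2 \<partial>conv m) \<le> hi"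
  shows "real p * lo \<le> var (p * m)" "var (p * m) \<le> real p * hi"
  using spread_bounds[OF assms, of p 0] by simp_all

lemma var_block: "\<bar>var (p * m) - real p * var m\<bar> \<le> real p * (8 * D * sqrt (var m) + 16 * D\<^sup>2)"
proof -
  have "var m - (8 * D * sqrt (var m) + 16 * D\<^sup>2) \<le> (\<integral>h. (jump j m g h)\<^sup>2 \<partial>conv m)"
    "(\<integral>h. (jump j m g h)\<^sup>2 \<partial>conv m) \<le> var m + (8 * D * sqrt (var m) + 16 * D\<^sup>2)" for j g
    using jump_second_moment[of m j g] unfolding abs_le_iff by linarith+
  from var_bounds[OF this, of p] show ?thesis
    unfolding abs_le_iff by (simp add: algebra_simps)
qed

text \<open>
  An upper bound for the conditional second moment of a one-step increment, hence for the growth of the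
  variance per step.
\<close>

definition var_rate :: real where "var_rate = var 1 + 8 * D * sqrt (var 1) + 16 * D\<^sup>2"

lemma var_rate_nonneg: "0 \<le> var_rate"
  using var_nonneg[of 1] D_nonneg by (simp add: var_rate_def)

lemma var_le: "var n \<le> real n * var_rate"
  using var_block[of n 1] unfolding var_rate_def abs_le_iff by (simp add: algebra_simps)

text \<open>
  Bounds the error per step that arises when the second moment of an increment over a block of length \<open>m\<close> is
  replaced by \<open>var m\<close>, in terms of \<open>var m \<le> m * var_rate\<close>.
\<close>

definition gap :: "nat \<Rightarrow> real" where "gap m = 8 * D * sqrt (var_rate / real m) + 16 * D\<^sup>2 / real m"

lemma gap_tendsto: "gap \<longlonglongrightarrow> 0"
proof -
  have "(\<lambda>m. 8 * D * sqrt (var_rate * inverse (real m)) + 16 * D\<^sup>2 * inverse (real m))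
      \<longlonglongrightarrow> 8 * D * sqrt (var_rate * 0) + 16 * D\<^sup>2 * 0"
    by (intro tendsto_intros LIMSEQ_inverse_real_of_nat lim_inverse_n)
  then show ?thesis by (simp add: gap_def[abs_def] divide_inverse)
qed

lemma perturbation_le_gap:
  assumes "m \<ge> 1"
  shows "8 * D * sqrt (var m) + 16 * D\<^sup>2 \<le> real m * gap m"
proof -
  have "sqrt (var m) \<le> sqrt (real m * var_rate)" using var_le by simp
  also have "\<dots> = real m * sqrt (var_rate / real m)"
  proof -
    have "real m * sqrt (var_rate / real m) = sqrt ((real m)\<^sup>2 * (var_rate / real m))"
      by (subst real_sqrt_mult) simp
    also have "(real m)\<^sup>2 * (var_rate / real m) = real m * var_rate"
      using assms by (simp add: power2_eq_square)
    finally show ?thesis ..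
  qed
  finally have "8 * D * sqrt (var m) \<le> 8 * D * (real m * sqrt (var_rate / real m))"
    using D_nonneg by (intro mult_left_mono) auto
  then show ?thesis using assms by (simp add: gap_def algebra_simps)
qed

definition sigma2 :: real where "sigma2 = lim (\<lambda>n. var n / real n)"

lemma var_tendsto: "(\<lambda>n. var n / real n) \<longlonglongrightarrow> sigma2"
  and var_sigma2: "m \<ge> 1 \<Longrightarrow> \<bar>var m / real m - sigma2\<bar> \<le> gap m"
proof -
  have "\<bar>var (p * m) / real (p * m) - var m / real m\<bar> \<le> gap m" if "m \<ge> 1" "p \<ge> 1" for m p
  proof -
    have "\<bar>var (p * m) - real p * var m\<bar> \<le> real p * (real m * gap m)"
      using var_block[of p m] mult_left_mono[OF perturbation_le_gap[OF that(1)], of "real p"] by linarith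
    moreover have "var (p * m) / real (p * m) - var m / real m = (var (p * m) - real p * var m) / (real p * real m)"
      using that by (simp add: field_simps)
    ultimately show ?thesis using that by (simp add: abs_mult field_simps)
  qed
  from block_limit[OF this gap_tendsto] obtain L where
    L: "(\<lambda>n. var n / real n) \<longlonglongrightarrow> L" "\<And>m. m \<ge> 1 \<Longrightarrow> \<bar>var m / real m - L\<bar> \<le> gap m"
    by blast
  moreover have "sigma2 = L" unfolding sigma2_def using L(1) by (rule limI)
  ultimately show "(\<lambda>n. var n / real n) \<longlonglongrightarrow> sigma2" "m \<ge> 1 \<Longrightarrow> \<bar>var m / real m - sigma2\<bar> \<le> gap m"
    by auto
qed

lemma sigma2_nonneg: "0 \<le> sigma2"
  by (rule tendsto_lowerbound[OF var_tendsto]) (auto simp: var_nonneg)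

abbreviation ell :: real where "ell \<equiv> distortion \<mu> \<phi>"

lemma mean_ell: "\<bar>mean n - real n * ell\<bar> \<le> D"
proof (cases "n = 0")
  case True
  then show ?thesis using phi_0 by (simp add: mean_def integral_return)
next
  case False
  have block: "\<bar>mean (Suc p * m) - real (Suc p) * mean m\<bar> \<le> real p * D" for p m
  proof (induction p)
    case (Suc p)
    have "\<bar>mean (Suc (Suc p) * m) - mean m - mean (Suc p * m)\<bar> \<le> D"
      using mean_quasi[of m "Suc p * m"] by simp
    moreover have "real (Suc (Suc p)) * mean m = real (Suc p) * mean m + mean m" "real (Suc p) * D = real p * D + D"
      by (simp_all add: algebra_simps)
    ultimately show ?case using Suc.IH by linarith
  qed simp
  have "\<bar>mean (p * m) / real (p * m) - mean m / real m\<bar> \<le> D / real m" if "m \<ge> 1" "p \<ge> 1" for m p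
  proof -
    have "\<bar>mean (p * m) - real p * mean m\<bar> \<le> real p * D"
      using block[of "p - 1" m] that D_nonneg by (simp add: of_nat_diff algebra_simps)
    moreover have "mean (p * m) / real (p * m) - mean m / real m = (mean (p * m) - real p * mean m) / (real p * real m)"
      using that by (simp add: field_simps)
    ultimately show ?thesis using that by (simp add: abs_mult field_simps)
  qed
  moreover have "(\<lambda>m. D / real m) \<longlonglongrightarrow> 0"
    by (rule tendsto_divide_0[OF tendsto_const filterlim_at_top_imp_at_infinity[OF filterlim_real_sequentially]])
  ultimately obtain L where
    L: "(\<lambda>n. mean n / real n) \<longlonglongrightarrow> L" "\<And>m. m \<ge> 1 \<Longrightarrow> \<bar>mean m / real m - L\<bar> \<le> D / real m"
    using block_limit[of mean "\<lambda>m. D / real m"] by blast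
  have "ell = L" unfolding distortion_def using limI[OF L(1)] by (simp add: mean_def)
  then show ?thesis using L(2)[of n] False by (simp add: field_simps abs_le_iff)
qed

text \<open>
  Suppose that \<open>\<bar>\<phi> h - mean m\<bar> > 4 * D\<close> had positive probability under \<open>conv m\<close>. Then every increment
  over a block of length \<open>m\<close> has a second moment above a fixed positive constant, because the increment
  differs from \<open>\<phi> h - mean m\<close> by at most \<open>4 * D\<close>, and the variance grows linearly. So
  \<open>sigma2 = 0\<close> implies tameness with the constant \<open>5 * D\<close>, where one \<open>D\<close> is due to \<open>mean_ell\<close>.
\<close>

lemma tame_iff: "tame \<mu> \<phi> \<longleftrightarrow> sigma2 = 0"
proof
  assume "tame \<mu> \<phi>"
  then obtain C where C: "\<And>n. n \<ge> 1 \<Longrightarrow> AE g in conv n. \<bar>\<phi> g - real n * ell\<bar> \<le> C"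
    unfolding tame_def by blast
  have "var n \<le> (C + D)\<^sup>2" if "n \<ge> 1" for n
  proof -
    have "AE g in conv n. (\<phi> g - mean n)\<^sup>2 \<le> (C + D)\<^sup>2"
      using C[OF that]
    proof eventually_elim
      case (elim g)
      then have "\<bar>\<phi> g - mean n\<bar> \<le> \<bar>C + D\<bar>" using mean_ell[of n] by linarith
      then show ?case by (simp only: abs_le_square_iff)
    qed
    then have "var n \<le> (\<integral>g. (C + D)\<^sup>2 \<partial>conv n)"
      unfolding var_def by (intro integral_mono_AE square_integrable_centered) auto
    then show ?thesis by (simp add: conv.prob_space[simplified])
  qed
  then have "sigma2 \<le> 0"
  proof (intro tendsto_le[OF _ _ var_tendsto])
    show "(\<lambda>n. (C + D)\<^sup>2 / real n) \<longlonglongrightarrow> 0"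
      by (rule tendsto_divide_0[OF tendsto_const filterlim_at_top_imp_at_infinity[OF filterlim_real_sequentially]])
    show "eventually (\<lambda>n. var n / real n \<le> (C + D)\<^sup>2 / real n) sequentially"
      using eventually_ge_at_top[of 1]
      by eventually_elim (use \<open>\<And>n. n \<ge> 1 \<Longrightarrow> var n \<le> (C + D)\<^sup>2\<close> in \<open>simp add: divide_right_mono\<close>)
  qed simp
  with sigma2_nonneg show "sigma2 = 0" by simp
next
  assume s: "sigma2 = 0"
  have "AE g in conv m. \<bar>\<phi> g - real m * ell\<bar> \<le> 5 * D" if m: "m \<ge> 1" for m
  proof -
    define X where "X h = max 0 (\<bar>\<phi> h - mean m\<bar> - 4 * D)" for h
    have [measurable]: "X \<in> borel_measurable borel" unfolding X_def by measurable
    have X: "(X h)\<^sup>2 \<le> (jump j m g h)\<^sup>2" for j g h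
    proof -
      have "\<bar>X h\<bar> \<le> \<bar>jump j m g h\<bar>"
        using jump_bound[of j m g h] by (simp add: X_def)
      then show ?thesis by (simp only: abs_le_square_iff)
    qed
    have Xi: "integrable (conv m) (\<lambda>h. (X h)\<^sup>2)"
      by (rule Bochner_Integration.integrable_bound[OF jump_square_integrable[of m 0 0]]) (use X in auto)
    have "(\<integral>h. (X h)\<^sup>2 \<partial>conv m) \<le> (\<integral>h. (jump j m g h)\<^sup>2 \<partial>conv m)" for j g
      using X by (intro integral_mono Xi jump_square_integrable)
    moreover have "(\<integral>h. (jump j m g h)\<^sup>2 \<partial>conv m) \<le> var m + (8 * D * sqrt (var m) + 16 * D\<^sup>2)" for j g
      using jump_second_moment[of m j g] unfolding abs_le_iff by linarith
    ultimately have lo: "real p * (\<integral>h. (X h)\<^sup>2 \<partial>conv m) \<le> var (p * m)" for p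
      by (rule var_bounds)
    have "(\<integral>h. (X h)\<^sup>2 \<partial>conv m) / real m \<le> sigma2"
    proof (rule tendsto_lowerbound)
      have "filterlim (\<lambda>p. p * m) sequentially sequentially"
        using m by (intro filterlim_subseq) (auto intro!: strict_monoI)
      from filterlim_compose[OF var_tendsto this]
      show "(\<lambda>p. var (p * m) / real (p * m)) \<longlonglongrightarrow> sigma2" .
      show "eventually (\<lambda>p. (\<integral>h. (X h)\<^sup>2 \<partial>conv m) / real m \<le> var (p * m) / real (p * m)) sequentially"
        using eventually_ge_at_top[of 1]
        by eventually_elim (use lo m in \<open>simp add: field_simps\<close>)
    qed simp
    then have "(\<integral>h. (X h)\<^sup>2 \<partial>conv m) \<le> 0" using m s by (simp add: field_simps)
    then have "(\<integral>h. (X h)\<^sup>2 \<partial>conv m) = 0" by (simp add: antisym)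
    then have "AE h in conv m. (X h)\<^sup>2 = 0"
      using Xi by (subst (asm) integral_nonneg_eq_0_iff_AE) auto
    then show ?thesis
    proof eventually_elim
      case (elim h)
      then have "\<bar>\<phi> h - mean m\<bar> \<le> 4 * D" by (simp add: X_def max_def split: if_splits)
      then show ?case using mean_ell[of m] by linarith
    qed
  qed
  then show "tame \<mu> \<phi>" unfolding tame_def by blast
qed

end

section \<open>The central limit theorem\<close>

lemma norm_iexp_minus_1_le: "cmod (iexp x - 1) \<le> \<bar>x\<bar>"
  using iexp_approx1[of x 0] by simp

lemma exp_minus_linear_bound:
  fixes x :: real
  assumes "0 \<le> x"
  shows "\<bar>exp (- x) - (1 - x)\<bar> \<le> x\<^sup>2"
proof -
  have "1 + x \<le> exp x" by simp
  then have "exp (- x) \<le> 1 / (1 + x)"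
    using assms by (simp add: exp_minus field_simps)
  also have "\<dots> \<le> 1 - x + x\<^sup>2"
  proof -
    have "1 \<le> (1 - x + x\<^sup>2) * (1 + x)"
      using assms by (simp add: power2_eq_square algebra_simps)
    then show ?thesis using assms by (simp add: divide_le_eq)
  qed
  finally have "exp (- x) \<le> 1 - x + x\<^sup>2" .
  moreover have "1 - x \<le> exp (- x)" using exp_ge_add_one_self[of "- x"] by simp
  ultimately show ?thesis by (simp add: abs_le_iff)
qed

lemma real_distribution_centered_gaussian: "real_distribution (centered_gaussian s)"
  if "0 \<le> s"
proof (cases "s = 0")
  case True
  then show ?thesis
    by (auto simp: centered_gaussian_def real_distribution_def real_distribution_axioms_def intro!: prob_space_return)
next
  case False
  then show ?thesis using that
    by (auto simp: centered_gaussian_def real_distribution_def real_distribution_axioms_def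
        intro!: prob_space_normal_density)
qed

text \<open>
  Reduces the characteristic function to that of the standard normal distribution.
\<close>

lemma centered_gaussian_scale:
  assumes "0 < s"
  shows "centered_gaussian s = distr std_normal_distribution borel (\<lambda>x. s * x)"
proof -
  interpret prob_space std_normal_distribution by (rule prob_space_normal_density) simp
  have "distributed std_normal_distribution lborel (\<lambda>x. x) (normal_density 0 1)"
    unfolding distributed_def by (auto simp: distr_id2 intro!: distr_id2)
  from normal_density_affine[OF this, of s 0]
  have "distributed std_normal_distribution lborel (\<lambda>x. s * x) (normal_density 0 s)"
    using assms by simp
  then have "distr std_normal_distribution lborel (\<lambda>x. s * x) = density lborel (normal_density 0 s)"
    by (rule distributed_distr_eq_density)
  moreover have "distr std_normal_distribution lborel (\<lambda>x. s * x) = distr std_normal_distribution borel (\<lambda>x. s * x)"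
    by (rule distr_cong) auto
  ultimately show ?thesis using assms by (simp add: centered_gaussian_def)
qed

lemma char_centered_gaussian:
  assumes "0 \<le> s"
  shows "char (centered_gaussian s) t = complex_of_real (exp (- (t\<^sup>2 * s\<^sup>2 / 2)))"
proof (cases "s = 0")
  case True
  then show ?thesis by (simp add: centered_gaussian_def char_def integral_return)
next
  case False
  then have s: "0 < s" using assms by simp
  have "char (centered_gaussian s) t = char std_normal_distribution (t * s)"
    unfolding centered_gaussian_scale[OF s] char_def
    by (subst integral_distr) (auto simp: algebra_simps)
  then show ?thesis by (simp add: char_std_normal_distribution power_mult_distrib)
qed

context quasimorphism_walk
begin

text \<open>
  The characteristic function of the centred martingale for the horizon \<open>i + j\<close> after \<open>i\<close> steps.
\<close>

definition partial_char :: "real \<Rightarrow> nat \<Rightarrow> nat \<Rightarrow> complex" where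
  "partial_char \<theta> i j = (\<integral>g. iexp (\<theta> * (forward j g - mean (i + j))) \<partial>conv i)"

lemma integrable_iexp [simp]:
  assumes [measurable]: "X \<in> borel_measurable borel"
  shows "integrable (conv i) (\<lambda>g. iexp (X g))"
  by (rule conv.integrable_const_bound[where B = 1]) auto

text \<open>
  Conditionally on the first \<open>i\<close> steps, the next block multiplies the characteristic function by a factor
  that depends on the position, but lies within \<open>\<delta>\<close> of a fixed number \<open>q\<close>.
\<close>

lemma partial_char_step:
  assumes "\<And>j g. cmod ((\<integral>h. iexp (\<theta> * jump j m g h) \<partial>conv m) - complex_of_real q) \<le> \<delta>"
  shows "cmod (partial_char \<theta> (i + m) j - complex_of_real q * partial_char \<theta> i (m + j)) \<le> \<delta>"
proof -
  define E where "E = mean (i + m + j)"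
  define B where "B g = (\<integral>h. iexp (\<theta> * jump j m g h) \<partial>conv m)" for g
  have [measurable]: "B \<in> borel_measurable borel" unfolding B_def jump_def by measurable
  have B1: "cmod (B g) \<le> 1" for g
  proof -
    have "cmod (B g) \<le> (\<integral>h. cmod (iexp (\<theta> * jump j m g h)) \<partial>conv m)"
      unfolding B_def by (rule integral_norm_bound)
    then show ?thesis by (simp add: conv.prob_space[simplified])
  qed
  have i1: "integrable (conv i) (\<lambda>g. iexp (\<theta> * (forward (m + j) g - E)) * B g)"
    using B1 by (intro conv.integrable_const_bound[where B = 1]) (auto simp: norm_mult)
  have i2: "integrable (conv i) (\<lambda>g. complex_of_real q * iexp (\<theta> * (forward (m + j) g - E)))"
    by (intro integrable_mult_right integrable_iexp) auto
  have "partial_char \<theta> (i + m) j = (\<integral>g. (\<integral>h. iexp (\<theta> * (forward j (g + h) - E)) \<partial>conv m) \<partial>conv i)"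
    unfolding partial_char_def E_def
    by (intro integral_convolution_power_add[OF prob_space_axioms sets_mu] integrable_iexp) auto
  also have "\<dots> = (\<integral>g. iexp (\<theta> * (forward (m + j) g - E)) * B g \<partial>conv i)"
  proof (rule Bochner_Integration.integral_cong)
    fix g
    have "iexp (\<theta> * (forward j (g + h) - E)) = iexp (\<theta> * (forward (m + j) g - E)) * iexp (\<theta> * jump j m g h)" for h
      by (simp add: jump_def exp_add[symmetric] algebra_simps)
    then show "(\<integral>h. iexp (\<theta> * (forward j (g + h) - E)) \<partial>conv m) = iexp (\<theta> * (forward (m + j) g - E)) * B g"
      unfolding B_def by simp
  qed simp
  finally have "partial_char \<theta> (i + m) j - complex_of_real q * partial_char \<theta> i (m + j) =
      (\<integral>g. iexp (\<theta> * (forward (m + j) g - E)) * B g - complex_of_real q * iexp (\<theta> * (forward (m + j) g - E)) \<partial>conv i)"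
    using i1 i2 by (subst Bochner_Integration.integral_diff) (auto simp: partial_char_def E_def add.assoc)
  also have "\<dots> = (\<integral>g. iexp (\<theta> * (forward (m + j) g - E)) * (B g - complex_of_real q) \<partial>conv i)"
    by (simp add: algebra_simps)
  also have "cmod \<dots> \<le> (\<integral>g. \<delta> \<partial>conv i)"
  proof (rule order.trans[OF integral_norm_bound], rule integral_mono)
    show "integrable (conv i) (\<lambda>g. cmod (iexp (\<theta> * (forward (m + j) g - E)) * (B g - complex_of_real q)))"
      using Bochner_Integration.integrable_diff[OF i1 i2] by (intro integrable_norm) (simp add: algebra_simps)
  qed (use assms in \<open>auto simp: norm_mult B_def\<close>)
  finally show ?thesis by (simp add: conv.prob_space[simplified])
qed

lemma partial_char_blocks:
  assumes "\<And>j g. cmod ((\<integral>h. iexp (\<theta> * jump j m g h) \<partial>conv m) - complex_of_real q) \<le> \<delta>" and q: "\<bar>q\<bar> \<le> 1"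
  shows "cmod (partial_char \<theta> (r + p * m) j - complex_of_real (q ^ p) * partial_char \<theta> r (p * m + j)) \<le> real p * \<delta>"
proof (induction p arbitrary: j)
  case (Suc p)
  let ?q = "complex_of_real q"
  have "cmod (partial_char \<theta> (r + p * m + m) j - ?q * partial_char \<theta> (r + p * m) (m + j)) \<le> \<delta>"
    by (rule partial_char_step) fact
  moreover have "cmod (?q * partial_char \<theta> (r + p * m) (m + j) - ?q * (?q ^ p * partial_char \<theta> r (p * m + (m + j)))) \<le> real p * \<delta>"
  proof -
    have "cmod (?q * partial_char \<theta> (r + p * m) (m + j) - ?q * (?q ^ p * partial_char \<theta> r (p * m + (m + j))))
      = \<bar>q\<bar> * cmod (partial_char \<theta> (r + p * m) (m + j) - ?q ^ p * partial_char \<theta> r (p * m + (m + j)))"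
      by (simp add: norm_mult flip: right_diff_distrib)
    also have "\<dots> \<le> 1 * cmod (partial_char \<theta> (r + p * m) (m + j) - ?q ^ p * partial_char \<theta> r (p * m + (m + j)))"
      using q by (intro mult_right_mono) auto
    also have "\<dots> \<le> real p * \<delta>" using Suc.IH[of "m + j"] by simp
    finally show ?thesis .
  qed
  ultimately have "cmod (partial_char \<theta> (r + p * m + m) j - ?q * (?q ^ p * partial_char \<theta> r (p * m + (m + j)))) \<le> \<delta> + real p * \<delta>"
    by (rule norm_diff_triangle_le)
  then show ?case by (simp add: algebra_simps)
qed simp

text \<open>
  The Taylor remainder of second order for the characteristic function of a block increment; the envelope
  \<open>\<bar>\<phi> h - mean m\<bar> + 4 * D\<close> dominates the increments from all starting points at once. The minimum keeps the
  remainder integrable without a third moment.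
\<close>

definition cubic_tail :: "nat \<Rightarrow> real \<Rightarrow> real" where
  "cubic_tail m \<theta> = (\<integral>h. min (6 * (\<bar>\<phi> h - mean m\<bar> + 4 * D)\<^sup>2) (\<bar>\<theta>\<bar> * (\<bar>\<phi> h - mean m\<bar> + 4 * D) ^ 3) \<partial>conv m)"

lemma envelope_square_integrable: "integrable (conv m) (\<lambda>h. (\<bar>\<phi> h - mean m\<bar> + 4 * D)\<^sup>2)"
  by (rule conv.second_moment_perturbation(1)[where X = "\<lambda>h. \<bar>\<phi> h - mean m\<bar>" and c = "4 * D"])
    (use D_nonneg in \<open>auto simp: square_integrable_centered\<close>)

lemma cubic_tail_tendsto:
  assumes "s \<longlonglongrightarrow> 0"
  shows "(\<lambda>n. cubic_tail m (s n)) \<longlonglongrightarrow> 0"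
proof -
  let ?Z = "\<lambda>h. \<bar>\<phi> h - mean m\<bar> + 4 * D"
  have Z: "0 \<le> ?Z h" for h using D_nonneg by simp
  have "(\<lambda>n. \<integral>h. min (6 * (?Z h)\<^sup>2) (\<bar>s n\<bar> * ?Z h ^ 3) \<partial>conv m) \<longlonglongrightarrow> (\<integral>h. 0 \<partial>conv m)"
  proof (rule integral_dominated_convergence)
    show "integrable (conv m) (\<lambda>h. 6 * (?Z h)\<^sup>2)" using envelope_square_integrable by simp
    show "AE h in conv m. (\<lambda>n. min (6 * (?Z h)\<^sup>2) (\<bar>s n\<bar> * ?Z h ^ 3)) \<longlonglongrightarrow> 0"
    proof (rule AE_I2)
      fix h
      have "(\<lambda>n. min (6 * (?Z h)\<^sup>2) (\<bar>s n\<bar> * ?Z h ^ 3)) \<longlonglongrightarrow> min (6 * (?Z h)\<^sup>2) (\<bar>0\<bar> * ?Z h ^ 3)"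
        by (intro tendsto_intros assms)
      then show "(\<lambda>n. min (6 * (?Z h)\<^sup>2) (\<bar>s n\<bar> * ?Z h ^ 3)) \<longlonglongrightarrow> 0" by simp
    qed
    show "AE h in conv m. norm (min (6 * (?Z h)\<^sup>2) (\<bar>s n\<bar> * ?Z h ^ 3)) \<le> 6 * (?Z h)\<^sup>2" for n
    proof (rule AE_I2)
      fix h have "0 \<le> \<bar>s n\<bar> * ?Z h ^ 3" using Z[of h] by (intro mult_nonneg_nonneg) auto
      then show "norm (min (6 * (?Z h)\<^sup>2) (\<bar>s n\<bar> * ?Z h ^ 3)) \<le> 6 * (?Z h)\<^sup>2" by simp
    qed
  qed measurable
  then show ?thesis unfolding cubic_tail_def by simp
qed

lemma jump_char_bound:
  assumes m: "m \<ge> 1"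
  shows "cmod ((\<integral>h. iexp (\<theta> * jump j m g h) \<partial>conv m) - complex_of_real (exp (- (\<theta>\<^sup>2 * (real m * sigma2) / 2))))
     \<le> \<theta>\<^sup>2 / 6 * cubic_tail m \<theta> + \<theta>\<^sup>2 * (real m * gap m) + (\<theta>\<^sup>2 * (real m * sigma2) / 2)\<^sup>2"
proof -
  let ?X = "jump j m g"
  let ?V = "\<integral>h. (?X h)\<^sup>2 \<partial>conv m"
  let ?Z = "\<lambda>h. \<bar>\<phi> h - mean m\<bar> + 4 * D"
  let ?x = "\<theta>\<^sup>2 * (real m * sigma2) / 2"
  have [measurable]: "?X \<in> borel_measurable borel" unfolding jump_def by measurable
  have mean0: "conv.expectation m ?X = 0" by (rule jump_integral)
  have X: "\<bar>?X h\<bar> \<le> ?Z h" for h using jump_bound[of j m g h] by linarith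
  have "cmod (char (distr (conv m) borel ?X) \<theta> - (1 - \<theta>\<^sup>2 * ?V / 2))
     \<le> (\<theta>\<^sup>2 / 6) * (\<integral>h. min (6 * (?X h)\<^sup>2) (\<bar>\<theta>\<bar> * \<bar>?X h\<bar> ^ 3) \<partial>conv m)"
    by (rule conv.char_approx3') (auto simp: jump_integrable jump_square_integrable mean0)
  also have "(\<integral>h. min (6 * (?X h)\<^sup>2) (\<bar>\<theta>\<bar> * \<bar>?X h\<bar> ^ 3) \<partial>conv m) \<le> cubic_tail m \<theta>"
    unfolding cubic_tail_def
  proof (rule integral_mono)
    show "integrable (conv m) (\<lambda>h. min (6 * (?X h)\<^sup>2) (\<bar>\<theta>\<bar> * \<bar>?X h\<bar> ^ 3))"
      by (rule Bochner_Integration.integrable_bound[of _ "\<lambda>h. 6 * (?X h)\<^sup>2"])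
        (auto simp: jump_square_integrable)
    show "integrable (conv m) (\<lambda>h. min (6 * (?Z h)\<^sup>2) (\<bar>\<theta>\<bar> * ?Z h ^ 3))"
      by (rule Bochner_Integration.integrable_bound[of _ "\<lambda>h. 6 * (?Z h)\<^sup>2"])
        (use D_nonneg envelope_square_integrable in auto)
    fix h
    have "(?X h)\<^sup>2 \<le> (?Z h)\<^sup>2" using X[of h] by (subst abs_le_square_iff[symmetric]) auto
    moreover have "\<bar>\<theta>\<bar> * \<bar>?X h\<bar> ^ 3 \<le> \<bar>\<theta>\<bar> * ?Z h ^ 3"
      using X[of h] by (intro mult_left_mono power_mono) auto
    ultimately show "min (6 * (?X h)\<^sup>2) (\<bar>\<theta>\<bar> * \<bar>?X h\<bar> ^ 3) \<le> min (6 * (?Z h)\<^sup>2) (\<bar>\<theta>\<bar> * ?Z h ^ 3)"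
      by (intro min.mono) auto
  qed
  also have "char (distr (conv m) borel ?X) \<theta> = (\<integral>h. iexp (\<theta> * ?X h) \<partial>conv m)"
    unfolding char_def by (subst integral_distr) auto
  finally have 1: "cmod ((\<integral>h. iexp (\<theta> * ?X h) \<partial>conv m) - (1 - \<theta>\<^sup>2 * ?V / 2)) \<le> \<theta>\<^sup>2 / 6 * cubic_tail m \<theta>"
    by (simp add: mult_left_mono)
  have "\<bar>var m - real m * sigma2\<bar> \<le> real m * gap m"
  proof -
    have "var m - real m * sigma2 = real m * (var m / real m - sigma2)" using m by (simp add: field_simps)
    then show ?thesis using var_sigma2[OF m] by (simp add: abs_mult mult_left_mono)
  qed
  then have "\<bar>?V - real m * sigma2\<bar> \<le> 2 * (real m * gap m)"
    using jump_second_moment[of m j g] perturbation_le_gap[OF m] by linarith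
  then have 2: "\<bar>\<theta>\<^sup>2 * ?V / 2 - ?x\<bar> \<le> \<theta>\<^sup>2 * (real m * gap m)"
  proof -
    assume *: "\<bar>?V - real m * sigma2\<bar> \<le> 2 * (real m * gap m)"
    have "\<theta>\<^sup>2 * ?V / 2 - ?x = \<theta>\<^sup>2 / 2 * (?V - real m * sigma2)" by (simp add: algebra_simps)
    then have "\<bar>\<theta>\<^sup>2 * ?V / 2 - ?x\<bar> = \<theta>\<^sup>2 / 2 * \<bar>?V - real m * sigma2\<bar>"
      by (simp only: abs_mult) simp
    also have "\<dots> \<le> \<theta>\<^sup>2 / 2 * (2 * (real m * gap m))" by (intro mult_left_mono *) simp
    finally show ?thesis by simp
  qed
  have 3: "\<bar>exp (- ?x) - (1 - ?x)\<bar> \<le> ?x\<^sup>2"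
    using sigma2_nonneg by (intro exp_minus_linear_bound) auto
  have "cmod ((\<integral>h. iexp (\<theta> * ?X h) \<partial>conv m) - complex_of_real (exp (- ?x))) \<le>
      cmod ((\<integral>h. iexp (\<theta> * ?X h) \<partial>conv m) - (1 - \<theta>\<^sup>2 * ?V / 2)) +
      cmod (complex_of_real ((1 - \<theta>\<^sup>2 * ?V / 2) - exp (- ?x)))"
    by (rule order.trans[OF _ norm_triangle_ineq]) simp
  also have "cmod (complex_of_real ((1 - \<theta>\<^sup>2 * ?V / 2) - exp (- ?x))) \<le> \<theta>\<^sup>2 * (real m * gap m) + ?x\<^sup>2"
    unfolding norm_of_real using 2 3 by linarith
  finally show ?thesis using 1 by linarith
qed

text \<open>
  Disposes of the first \<open>n mod m\<close> steps, which do not fill a block.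
\<close>

lemma partial_char_near_1: "cmod (partial_char \<theta> r j - 1) \<le> \<bar>\<theta>\<bar> * sqrt (real r * var_rate)"
proof -
  let ?Y = "\<lambda>g. forward j g - mean (r + j)"
  have Yi: "integrable (conv r) ?Y"
    by (rule conv.square_integrable_imp_integrable[OF _ forward_square_integrable]) measurable
  have i: "integrable (conv r) (\<lambda>g. iexp (\<theta> * ?Y g))" by (rule integrable_iexp) measurable
  have "partial_char \<theta> r j - 1 = (\<integral>g. iexp (\<theta> * ?Y g) - 1 \<partial>conv r)"
    unfolding partial_char_def
    by (subst Bochner_Integration.integral_diff[OF i]) (auto simp: conv.prob_space[simplified])
  also have "cmod \<dots> \<le> (\<integral>g. \<bar>\<theta>\<bar> * \<bar>?Y g\<bar> \<partial>conv r)"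
  proof (rule order.trans[OF integral_norm_bound], rule integral_mono)
    show "integrable (conv r) (\<lambda>g. cmod (iexp (\<theta> * ?Y g) - 1))"
      by (intro integrable_norm Bochner_Integration.integrable_diff integrable_iexp) auto
    show "cmod (iexp (\<theta> * ?Y g) - 1) \<le> \<bar>\<theta>\<bar> * \<bar>?Y g\<bar>" for g
      using norm_iexp_minus_1_le[of "\<theta> * ?Y g"] by (simp add: abs_mult)
  qed (use Yi in auto)
  also have "\<dots> = \<bar>\<theta>\<bar> * (\<integral>g. \<bar>?Y g\<bar> \<partial>conv r)" by simp
  also have "(\<integral>g. \<bar>?Y g\<bar> \<partial>conv r) \<le> sqrt (spread r j)"
    unfolding spread_def
    by (intro conv.expectation_abs_le_sqrt forward_square_integrable) measurable
  also have "spread r j \<le> real r * var_rate"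
  proof -
    have "(\<integral>h. (jump j 1 g h)\<^sup>2 \<partial>conv 1) \<le> var_rate" for j g
      using jump_second_moment[of 1 j g] unfolding var_rate_def abs_le_iff by linarith
    then show ?thesis using spread_bounds[of 0 1 var_rate r j] by simp
  qed
  finally show ?thesis by (simp add: mult_left_mono)
qed

text \<open>
  With \<open>\<theta> = t / sqrt n\<close> and \<open>n div m\<close> blocks of length \<open>m\<close>, the errors of the single blocks add up to
  \<open>t\<^sup>2 * gap m + o(1)\<close> as \<open>n\<close> tends to infinity. The first summand is made small by the choice of \<open>m\<close>.
\<close>

theorem conv_char_tendsto:
  "(\<lambda>n. \<integral>g. iexp (t * ((\<phi> g - real n * ell) / sqrt (real n))) \<partial>conv n)
     \<longlonglongrightarrow> complex_of_real (exp (- (t\<^sup>2 * sigma2 / 2)))"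
proof -
  define F where "F n = (\<integral>g. iexp (t * ((\<phi> g - real n * ell) / sqrt (real n))) \<partial>conv n)" for n
  define L where "L = exp (- (t\<^sup>2 * sigma2 / 2))"
  define \<theta> where "\<theta> n = t / sqrt (real n)" for n
  define Q where "Q m n = exp (- (t\<^sup>2 * sigma2 / 2 * (real (n div m * m) / real n)))" for m n
  define U where "U m n = \<bar>t\<bar> * D / sqrt (real n)
      + (t\<^sup>2 / (6 * real m) * cubic_tail m (\<theta> n) + t\<^sup>2 * gap m + t^4 * real m * sigma2\<^sup>2 / (4 * real n))
      + \<bar>t\<bar> * sqrt (real m * var_rate) / sqrt (real n) + \<bar>Q m n - L\<bar>" for m n
  have U: "cmod (F n - complex_of_real L) \<le> U m n" if m: "m \<ge> 1" and n: "n \<ge> 1" for m n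
  proof -
    define p where "p = n div m"
    define r where "r = n mod m"
    have npr: "n = r + p * m" by (simp add: p_def r_def)
    have rm: "r \<le> m" using m by (simp add: r_def less_imp_le)
    have pm: "real p * real m \<le> real n" unfolding npr by simp
    have th2: "(\<theta> n)\<^sup>2 = t\<^sup>2 / real n" by (simp add: \<theta>_def power_divide)
    define x where "x = (\<theta> n)\<^sup>2 * (real m * sigma2) / 2"
    define \<delta> where "\<delta> = (\<theta> n)\<^sup>2 / 6 * cubic_tail m (\<theta> n) + (\<theta> n)\<^sup>2 * (real m * gap m) + x\<^sup>2"
    have x0: "0 \<le> x" using sigma2_nonneg by (simp add: x_def)
    have blocks: "cmod (partial_char (\<theta> n) n 0 - complex_of_real (exp (- x) ^ p) * partial_char (\<theta> n) r (p * m)) \<le> real p * \<delta>"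
      using partial_char_blocks[of m "\<theta> n" "exp (- x)" \<delta> r p 0] jump_char_bound[OF m, of "\<theta> n"] x0
      by (simp add: npr[symmetric] x_def \<delta>_def)
    have \<delta>0: "0 \<le> \<delta>"
      using jump_char_bound[OF m, of "\<theta> n" 0 0] unfolding \<delta>_def x_def
      by (rule order.trans[OF norm_ge_zero])
    have "real p * \<delta> \<le> real n / real m * \<delta>"
      using pm m \<delta>0 by (intro mult_right_mono) (auto simp: field_simps)
    also have "\<dots> = t\<^sup>2 / (6 * real m) * cubic_tail m (\<theta> n) + t\<^sup>2 * gap m + t^4 * real m * sigma2\<^sup>2 / (4 * real n)"
      unfolding \<delta>_def x_def th2 using m n by (simp add: field_simps power2_eq_square power4_eq_xxxx)
    finally have 2: "real p * \<delta> \<le> t\<^sup>2 / (6 * real m) * cubic_tail m (\<theta> n) + t\<^sup>2 * gap m + t^4 * real m * sigma2\<^sup>2 / (4 * real n)" .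
    have Q: "exp (- x) ^ p = Q m n"
      by (simp add: Q_def x_def th2 p_def exp_of_nat_mult[symmetric] field_simps)
    have Q1: "0 \<le> Q m n" "Q m n \<le> 1" using sigma2_nonneg by (auto simp: Q_def)
    have "cmod (complex_of_real (Q m n) * partial_char (\<theta> n) r (p * m) - complex_of_real (Q m n) * 1)
        = \<bar>Q m n\<bar> * cmod (partial_char (\<theta> n) r (p * m) - 1)"
      by (simp only: right_diff_distrib[symmetric] norm_mult norm_of_real)
    also have "\<dots> \<le> 1 * (\<bar>\<theta> n\<bar> * sqrt (real r * var_rate))"
      using Q1 by (intro mult_mono partial_char_near_1) auto
    also have "\<dots> \<le> 1 * (\<bar>\<theta> n\<bar> * sqrt (real m * var_rate))"
      using rm var_rate_nonneg by (intro mult_left_mono real_sqrt_le_mono mult_right_mono) auto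
    finally have 3: "cmod (complex_of_real (Q m n) * partial_char (\<theta> n) r (p * m) - complex_of_real (Q m n))
        \<le> \<bar>t\<bar> * sqrt (real m * var_rate) / sqrt (real n)" by (simp add: \<theta>_def)
    have 4: "cmod (complex_of_real (Q m n) - complex_of_real L) \<le> \<bar>Q m n - L\<bar>"
      by (simp add: norm_of_real flip: of_real_diff)
    have F: "F n = iexp (\<theta> n * (mean n - real n * ell)) * partial_char (\<theta> n) n 0"
      unfolding F_def partial_char_def
      by (subst integral_mult_right_zero[symmetric], rule Bochner_Integration.integral_cong)
        (auto simp: \<theta>_def exp_add[symmetric] diff_divide_distrib algebra_simps)
    have "cmod (F n - partial_char (\<theta> n) n 0) = cmod (iexp (\<theta> n * (mean n - real n * ell)) - 1) * cmod (partial_char (\<theta> n) n 0)"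
      unfolding F by (simp add: norm_mult[symmetric] algebra_simps)
    also have "\<dots> \<le> \<bar>\<theta> n * (mean n - real n * ell)\<bar> * 1"
    proof (intro mult_mono norm_iexp_minus_1_le)
      have "cmod (partial_char (\<theta> n) n 0) \<le> (\<integral>g. cmod (iexp (\<theta> n * (forward 0 g - mean (n + 0)))) \<partial>conv n)"
        unfolding partial_char_def by (rule integral_norm_bound)
      then show "cmod (partial_char (\<theta> n) n 0) \<le> 1" by (simp add: conv.prob_space[simplified])
    qed auto
    also have "\<dots> \<le> \<bar>t\<bar> * D / sqrt (real n)"
      using mult_left_mono[OF mean_ell[of n], of "\<bar>\<theta> n\<bar>"] by (simp add: abs_mult \<theta>_def)
    finally have 1: "cmod (F n - partial_char (\<theta> n) n 0) \<le> \<bar>t\<bar> * D / sqrt (real n)" .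
    have b2: "cmod (partial_char (\<theta> n) n 0 - complex_of_real (Q m n) * partial_char (\<theta> n) r (p * m)) \<le>
      t\<^sup>2 / (6 * real m) * cubic_tail m (\<theta> n) + t\<^sup>2 * gap m + t^4 * real m * sigma2\<^sup>2 / (4 * real n)"
      using blocks 2 unfolding Q by linarith
    show ?thesis unfolding U_def
      by (rule norm_diff_triangle_le[OF norm_diff_triangle_le[OF norm_diff_triangle_le[OF 1 b2] 3] 4])
  qed
  have inv: "(\<lambda>n. c / sqrt (real n)) \<longlonglongrightarrow> 0" for c
    by (rule tendsto_divide_0[OF tendsto_const filterlim_at_top_imp_at_infinity])
      (rule filterlim_compose[OF sqrt_at_top filterlim_real_sequentially])
  have inv': "(\<lambda>n. c / (4 * real n)) \<longlonglongrightarrow> 0" for c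
    by (rule tendsto_divide_0[OF tendsto_const filterlim_at_top_imp_at_infinity])
      (intro filterlim_tendsto_pos_mult_at_top[OF tendsto_const _ filterlim_real_sequentially], simp)
  have Ulim: "U m \<longlonglongrightarrow> t\<^sup>2 * gap m" if m: "m \<ge> 1" for m
  proof -
    have "(\<lambda>n. real (n div m * m) / real n) \<longlonglongrightarrow> 1"
    proof (rule tendsto_sandwich)
      show "eventually (\<lambda>n. 1 - real m / real n \<le> real (n div m * m) / real n) sequentially"
        using eventually_gt_at_top[of 0]
      proof eventually_elim
        case (elim n)
        have "n \<le> n div m * m + m" using m mod_less_divisor[of m n] div_mult_mod_eq[of n m] by linarith
        then have "real n \<le> real (n div m * m) + real m" by (metis of_nat_add of_nat_le_iff)
        then have "(real n - real m) / real n \<le> real (n div m * m) / real n"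
          by (intro divide_right_mono) auto
        then show ?case using elim by (simp add: diff_divide_distrib)
      qed
      show "eventually (\<lambda>n. real (n div m * m) / real n \<le> 1) sequentially"
        using eventually_gt_at_top[of 0]
        by eventually_elim (simp only: divide_le_eq_1 of_nat_le_iff of_nat_0_less_iff, simp)
      have "(\<lambda>n. 1 - real m * inverse (real n)) \<longlonglongrightarrow> 1 - real m * 0"
        by (intro tendsto_intros lim_inverse_n)
      then show "(\<lambda>n. 1 - real m / real n) \<longlonglongrightarrow> 1" by (simp add: divide_inverse)
    qed simp
    then have "Q m \<longlonglongrightarrow> exp (- (t\<^sup>2 * sigma2 / 2 * 1))"
      unfolding Q_def by (intro tendsto_intros)
    then have q: "Q m \<longlonglongrightarrow> L" by (simp add: L_def)
    have "\<theta> \<longlonglongrightarrow> 0" unfolding \<theta>_def by (rule inv)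
    then have "U m \<longlonglongrightarrow> 0 + (t\<^sup>2 / (6 * real m) * 0 + t\<^sup>2 * gap m + 0) + 0 + \<bar>L - L\<bar>"
      unfolding U_def by (intro tendsto_add inv inv' tendsto_const tendsto_mult tendsto_rabs tendsto_diff q cubic_tail_tendsto)
    then show ?thesis by simp
  qed
  have "(\<lambda>n. F n - complex_of_real L) \<longlonglongrightarrow> 0"
  proof (rule tendstoI)
    fix \<epsilon> :: real assume \<epsilon>: "0 < \<epsilon>"
    have "(\<lambda>m. t\<^sup>2 * gap m) \<longlonglongrightarrow> t\<^sup>2 * 0" by (intro tendsto_intros gap_tendsto)
    then have "eventually (\<lambda>m. t\<^sup>2 * gap m < \<epsilon>) sequentially"
      using \<epsilon> by (auto dest: order_tendstoD(2))
    then obtain m where m: "m \<ge> 1" "t\<^sup>2 * gap m < \<epsilon>"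
      by (metis (mono_tags, lifting) eventually_at_top_linorder eventually_conj eventually_ge_at_top order_refl)
    from order_tendstoD(2)[OF Ulim[OF m(1)] m(2)] eventually_ge_at_top[of 1]
    show "eventually (\<lambda>n. dist (F n - complex_of_real L) 0 < \<epsilon>) sequentially"
    proof eventually_elim
      case (elim n)
      then show ?case using U[OF m(1), of n] by simp
    qed
  qed
  then show ?thesis unfolding F_def L_def by (simp add: LIM_zero_iff)
qed

theorem conv_central_limit:
  "weak_conv_m (\<lambda>n. distr (conv n) borel (\<lambda>g. (\<phi> g - real n * ell) / sqrt (real n)))
     (centered_gaussian (sqrt sigma2))"
proof (rule levy_continuity)
  show "real_distribution (distr (conv n) borel (\<lambda>g. (\<phi> g - real n * ell) / sqrt (real n)))" for n
    by (rule conv.real_distribution_distr) measurable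
  show "real_distribution (centered_gaussian (sqrt sigma2))"
    by (rule real_distribution_centered_gaussian) (simp add: sigma2_nonneg)
  fix t
  have "char (distr (conv n) borel (\<lambda>g. (\<phi> g - real n * ell) / sqrt (real n))) t =
      (\<integral>g. iexp (t * ((\<phi> g - real n * ell) / sqrt (real n))) \<partial>conv n)" for n
    unfolding char_def by (subst integral_distr) auto
  then show "(\<lambda>n. char (distr (conv n) borel (\<lambda>g. (\<phi> g - real n * ell) / sqrt (real n))) t)
      \<longlonglongrightarrow> char (centered_gaussian (sqrt sigma2)) t"
    using conv_char_tendsto[of t] sigma2_nonneg by (simp add: char_centered_gaussian)
qed

end

section \<open>Exponential moments of walks with bounded steps\<close>

lemma exp_le_quadratic:
  fixes x :: real
  assumes "\<bar>x\<bar> \<le> c"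
  shows "exp x \<le> 1 + x + x\<^sup>2 / 2 * exp c"
proof -
  obtain t where t: "\<bar>t\<bar> \<le> \<bar>x\<bar>" "exp x = (\<Sum>m<2. x ^ m / fact m) + exp t / fact 2 * x\<^sup>2"
    using Maclaurin_exp_le[of x 2] by blast
  have "exp t \<le> exp c" using t(1) assms by simp
  then have "exp t * x\<^sup>2 \<le> exp c * x\<^sup>2" by (intro mult_right_mono) auto
  then show ?thesis unfolding t(2) by (simp add: numeral_2_eq_2 algebra_simps)
qed

context quasimorphism_walk
begin

lemma AE_conv_bounded:
  assumes "AE g in \<mu>. \<bar>\<phi> g\<bar> \<le> b"
  shows "AE g in conv m. \<bar>\<phi> g\<bar> \<le> D + real m * (b + D)"
proof (induction m)
  case 0
  show ?case unfolding convolution_power.simps using phi_0 by (subst AE_return) auto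
next
  case (Suc m)
  interpret pair_prob_space "conv m" \<mu> ..
  have "AE z in conv m \<Otimes>\<^sub>M \<mu>. \<bar>\<phi> (fst z + snd z)\<bar> \<le> D + real (Suc m) * (b + D)"
  proof (rule AE_pair_measure)
    show "AE g in conv m. AE h in \<mu>. \<bar>\<phi> (fst (g, h) + snd (g, h))\<bar> \<le> D + real (Suc m) * (b + D)"
      using Suc.IH
    proof eventually_elim
      case g: (elim g)
      show ?case using assms
      proof eventually_elim
        case (elim h)
        then show ?case using quasi[of g h] g by (simp add: algebra_simps)
      qed
    qed
  qed measurable
  then show ?case
    unfolding convolution_power.simps group_convolution_def
    by (subst AE_distr_iff) (auto simp: case_prod_beta')
qed

text \<open>
  The linear term of the exponential integrates to \<open>0\<close>, and the quadratic term is controlled by the variance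
  of a block, uniformly in the starting point.
\<close>

lemma jump_exp_moment:
  assumes \<theta>: "0 \<le> \<theta>" and c: "AE h in conv m. \<bar>\<phi> h - mean m\<bar> + 4 * D \<le> c"
    and W: "var m + 8 * D * sqrt (var m) + 16 * D\<^sup>2 \<le> W"
  shows "(\<integral>\<^sup>+h. ennreal (exp (\<theta> * jump j m g h)) \<partial>conv m) \<le> ennreal (exp (\<theta>\<^sup>2 / 2 * exp (\<theta> * c) * W))"
proof -
  let ?X = "jump j m g"
  let ?b = "\<lambda>h. 1 + \<theta> * ?X h + \<theta>\<^sup>2 / 2 * exp (\<theta> * c) * (?X h)\<^sup>2"
  have i: "integrable (conv m) ?b" using jump_integrable jump_square_integrable by simp
  have AE: "AE h in conv m. exp (\<theta> * ?X h) \<le> ?b h"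
    using c
  proof eventually_elim
    case (elim h)
    then have "\<bar>?X h\<bar> \<le> c" using jump_bound[of j m g h] by linarith
    then have "\<bar>\<theta> * ?X h\<bar> \<le> \<theta> * c" using \<theta> by (simp add: abs_mult mult_left_mono)
    from exp_le_quadratic[OF this] show ?case by (simp add: power_mult_distrib algebra_simps)
  qed
  have "(\<integral>\<^sup>+h. ennreal (exp (\<theta> * ?X h)) \<partial>conv m) \<le> (\<integral>\<^sup>+h. ennreal (?b h) \<partial>conv m)"
    using AE by (intro nn_integral_mono_AE) (auto simp: ennreal_leI)
  also have "\<dots> = ennreal (\<integral>h. ?b h \<partial>conv m)"
    using AE by (intro nn_integral_eq_integral i) (auto elim!: eventually_mono intro: order.trans[OF exp_ge_zero])
  also have "(\<integral>h. ?b h \<partial>conv m) = 1 + \<theta>\<^sup>2 / 2 * exp (\<theta> * c) * (\<integral>h. (?X h)\<^sup>2 \<partial>conv m)"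
    using jump_integrable jump_square_integrable by (simp add: jump_integral conv.prob_space[simplified])
  also have "(\<integral>h. (?X h)\<^sup>2 \<partial>conv m) \<le> W"
    using jump_second_moment[of m j g] W unfolding abs_le_iff by linarith
  also have "1 + \<theta>\<^sup>2 / 2 * exp (\<theta> * c) * W \<le> exp (\<theta>\<^sup>2 / 2 * exp (\<theta> * c) * W)"
    by (rule exp_ge_add_one_self)
  finally show ?thesis by (simp add: ennreal_leI mult_left_mono)
qed

definition partial_exp :: "real \<Rightarrow> nat \<Rightarrow> nat \<Rightarrow> ennreal" where
  "partial_exp \<theta> i j = (\<integral>\<^sup>+g. ennreal (exp (\<theta> * (forward j g - mean (i + j)))) \<partial>conv i)"

lemma partial_exp_step:
  assumes K: "\<And>j g. (\<integral>\<^sup>+h. ennreal (exp (\<theta> * jump j m g h)) \<partial>conv m) \<le> K"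
  shows "partial_exp \<theta> (i + m) j \<le> K * partial_exp \<theta> i (m + j)"
proof -
  define E where "E = mean (i + m + j)"
  have "partial_exp \<theta> (i + m) j = (\<integral>\<^sup>+g. \<integral>\<^sup>+h. ennreal (exp (\<theta> * (forward j (g + h) - E))) \<partial>conv m \<partial>conv i)"
    unfolding partial_exp_def E_def
    by (rule nn_integral_convolution_power_add[OF prob_space_axioms sets_mu]) measurable
  also have "\<dots> \<le> (\<integral>\<^sup>+g. K * ennreal (exp (\<theta> * (forward (m + j) g - E))) \<partial>conv i)"
  proof (rule nn_integral_mono)
    fix g
    have [measurable]: "jump j m g \<in> borel_measurable borel" unfolding jump_def by measurable
    have "ennreal (exp (\<theta> * (forward j (g + h) - E))) =
        ennreal (exp (\<theta> * jump j m g h)) * ennreal (exp (\<theta> * (forward (m + j) g - E)))" for h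
      by (simp add: jump_def exp_add[symmetric] algebra_simps flip: ennreal_mult)
    then have "(\<integral>\<^sup>+h. ennreal (exp (\<theta> * (forward j (g + h) - E))) \<partial>conv m) =
        (\<integral>\<^sup>+h. ennreal (exp (\<theta> * jump j m g h)) \<partial>conv m) * ennreal (exp (\<theta> * (forward (m + j) g - E)))"
      by (simp add: nn_integral_multc)
    also have "\<dots> \<le> K * ennreal (exp (\<theta> * (forward (m + j) g - E)))"
      by (intro mult_right_mono K) simp
    finally show "(\<integral>\<^sup>+h. ennreal (exp (\<theta> * (forward j (g + h) - E))) \<partial>conv m)
        \<le> K * ennreal (exp (\<theta> * (forward (m + j) g - E)))" .
  qed
  also have "\<dots> = K * partial_exp \<theta> i (m + j)"
    unfolding partial_exp_def E_def by (subst nn_integral_cmult) (auto simp: add.assoc)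
  finally show ?thesis .
qed

lemma partial_exp_blocks:
  assumes K: "\<And>j g. (\<integral>\<^sup>+h. ennreal (exp (\<theta> * jump j m g h)) \<partial>conv m) \<le> K"
  shows "partial_exp \<theta> (p * m) j \<le> K ^ p"
proof (induction p arbitrary: j)
  case 0
  then show ?case by (simp add: partial_exp_def nn_integral_return)
next
  case (Suc p)
  have "partial_exp \<theta> (p * m + m) j \<le> K * partial_exp \<theta> (p * m) (m + j)"
    by (rule partial_exp_step) fact
  also have "\<dots> \<le> K * K ^ p" by (intro mult_left_mono Suc.IH) simp
  finally show ?case by (simp add: add.commute)
qed

text \<open>
  Chernoff's bound for the product of \<open>p\<close> blocks. The expression bounded by \<open>W\<close> bounds the conditional
  variance of a block, uniformly in the starting point.
\<close>

lemma exponential_tail: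
  assumes \<theta>: "0 \<le> \<theta>" and c: "AE h in conv m. \<bar>\<phi> h - mean m\<bar> + 4 * D \<le> c"
    and W: "var m + 8 * D * sqrt (var m) + 16 * D\<^sup>2 \<le> W"
  shows "measure (conv (p * m)) {g. x < \<phi> g - mean (p * m)} \<le> exp (real p * (\<theta>\<^sup>2 / 2 * exp (\<theta> * c) * W) - \<theta> * x)"
proof -
  define \<kappa> where "\<kappa> = \<theta>\<^sup>2 / 2 * exp (\<theta> * c) * W"
  have "ennreal (measure (conv (p * m)) {g. x < \<phi> g - mean (p * m)})
      = (\<integral>\<^sup>+g. indicator {g. x < \<phi> g - mean (p * m)} g \<partial>conv (p * m))"
    by (simp add: conv.emeasure_eq_measure)
  also have "\<dots> \<le> (\<integral>\<^sup>+g. ennreal (exp (- (\<theta> * x))) * ennreal (exp (\<theta> * (forward 0 g - mean (p * m + 0)))) \<partial>conv (p * m))"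
  proof (rule nn_integral_mono)
    fix g
    have "1 \<le> exp (- (\<theta> * x)) * exp (\<theta> * (\<phi> g - mean (p * m)))" if "x < \<phi> g - mean (p * m)"
    proof -
      have "\<theta> * x \<le> \<theta> * (\<phi> g - mean (p * m))" using that \<theta> by (intro mult_left_mono) auto
      then show ?thesis by (simp add: exp_add[symmetric])
    qed
    then show "indicator {g. x < \<phi> g - mean (p * m)} g \<le>
        ennreal (exp (- (\<theta> * x))) * ennreal (exp (\<theta> * (forward 0 g - mean (p * m + 0))))"
      by (auto simp: indicator_def ennreal_mult[symmetric] simp flip: ennreal_1 intro!: ennreal_leI)
  qed
  also have "\<dots> = ennreal (exp (- (\<theta> * x))) * partial_exp \<theta> (p * m) 0"
    unfolding partial_exp_def by (rule nn_integral_cmult) measurable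
  also have "\<dots> \<le> ennreal (exp (- (\<theta> * x))) * ennreal (exp \<kappa>) ^ p"
    unfolding \<kappa>_def by (intro mult_left_mono partial_exp_blocks jump_exp_moment \<theta> c W) simp
  also have "\<dots> = ennreal (exp (real p * \<kappa> - \<theta> * x))"
    by (simp add: ennreal_power exp_of_nat_mult[symmetric] ennreal_mult[symmetric] exp_add[symmetric])
  finally show ?thesis by (simp add: \<kappa>_def)
qed

end

section \<open>Sequence space and the maximal inequality\<close>

definition path_sum :: "(nat \<Rightarrow> 'a::group_add) \<Rightarrow> nat \<Rightarrow> 'a" where
  "path_sum s n = sum_list (map s [0..<n])"

lemma walk_path_sum: "walk \<omega> n x = path_sum (\<lambda>k. \<omega> k x) n"
  by (simp add: walk_def path_sum_def)

lemma path_sum_0 [simp]: "path_sum s 0 = 0"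
  by (simp add: path_sum_def)

lemma path_sum_Suc: "path_sum s (Suc n) = path_sum s n + s n"
  by (simp add: path_sum_def)

lemma path_sum_Suc_shift: "path_sum s (Suc n) = s 0 + path_sum (\<lambda>k. s (Suc k)) n"
  by (induction n) (simp_all add: path_sum_Suc add.assoc)

lemma path_sum_add: "path_sum s (m + n) = path_sum s m + path_sum (\<lambda>k. s (m + k)) n"
  by (induction n) (simp_all add: path_sum_Suc add.assoc)

context quasimorphism_walk
begin

abbreviation paths :: "(nat \<Rightarrow> 'a) measure" where "paths \<equiv> PiM UNIV (\<lambda>_. \<mu>)"

lemma sets_paths [measurable_cong]: "sets paths = sets (PiM UNIV (\<lambda>_::nat. borel :: 'a measure))"
  by (rule sets_PiM_cong) (simp_all add: sets_mu)

lemma space_paths [simp]: "space paths = UNIV"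
  using sets_eq_imp_space_eq[OF sets_mu] by (simp add: space_PiM)

lemma prob_space_paths: "prob_space paths"
  by (rule prob_space_PiM) (rule prob_space_axioms)

lemma path_sum_measurable [measurable]:
  "(\<lambda>s. path_sum s n) \<in> PiM UNIV (\<lambda>_::nat. borel :: 'a measure) \<rightarrow>\<^sub>M borel"
  by (induction n) (simp_all add: path_sum_Suc)

lemma nn_integral_paths:
  assumes [measurable]: "f \<in> borel_measurable paths"
  shows "(\<integral>\<^sup>+s. f s \<partial>paths) = (\<integral>\<^sup>+h. \<integral>\<^sup>+s. f (case_nat h s) \<partial>paths \<partial>\<mu>)"
proof -
  interpret S: prob_space paths by (rule prob_space_paths)
  interpret sequence_space \<mu> by unfold_locales
  have m: "(\<lambda>(s, \<omega>). case_nat s \<omega>) \<in> \<mu> \<Otimes>\<^sub>M paths \<rightarrow>\<^sub>M paths" by measurable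
  have "(\<integral>\<^sup>+s. f s \<partial>paths) = (\<integral>\<^sup>+s. f s \<partial>distr (\<mu> \<Otimes>\<^sub>M paths) paths (\<lambda>(s, \<omega>). case_nat s \<omega>))"
    by (simp add: PiM_iter)
  also have "\<dots> = (\<integral>\<^sup>+z. f (case z of (s, \<omega>) \<Rightarrow> case_nat s \<omega>) \<partial>(\<mu> \<Otimes>\<^sub>M paths))"
    by (rule nn_integral_distr[OF m]) simp
  also have "\<dots> = (\<integral>\<^sup>+h. \<integral>\<^sup>+s. f (case_nat h s) \<partial>paths \<partial>\<mu>)"
    by (subst S.nn_integral_fst[symmetric]) (use measurable_compose[OF m assms] in simp_all)
  finally show ?thesis .
qed

lemma nn_integral_conv_Suc:
  assumes [measurable]: "f \<in> borel_measurable borel"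
  shows "(\<integral>\<^sup>+z. f z \<partial>conv (Suc n)) = (\<integral>\<^sup>+h. \<integral>\<^sup>+z. f (h + z) \<partial>conv n \<partial>\<mu>)"
  using nn_integral_convolution_power_add[OF prob_space_axioms sets_mu assms, of 1 n]
  by (simp add: conv_1[simplified])

lemma nn_integral_path_sum:
  assumes "f \<in> borel_measurable borel"
  shows "(\<integral>\<^sup>+s. f (path_sum s n) \<partial>paths) = (\<integral>\<^sup>+h. f h \<partial>conv n)"
  using assms
proof (induction n arbitrary: f)
  case 0
  interpret S: prob_space paths by (rule prob_space_paths)
  show ?case using 0 by (simp add: nn_integral_return S.emeasure_space_1[simplified])
next
  case (Suc n)
  note [measurable] = Suc.prems
  have "(\<integral>\<^sup>+s. f (path_sum s (Suc n)) \<partial>paths) = (\<integral>\<^sup>+h. \<integral>\<^sup>+s. f (h + path_sum s n) \<partial>paths \<partial>\<mu>)"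
    by (subst nn_integral_paths) (measurable, simp add: path_sum_Suc_shift)
  also have "\<dots> = (\<integral>\<^sup>+h. \<integral>\<^sup>+z. f (h + z) \<partial>conv n \<partial>\<mu>)"
    by (subst Suc.IH) auto
  also have "\<dots> = (\<integral>\<^sup>+z. f z \<partial>conv (Suc n))"
    by (rule nn_integral_conv_Suc[symmetric]) measurable
  finally show ?case .
qed

lemma distr_path_sum: "distr paths borel (\<lambda>s. path_sum s n) = conv n"
proof (rule measure_eqI)
  fix A assume "A \<in> sets (distr paths borel (\<lambda>s. path_sum s n))"
  then have A[measurable]: "A \<in> sets borel" by simp
  have "emeasure (distr paths borel (\<lambda>s. path_sum s n)) A = (\<integral>\<^sup>+z. indicator A z \<partial>distr paths borel (\<lambda>s. path_sum s n))"
    by simp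
  also have "\<dots> = (\<integral>\<^sup>+s. indicator A (path_sum s n) \<partial>paths)"
    by (rule nn_integral_distr) measurable
  also have "\<dots> = emeasure (conv n) A"
    by (subst nn_integral_path_sum) auto
  finally show "emeasure (distr paths borel (\<lambda>s. path_sum s n)) A = emeasure (conv n) A" .
qed simp

text \<open>
  If \<open>\<phi>\<close> is already above the level at the starting point, it remains above the slightly lower level after \<open>N\<close>
  steps as soon as the remaining walk does not fall by more than \<open>y\<close>.
\<close>

lemma immediate_exceedance:
  assumes "1 / 2 \<le> measure (conv N) {h. - y \<le> \<phi> h - real N * a}" and c: "c < \<phi> g"
  shows "emeasure paths A \<le> 2 * emeasure (conv N) {h. c - y - D < \<phi> (g + h) - real N * a}"
proof -
  interpret S: prob_space paths by (rule prob_space_paths)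
  have "{h. - y \<le> \<phi> h - real N * a} \<subseteq> {h. c - y - D < \<phi> (g + h) - real N * a}"
  proof safe
    fix h assume "- y \<le> \<phi> h - real N * a"
    then show "c - y - D < \<phi> (g + h) - real N * a" using quasi[of g h] c by linarith
  qed
  then have "measure (conv N) {h. - y \<le> \<phi> h - real N * a} \<le> measure (conv N) {h. c - y - D < \<phi> (g + h) - real N * a}"
    by (rule conv.finite_measure_mono) measurable
  with assms(1) have "1 \<le> 2 * measure (conv N) {h. c - y - D < \<phi> (g + h) - real N * a}" by simp
  then have "1 \<le> 2 * emeasure (conv N) {h. c - y - D < \<phi> (g + h) - real N * a}"
    by (simp add: conv.emeasure_eq_measure ennreal_mult[symmetric] flip: ennreal_numeral ennreal_1)
  then show ?thesis using S.emeasure_le_1 order.trans by blast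
qed

text \<open>
  Ottaviani's maximal inequality. At the first time at which the level is exceeded, the remaining walk
  is independent of the past and with probability at least \<open>1 / 2\<close> does not fall by more than \<open>y\<close>. The
  induction on \<open>N\<close> over all starting points replaces the stopping time.
\<close>

lemma maximal_inequality:
  assumes "\<And>j. j \<le> N \<Longrightarrow> 1 / 2 \<le> measure (conv j) {h. - y \<le> \<phi> h - real j * a}"
  shows "emeasure paths {s. \<exists>k\<le>N. c < \<phi> (g + path_sum s k) - real k * a}
     \<le> 2 * emeasure (conv N) {h. c - y - D < \<phi> (g + h) - real N * a}"
  using assms
proof (induction N arbitrary: g c)
  case (0 g c)
  show ?case
  proof (cases "c < \<phi> g")
    case True
    then show ?thesis using immediate_exceedance[OF "0"[OF order_refl] True] by simp
  next
    case False
    then show ?thesis by simp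
  qed
next
  case (Suc N g c)
  show ?case
  proof (cases "c < \<phi> g")
    case True
    then show ?thesis using immediate_exceedance[OF Suc.prems[OF order_refl] True] by simp
  next
    case False
    let ?E = "\<lambda>N g c. {s. \<exists>k\<le>N. c < \<phi> (g + path_sum s k) - real k * a}"
    let ?F = "\<lambda>N g c. {h. c - y - D < \<phi> (g + h) - real N * a}"
    have [measurable]: "?E N g c \<in> sets paths" for N g c
    proof -
      have "{s \<in> space paths. \<exists>k\<le>N. c < \<phi> (g + path_sum s k) - real k * a} \<in> sets paths" by measurable
      then show ?thesis by simp
    qed
    have shift: "case_nat h s \<in> ?E (Suc N) g c \<longleftrightarrow> s \<in> ?E N (g + h) (c + a)" for h s
    proof
      assume "case_nat h s \<in> ?E (Suc N) g c"
      then obtain k where k: "k \<le> Suc N" "c < \<phi> (g + path_sum (case_nat h s) k) - real k * a" by blast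
      then obtain k' where "k = Suc k'" using False by (cases k) auto
      with k show "s \<in> ?E N (g + h) (c + a)"
        by (auto simp: path_sum_Suc_shift add.assoc algebra_simps intro!: exI[of _ k'])
    next
      assume "s \<in> ?E N (g + h) (c + a)"
      then obtain k where "k \<le> N" "c + a < \<phi> (g + h + path_sum s k) - real k * a" by blast
      then show "case_nat h s \<in> ?E (Suc N) g c"
        by (auto simp: path_sum_Suc_shift add.assoc algebra_simps intro!: exI[of _ "Suc k"])
    qed
    have "emeasure paths (?E (Suc N) g c) = (\<integral>\<^sup>+s. indicator (?E (Suc N) g c) s \<partial>paths)"
      by (subst nn_integral_indicator) measurable
    also have "\<dots> = (\<integral>\<^sup>+h. \<integral>\<^sup>+s. indicator (?E (Suc N) g c) (case_nat h s) \<partial>paths \<partial>\<mu>)"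
      by (rule nn_integral_paths) measurable
    also have "\<dots> = (\<integral>\<^sup>+h. \<integral>\<^sup>+s. indicator (?E N (g + h) (c + a)) s \<partial>paths \<partial>\<mu>)"
      by (intro nn_integral_cong) (simp only: indicator_def shift)
    also have "\<dots> = (\<integral>\<^sup>+h. emeasure paths (?E N (g + h) (c + a)) \<partial>\<mu>)"
      by simp
    also have "\<dots> \<le> (\<integral>\<^sup>+h. 2 * emeasure (conv N) (?F N (g + h) (c + a)) \<partial>\<mu>)"
      by (intro nn_integral_mono Suc.IH Suc.prems) auto
    also have "\<dots> = (\<integral>\<^sup>+h. 2 * (\<integral>\<^sup>+z. indicator (?F (Suc N) g c) (h + z) \<partial>conv N) \<partial>\<mu>)"
    proof (rule nn_integral_cong)
      fix h
      have "(\<integral>\<^sup>+z. indicator (?F (Suc N) g c) (h + z) \<partial>conv N) = (\<integral>\<^sup>+z. indicator (?F N (g + h) (c + a)) z \<partial>conv N)"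
        by (intro nn_integral_cong) (auto simp: indicator_def algebra_simps add.assoc)
      then show "2 * emeasure (conv N) (?F N (g + h) (c + a)) = 2 * (\<integral>\<^sup>+z. indicator (?F (Suc N) g c) (h + z) \<partial>conv N)"
        by simp
    qed
    also have "\<dots> = 2 * (\<integral>\<^sup>+h. \<integral>\<^sup>+z. indicator (?F (Suc N) g c) (h + z) \<partial>conv N \<partial>\<mu>)"
      by (rule nn_integral_cmult) measurable
    also have "(\<integral>\<^sup>+h. \<integral>\<^sup>+z. indicator (?F (Suc N) g c) (h + z) \<partial>conv N \<partial>\<mu>) = (\<integral>\<^sup>+z. indicator (?F (Suc N) g c) z \<partial>conv (Suc N))"
      by (rule nn_integral_conv_Suc[symmetric]) measurable
    also have "\<dots> = emeasure (conv (Suc N)) (?F (Suc N) g c)"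
      by (subst nn_integral_indicator) (auto simp del: convolution_power.simps)
    finally show ?thesis .
  qed
qed

end

lemma path_distribution:
  fixes \<mu> :: "'a::{topological_group_add, second_countable_topology} measure"
  assumes "iid_increments \<mu> P \<omega>"
  shows "distr P (PiM UNIV (\<lambda>_. borel)) (\<lambda>x k. \<omega> k x) = PiM UNIV (\<lambda>_. \<mu>)"
    and "\<And>k. \<omega> k \<in> P \<rightarrow>\<^sub>M borel"
proof -
  interpret prob_space P using assms by (simp add: iid_increments_def)
  have ind: "indep_vars (\<lambda>_. borel) \<omega> UNIV" and d: "\<And>k. distr P borel (\<omega> k) = \<mu>"
    using assms by (simp_all add: iid_increments_def)
  show rv: "\<And>k. \<omega> k \<in> P \<rightarrow>\<^sub>M borel" using ind by (simp add: indep_vars_def)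
  show "distr P (PiM UNIV (\<lambda>_. borel)) (\<lambda>x k. \<omega> k x) = PiM UNIV (\<lambda>_. \<mu>)"
    using indep_vars_iff_distr_eq_PiM[where I = UNIV and M' = "\<lambda>_. borel" and X = \<omega>] rv ind by (simp add: d restrict_UNIV)
qed

section \<open>Truncation\<close>

context quasimorphism_walk
begin

text \<open>
  The summand \<open>3 * D\<close> makes \<open>weight h\<close> a bound for the change of \<open>\<phi>\<close> when one factor \<open>h\<close> of a product
  is replaced by the neutral element.
\<close>

definition weight :: "'a \<Rightarrow> real" where "weight g = \<bar>\<phi> g\<bar> + 3 * D"

definition trunc :: "real \<Rightarrow> 'a \<Rightarrow> 'a" where "trunc b g = (if weight g \<le> b then g else 0)"

definition excess :: "real \<Rightarrow> 'a \<Rightarrow> real" where "excess b g = (if weight g \<le> b then 0 else weight g)"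

lemma weight_nonneg: "0 \<le> weight g"
  using D_nonneg by (simp add: weight_def)

lemma excess_nonneg: "0 \<le> excess b g"
  using weight_nonneg by (simp add: excess_def)

lemma excess_le_weight: "excess b g \<le> weight g"
  using weight_nonneg by (simp add: excess_def)

lemma weight_measurable [measurable]: "weight \<in> borel_measurable borel"
  unfolding weight_def by measurable

lemma trunc_measurable [measurable]: "trunc b \<in> borel \<rightarrow>\<^sub>M borel"
  unfolding trunc_def by measurable

lemma excess_measurable [measurable]: "excess b \<in> borel_measurable borel"
  unfolding excess_def by measurable

lemma phi_trunc_le_weight: "\<bar>\<phi> (trunc b g)\<bar> \<le> weight g"
  using phi_0 D_nonneg by (auto simp: trunc_def weight_def)

lemma phi_trunc_le: "0 \<le> b \<Longrightarrow> \<bar>\<phi> (trunc b g)\<bar> \<le> b + D"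
  using phi_0 D_nonneg by (auto simp: trunc_def weight_def)

lemma weight_square_integrable: "integrable \<mu> (\<lambda>g. (weight g)\<^sup>2)"
  by (rule second_moment_perturbation(1)[where X = "\<lambda>g. \<bar>\<phi> g\<bar>" and c = "3 * D"])
    (use D_nonneg square_integrable in \<open>auto simp: weight_def[abs_def]\<close>)

lemma weight_integrable: "integrable \<mu> weight"
  by (rule square_integrable_imp_integrable[OF _ weight_square_integrable]) measurable

lemma excess_integrable: "integrable \<mu> (excess b)"
  by (rule Bochner_Integration.integrable_bound[OF weight_integrable])
    (use excess_nonneg excess_le_weight weight_nonneg in auto)

lemma quasimorphism_walk_trunc: "quasimorphism_walk (distr \<mu> borel (trunc b)) \<phi> D"
proof (intro quasimorphism_walk.intro quasimorphism_walk_axioms.intro)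
  show "prob_space (distr \<mu> borel (trunc b))" by (rule prob_space_distr) measurable
  have "integrable \<mu> (\<lambda>g. (\<phi> (trunc b g))\<^sup>2)"
  proof (rule Bochner_Integration.integrable_bound[OF weight_square_integrable])
    have "(\<phi> (trunc b g))\<^sup>2 \<le> (weight g)\<^sup>2" for g
      using phi_trunc_le_weight[of b g] weight_nonneg[of g] by (subst abs_le_square_iff[symmetric]) simp
    then show "AE g in \<mu>. norm ((\<phi> (trunc b g))\<^sup>2) \<le> norm ((weight g)\<^sup>2)" by simp
  qed measurable
  then show "integrable (distr \<mu> borel (trunc b)) (\<lambda>g. (\<phi> g)\<^sup>2)"
    by (subst integrable_distr_eq) auto
qed (auto simp: quasi)

text \<open>
  Deleting a factor from a product changes \<open>\<phi>\<close> by at most its weight; the factors are treated one at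
  a time, and the induction runs over all left factors \<open>g\<close> so that the defects do not accumulate on the factors
  that are kept.
\<close>

lemma path_sum_trunc_distance:
  "\<bar>\<phi> (g + path_sum s n) - \<phi> (g + path_sum (\<lambda>k. trunc b (s k)) n)\<bar> \<le> (\<Sum>k<n. excess b (s k))"
proof (induction n arbitrary: g s)
  case (Suc n)
  let ?s = "\<lambda>k. s (Suc k)"
  define w where "w = path_sum (\<lambda>k. trunc b (?s k)) n"
  have "\<bar>\<phi> (g + s 0 + path_sum ?s n) - \<phi> (g + s 0 + w)\<bar> \<le> (\<Sum>k<n. excess b (?s k))"
    unfolding w_def by (rule Suc.IH)
  moreover have "\<bar>\<phi> (g + s 0 + w) - \<phi> (g + trunc b (s 0) + w)\<bar> \<le> excess b (s 0)"
    using quasi[of "g + s 0" w] quasi[of g "s 0"] quasi[of g w]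
    by (auto simp: trunc_def excess_def weight_def)
  ultimately have "\<bar>\<phi> (g + s 0 + path_sum ?s n) - \<phi> (g + trunc b (s 0) + w)\<bar> \<le> excess b (s 0) + (\<Sum>k<n. excess b (?s k))"
    by linarith
  then show ?case
    by (simp add: path_sum_Suc_shift sum.lessThan_Suc_shift w_def add.assoc del: sum.lessThan_Suc)
qed simp

end

lemma iid_map:
  fixes \<mu> :: "'a::{topological_group_add, second_countable_topology} measure"
  assumes iid: "iid_increments \<mu> P \<omega>" and s: "sets \<mu> = sets borel" and [measurable]: "f \<in> borel \<rightarrow>\<^sub>M borel"
  shows "iid_increments (distr \<mu> borel f) P (\<lambda>k x. f (\<omega> k x))"
proof -
  interpret prob_space P using iid by (simp add: iid_increments_def)
  have "distr P borel (\<lambda>x. f (\<omega> k x)) = distr \<mu> borel f" for k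
  proof -
    have "\<mu> = distr P borel (\<omega> k)" using iid by (simp add: iid_increments_def)
    then show ?thesis using path_distribution(2)[OF iid, of k]
      by (simp add: distr_distr comp_def)
  qed
  moreover have "indep_vars (\<lambda>_. borel) (\<lambda>k x. f (\<omega> k x)) UNIV"
    by (rule indep_vars_compose2[where X = \<omega> and Y = "\<lambda>_. f" and M' = "\<lambda>_. borel"])
      (use iid in \<open>simp_all add: iid_increments_def\<close>)
  ultimately show ?thesis by (simp add: iid_increments_def prob_space_axioms)
qed

lemma square_integrable_add:
  fixes f g :: "'a \<Rightarrow> real"
  assumes [measurable]: "f \<in> borel_measurable M" "g \<in> borel_measurable M"
    and "integrable M (\<lambda>x. (f x)\<^sup>2)" "integrable M (\<lambda>x. (g x)\<^sup>2)"
  shows "integrable M (\<lambda>x. (f x + g x)\<^sup>2)"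
proof (rule Bochner_Integration.integrable_bound)
  show "integrable M (\<lambda>x. 2 * (f x)\<^sup>2 + 2 * (g x)\<^sup>2)" using assms by simp
  have "(f x + g x)\<^sup>2 \<le> 2 * (f x)\<^sup>2 + 2 * (g x)\<^sup>2" for x
    using zero_le_power2[of "f x - g x"] by (simp add: power2_eq_square algebra_simps)
  then show "AE x in M. norm ((f x + g x)\<^sup>2) \<le> norm (2 * (f x)\<^sup>2 + 2 * (g x)\<^sup>2)" by auto
qed measurable

locale quasimorphism_random_walk = quasimorphism_walk \<mu> \<phi> D
  for \<mu> :: "'a::{topological_group_add, second_countable_topology} measure" and \<phi> D +
  fixes P :: "'w measure" and \<omega> :: "nat \<Rightarrow> 'w \<Rightarrow> 'a"
  assumes iid: "iid_increments \<mu> P \<omega>"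
begin

sublocale P: prob_space P
  using iid by (simp add: iid_increments_def)

lemma increment_measurable [measurable]: "\<omega> k \<in> P \<rightarrow>\<^sub>M borel"
  by (rule path_distribution(2)[OF iid])

lemma increment_distr: "distr P borel (\<omega> k) = \<mu>"
  using iid by (simp add: iid_increments_def)

lemma path_measurable [measurable]: "(\<lambda>x k. \<omega> k x) \<in> P \<rightarrow>\<^sub>M PiM UNIV (\<lambda>_. borel)"
  by (rule measurable_PiM_single') (auto simp: space_PiM)

lemma walk_measurable [measurable]: "walk \<omega> n \<in> P \<rightarrow>\<^sub>M borel"
  unfolding walk_path_sum by measurable

lemma walk_distr: "distr P borel (walk \<omega> n) = conv n"
proof -
  have "distr P borel (walk \<omega> n) = distr (distr P (PiM UNIV (\<lambda>_. borel)) (\<lambda>x k. \<omega> k x)) borel (\<lambda>s. path_sum s n)"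
    by (subst distr_distr) (auto simp: walk_path_sum[abs_def] comp_def)
  also have "\<dots> = conv n"
    unfolding path_distribution(1)[OF iid] by (rule distr_path_sum)
  finally show ?thesis .
qed

lemma integral_walk:
  fixes f :: "'a \<Rightarrow> real"
  assumes "f \<in> borel_measurable borel"
  shows "(\<integral>x. f (walk \<omega> n x) \<partial>P) = (\<integral>g. f g \<partial>conv n)"
  unfolding walk_distr[symmetric] using assms by (subst integral_distr) auto

lemma integrable_walk:
  fixes f :: "'a \<Rightarrow> real"
  assumes "f \<in> borel_measurable borel"
  shows "integrable P (\<lambda>x. f (walk \<omega> n x)) \<longleftrightarrow> integrable (conv n) f"
  unfolding walk_distr[symmetric] using assms by (subst integrable_distr_eq) auto

lemma measure_walk:
  assumes "A \<in> sets borel"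
  shows "measure P {x \<in> space P. walk \<omega> n x \<in> A} = measure (conv n) A"
  unfolding walk_distr[symmetric] using assms
  by (subst measure_distr) (auto intro!: arg_cong[where f = "measure P"])

lemma integral_increment:
  fixes f :: "'a \<Rightarrow> real"
  assumes "f \<in> borel_measurable borel"
  shows "(\<integral>x. f (\<omega> k x) \<partial>P) = (\<integral>g. f g \<partial>\<mu>)"
    and "integrable P (\<lambda>x. f (\<omega> k x)) \<longleftrightarrow> integrable \<mu> f"
proof -
  show "(\<integral>x. f (\<omega> k x) \<partial>P) = (\<integral>g. f g \<partial>\<mu>)"
    unfolding increment_distr[of k, symmetric] using assms by (subst integral_distr) auto
  show "integrable P (\<lambda>x. f (\<omega> k x)) \<longleftrightarrow> integrable \<mu> f"
    unfolding increment_distr[of k, symmetric] using assms by (subst integrable_distr_eq) auto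
qed

lemma measure_maximum:
  assumes "\<And>j. j \<le> N \<Longrightarrow> 1 / 2 \<le> measure (conv j) {h. - y \<le> \<phi> h - real j * a}"
  shows "measure P {x \<in> space P. \<exists>k\<le>N. c < \<phi> (walk \<omega> k x) - real k * a}
     \<le> 2 * measure (conv N) {h. c - y - D < \<phi> h - real N * a}"
proof -
  let ?E = "{s. \<exists>k\<le>N. c < \<phi> (path_sum s k) - real k * a}"
  have E: "?E \<in> sets (PiM UNIV (\<lambda>_. borel))"
  proof -
    have "{s \<in> space (PiM UNIV (\<lambda>_. borel)). \<exists>k\<le>N. c < \<phi> (path_sum s k) - real k * a} \<in> sets (PiM UNIV (\<lambda>_. borel))"
      by measurable
    then show ?thesis by (simp add: space_PiM)
  qed
  have "emeasure P {x \<in> space P. \<exists>k\<le>N. c < \<phi> (walk \<omega> k x) - real k * a} =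
      emeasure (distr P (PiM UNIV (\<lambda>_. borel)) (\<lambda>x k. \<omega> k x)) ?E"
    using E by (subst emeasure_distr) (auto simp: walk_path_sum intro!: arg_cong[where f = "emeasure P"])
  also have "\<dots> \<le> 2 * emeasure (conv N) {h. c - y - D < \<phi> h - real N * a}"
    unfolding path_distribution(1)[OF iid]
    using maximal_inequality[of N y a c 0] assms by simp
  finally show ?thesis
    by (simp add: P.emeasure_eq_measure conv.emeasure_eq_measure ennreal_mult[symmetric] flip: ennreal_numeral)
qed

definition remainder :: "real \<Rightarrow> nat \<Rightarrow> 'w \<Rightarrow> real" where
  "remainder b n x = (\<Sum>k<n. excess b (\<omega> k x))"

lemma remainder_measurable [measurable]: "remainder b n \<in> borel_measurable P"
  unfolding remainder_def by measurable

lemma remainder_nonneg: "0 \<le> remainder b n x"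
  unfolding remainder_def by (intro sum_nonneg excess_nonneg)

lemma remainder_mono: "m \<le> n \<Longrightarrow> remainder b m x \<le> remainder b n x"
  unfolding remainder_def by (intro sum_mono2) (auto simp: excess_nonneg)

lemma remainder_integral:
  "(\<integral>x. remainder b n x \<partial>P) = real n * (\<integral>g. excess b g \<partial>\<mu>)" and remainder_integrable: "integrable P (remainder b n)"
  unfolding remainder_def[abs_def] using excess_integrable[of b] integral_increment[of "excess b"] by auto

abbreviation trunc_walk :: "real \<Rightarrow> nat \<Rightarrow> 'w \<Rightarrow> 'a" where
  "trunc_walk b \<equiv> walk (\<lambda>k x. trunc b (\<omega> k x))"

lemma trunc_walk_distance: "\<bar>\<phi> (walk \<omega> n x) - \<phi> (trunc_walk b n x)\<bar> \<le> remainder b n x"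
  using path_sum_trunc_distance[of 0 "\<lambda>k. \<omega> k x" n b] by (simp add: walk_path_sum remainder_def)

interpretation C: quasimorphism_random_walk "distr \<mu> borel (trunc b)" \<phi> D P "\<lambda>k x. trunc b (\<omega> k x)" for b
  by (intro quasimorphism_random_walk.intro quasimorphism_walk_trunc quasimorphism_random_walk_axioms.intro
      iid_map iid sets_mu trunc_measurable)

lemma trunc_mean: "\<bar>C.mean b n - mean n\<bar> \<le> real n * (\<integral>g. excess b g \<partial>\<mu>)"
proof -
  have i: "integrable P (\<lambda>x. \<phi> (walk \<omega> n x))" "integrable P (\<lambda>x. \<phi> (trunc_walk b n x))"
    by (simp_all add: integrable_walk integrable_phi_conv C.integrable_walk C.integrable_phi_conv)
  have "\<bar>C.mean b n - mean n\<bar> = \<bar>\<integral>x. \<phi> (trunc_walk b n x) - \<phi> (walk \<omega> n x) \<partial>P\<bar>"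
    using i by (simp add: mean_def C.mean_def integral_walk C.integral_walk)
  also have "\<dots> \<le> (\<integral>x. remainder b n x \<partial>P)"
    using i trunc_walk_distance
    by (intro order.trans[OF integral_abs_bound] integral_mono remainder_integrable) (auto simp: abs_minus_commute)
  finally show ?thesis by (simp add: remainder_integral)
qed

text \<open>
  For a fixed length, the truncated walk eventually coincides with the original one, so the second
  moments about \<open>mean m\<close> converge by dominated convergence; they bound the variances from above.
\<close>

lemma trunc_var_eventually:
  assumes b: "filterlim b at_top sequentially" and v: "var m < v"
  shows "eventually (\<lambda>k. C.var (b k) m < v) sequentially"
proof -
  let ?E = "mean m"
  let ?G = "\<lambda>x. \<bar>\<phi> (walk \<omega> m x) - ?E\<bar> + (\<Sum>k<m. weight (\<omega> k x))"
  have sum2: "integrable P (\<lambda>x. (\<Sum>k<n. weight (\<omega> k x))\<^sup>2)" for n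
  proof (induction n)
    case (Suc n)
    have "integrable P (\<lambda>x. (weight (\<omega> n x))\<^sup>2)"
      by (subst integral_increment(2)[of "\<lambda>g. (weight g)\<^sup>2"]) (auto simp: weight_square_integrable)
    with Suc show ?case by (simp add: square_integrable_add)
  qed simp
  have "integrable P (\<lambda>x. (\<phi> (walk \<omega> m x) - ?E)\<^sup>2)"
    by (subst integrable_walk[of "\<lambda>g. (\<phi> g - ?E)\<^sup>2"]) (auto simp: square_integrable_centered)
  then have G2: "integrable P (\<lambda>x. (?G x)\<^sup>2)"
    by (intro square_integrable_add sum2) auto
  have dist: "\<bar>\<phi> (trunc_walk c m x) - ?E\<bar> \<le> ?G x" for c x
  proof -
    have "remainder c m x \<le> (\<Sum>k<m. weight (\<omega> k x))"
      unfolding remainder_def by (intro sum_mono excess_le_weight)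
    then show ?thesis using trunc_walk_distance[of m x c] by linarith
  qed
  have "(\<lambda>k. \<integral>x. (\<phi> (trunc_walk (b k) m x) - ?E)\<^sup>2 \<partial>P) \<longlonglongrightarrow> (\<integral>x. (\<phi> (walk \<omega> m x) - ?E)\<^sup>2 \<partial>P)"
  proof (rule integral_dominated_convergence[OF _ _ G2])
    show "AE x in P. (\<lambda>k. (\<phi> (trunc_walk (b k) m x) - ?E)\<^sup>2) \<longlonglongrightarrow> (\<phi> (walk \<omega> m x) - ?E)\<^sup>2"
    proof (rule AE_I2)
      fix x
      have "eventually (\<lambda>k. \<forall>i\<in>{..<m}. weight (\<omega> i x) \<le> b k) sequentially"
        using b by (intro eventually_ball_finite) (auto simp: filterlim_at_top)
      then have "eventually (\<lambda>k. (\<phi> (trunc_walk (b k) m x) - ?E)\<^sup>2 = (\<phi> (walk \<omega> m x) - ?E)\<^sup>2) sequentially"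
      proof eventually_elim
        case (elim k)
        then have "map (\<lambda>i. trunc (b k) (\<omega> i x)) [0..<m] = map (\<lambda>i. \<omega> i x) [0..<m]"
          by (simp add: trunc_def)
        then show ?case by (simp only: walk_def)
      qed
      then show "(\<lambda>k. (\<phi> (trunc_walk (b k) m x) - ?E)\<^sup>2) \<longlonglongrightarrow> (\<phi> (walk \<omega> m x) - ?E)\<^sup>2"
        by (rule tendsto_eventually)
    qed
    show "AE x in P. norm ((\<phi> (trunc_walk (b k) m x) - ?E)\<^sup>2) \<le> (?G x)\<^sup>2" for k
    proof (rule AE_I2)
      fix x show "norm ((\<phi> (trunc_walk (b k) m x) - ?E)\<^sup>2) \<le> (?G x)\<^sup>2"
        using dist[of "b k" x] by (simp, subst abs_le_square_iff[symmetric]) simp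
    qed
  qed measurable
  then have "(\<lambda>k. \<integral>x. (\<phi> (trunc_walk (b k) m x) - ?E)\<^sup>2 \<partial>P) \<longlonglongrightarrow> var m"
    by (simp add: var_def integral_walk[of "\<lambda>g. (\<phi> g - ?E)\<^sup>2"])
  then have "eventually (\<lambda>k. (\<integral>x. (\<phi> (trunc_walk (b k) m x) - ?E)\<^sup>2 \<partial>P) < v) sequentially"
    using v by (rule order_tendstoD(2))
  then show ?thesis
  proof eventually_elim
    case (elim k)
    have "C.var (b k) m = (\<integral>g. (\<phi> g)\<^sup>2 \<partial>C.conv (b k) m) - (C.mean (b k) m)\<^sup>2"
      unfolding C.var_def C.mean_def
      by (rule C.conv.variance_eq) (auto simp: C.integrable_phi_conv C.square_integrable_conv)
    also have "\<dots> \<le> (\<integral>g. (\<phi> g)\<^sup>2 \<partial>C.conv (b k) m) - 2 * ?E * C.mean (b k) m + ?E\<^sup>2"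
      using zero_le_power2[of "C.mean (b k) m - ?E"] by (simp add: power2_eq_square algebra_simps)
    also have "\<dots> = (\<integral>g. (\<phi> g - ?E)\<^sup>2 \<partial>C.conv (b k) m)"
      using C.integrable_phi_conv[of "b k" m] C.square_integrable_conv[of "b k" m] C.conv.prob_space[of "b k" m]
      by (simp add: power2_diff C.mean_def algebra_simps)
    also have "\<dots> = (\<integral>x. (\<phi> (trunc_walk (b k) m x) - ?E)\<^sup>2 \<partial>P)"
      by (rule C.integral_walk[symmetric]) measurable
    also note elim
    finally show ?case .
  qed
qed

end

section \<open>The upper half of the law of the iterated logarithm\<close>

text \<open>
  For a sequence that grows geometrically, the terms below a level add up to a multiple of the level. The
  sum telescopes after comparison with \<open>min (b k) (\<rho> * y)\<close>.
\<close>

lemma sum_below_level: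
  fixes b :: "nat \<Rightarrow> real"
  assumes \<rho>: "1 < \<rho>" and b: "\<And>k. K \<le> k \<Longrightarrow> 0 \<le> b k \<and> \<rho> * b k \<le> b (Suc k)" and y: "0 \<le> y"
  shows "(\<Sum>k<n. if b (K + k) < y then b (K + k) else 0) \<le> \<rho> * y / (\<rho> - 1)"
proof -
  have step: "(\<rho> - 1) * (if b (K + k) < y then b (K + k) else 0) \<le>
      min (b (K + Suc k)) (\<rho> * y) - min (b (K + k)) (\<rho> * y)" for k
  proof -
    have "0 \<le> b (K + k)" "\<rho> * b (K + k) \<le> b (K + Suc k)" using b[of "K + k"] by auto
    moreover have "1 * b (K + k) \<le> \<rho> * b (K + k)"
      using \<open>0 \<le> b (K + k)\<close> \<rho> by (intro mult_right_mono) auto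
    moreover have "1 * y \<le> \<rho> * y" using y \<rho> by (intro mult_right_mono) auto
    moreover have "\<rho> * b (K + k) \<le> \<rho> * y" if "b (K + k) < y" using that \<rho> by (intro mult_left_mono) auto
    ultimately show ?thesis by (auto simp: min_def algebra_simps)
  qed
  have "(\<rho> - 1) * (\<Sum>k<n. if b (K + k) < y then b (K + k) else 0)
      \<le> (\<Sum>k<n. min (b (K + Suc k)) (\<rho> * y) - min (b (K + k)) (\<rho> * y))"
    unfolding sum_distrib_left by (intro sum_mono step)
  also have "\<dots> = min (b (K + n)) (\<rho> * y) - min (b K) (\<rho> * y)"
    using sum_lessThan_telescope[of "\<lambda>k. min (b (K + k)) (\<rho> * y)" n] by simp
  also have "\<dots> \<le> \<rho> * y"
  proof -
    have "0 \<le> min (b K) (\<rho> * y)" using b[of K] y \<rho> by simp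
    moreover have "min (b (K + n)) (\<rho> * y) \<le> \<rho> * y" by simp
    ultimately show ?thesis by linarith
  qed
  finally show ?thesis using \<rho> by (simp add: field_simps)
qed

context quasimorphism_walk
begin

definition mean_excess :: "real \<Rightarrow> real" where "mean_excess b = (\<integral>g. excess b g \<partial>\<mu>)"

lemma mean_excess_nonneg: "0 \<le> mean_excess b"
  unfolding mean_excess_def by (simp add: excess_nonneg)

text \<open>
  This is where a second moment is exactly what is needed: an increment of weight \<open>y\<close> is discarded on those
  scales with \<open>b k < y\<close>, so it contributes \<open>y\<close> times a sum of such \<open>b k\<close>, that is \<open>O(y\<^sup>2)\<close>.
\<close>

lemma weighted_excess_summable:
  fixes b :: "nat \<Rightarrow> real"
  assumes \<rho>: "1 < \<rho>" and b: "\<And>k. K \<le> k \<Longrightarrow> 0 \<le> b k \<and> \<rho> * b k \<le> b (Suc k)"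
  shows "summable (\<lambda>k. b k * mean_excess (b k))"
proof -
  have "summable (\<lambda>k. b (K + k) * mean_excess (b (K + k)))"
  proof (rule summableI_nonneg_bounded)
    show "0 \<le> b (K + k) * mean_excess (b (K + k))" for k using b[of "K + k"] mean_excess_nonneg by simp
    fix n
    have "(\<Sum>k<n. b (K + k) * mean_excess (b (K + k))) = (\<integral>g. (\<Sum>k<n. b (K + k) * excess (b (K + k)) g) \<partial>\<mu>)"
      unfolding mean_excess_def using excess_integrable by (subst Bochner_Integration.integral_sum) auto
    also have "\<dots> \<le> (\<integral>g. \<rho> / (\<rho> - 1) * (weight g)\<^sup>2 \<partial>\<mu>)"
    proof (rule integral_mono)
      show "integrable \<mu> (\<lambda>g. \<Sum>k<n. b (K + k) * excess (b (K + k)) g)" using excess_integrable by auto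
      show "integrable \<mu> (\<lambda>g. \<rho> / (\<rho> - 1) * (weight g)\<^sup>2)" using weight_square_integrable by simp
      fix g
      have "(\<Sum>k<n. b (K + k) * excess (b (K + k)) g) = weight g * (\<Sum>k<n. if b (K + k) < weight g then b (K + k) else 0)"
        unfolding sum_distrib_left by (intro sum.cong) (auto simp: excess_def)
      also have "\<dots> \<le> weight g * (\<rho> * weight g / (\<rho> - 1))"
        by (intro mult_left_mono sum_below_level[where b = b, OF \<rho> b] weight_nonneg)
      finally show "(\<Sum>k<n. b (K + k) * excess (b (K + k)) g) \<le> \<rho> / (\<rho> - 1) * (weight g)\<^sup>2"
        by (simp add: power2_eq_square algebra_simps)
    qed
    finally show "(\<Sum>k<n. b (K + k) * mean_excess (b (K + k))) \<le> (\<integral>g. \<rho> / (\<rho> - 1) * (weight g)\<^sup>2 \<partial>\<mu>)" .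
  qed
  then show ?thesis
    using summable_iff_shift[of "\<lambda>k. b k * mean_excess (b k)" K] by (simp add: add.commute)
qed

end

context quasimorphism_random_walk
begin

interpretation C: quasimorphism_random_walk "distr \<mu> borel (trunc b)" \<phi> D P "\<lambda>k x. trunc b (\<omega> k x)" for b
  by (intro quasimorphism_random_walk.intro quasimorphism_walk_trunc quasimorphism_random_walk_axioms.intro
      iid_map iid sets_mu trunc_measurable)

text \<open>
  The margin \<open>5 * u\<close> is spent as follows: \<open>u\<close> for the discarded increments, \<open>2 * u + D\<close> for the
  maximal inequality, and \<open>u\<close> for the difference between the mean of the truncated walk and \<open>N * ell\<close>.
\<close>

lemma maximum_tail_bound:
  assumes b: "0 \<le> b" and N: "N = p * m" and u: "0 < u"
    and W: "C.var b m + 8 * D * sqrt (C.var b m) + 16 * D\<^sup>2 \<le> W"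
    and Q: "real N * C.var_rate b \<le> u\<^sup>2 / 2"
    and B: "real N * mean_excess b + D \<le> u" and \<theta>: "0 \<le> \<theta>"
  shows "measure P {x \<in> space P. \<exists>j\<le>N. z + 5 * u < \<phi> (walk \<omega> j x) - real j * ell} \<le>
    real N * mean_excess b / u +
    2 * exp (real p * (\<theta>\<^sup>2 / 2 * exp (\<theta> * (2 * (D + real m * (b + 2 * D)) + 4 * D)) * W) - \<theta> * z)"
proof -
  let ?c = "2 * (D + real m * (b + 2 * D)) + 4 * D"
  have Du: "D \<le> u" using B mean_excess_nonneg[of b] by (smt (verit) mult_nonneg_nonneg of_nat_0_le_iff)
  have mean: "\<bar>C.mean b j - real j * ell\<bar> \<le> u" if "j \<le> N" for j
  proof -
    have "real j * mean_excess b \<le> real N * mean_excess b" using that mean_excess_nonneg by (intro mult_right_mono) auto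
    then show ?thesis using trunc_mean[of b j] mean_ell[of j] B unfolding mean_excess_def by linarith
  qed
  have cheb: "1 / 2 \<le> measure (C.conv b j) {h. - (2 * u) \<le> \<phi> h - real j * ell}" if j: "j \<le> N" for j
  proof -
    have "C.var b j \<le> real N * C.var_rate b"
    proof -
      have "real j * C.var_rate b \<le> real N * C.var_rate b"
        using j C.var_rate_nonneg[of b] by (intro mult_right_mono) auto
      then show ?thesis using C.var_le[of b j] by linarith
    qed
    with Q have v: "C.var b j \<le> u\<^sup>2 / 2" by linarith
    have "measure (C.conv b j) {h \<in> space (C.conv b j). u \<le> \<bar>\<phi> h - C.conv.expectation b j \<phi>\<bar>} \<le> C.var b j / u\<^sup>2"
      unfolding C.var_def C.mean_def
      by (rule C.conv.Chebyshev_inequality[OF _ C.square_integrable_conv u]) simp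
    also have "\<dots> \<le> 1 / 2" using v u by (simp add: field_simps)
    finally have "1 / 2 \<le> 1 - measure (C.conv b j) {h. u \<le> \<bar>\<phi> h - C.mean b j\<bar>}"
      by (simp add: C.mean_def)
    also have "\<dots> = measure (C.conv b j) (space (C.conv b j) - {h. u \<le> \<bar>\<phi> h - C.mean b j\<bar>})"
      by (rule C.conv.prob_compl[symmetric]) measurable
    also have "\<dots> \<le> measure (C.conv b j) {h. - (2 * u) \<le> \<phi> h - real j * ell}"
    proof (rule C.conv.finite_measure_mono)
      show "space (C.conv b j) - {h. u \<le> \<bar>\<phi> h - C.mean b j\<bar>} \<subseteq> {h. - (2 * u) \<le> \<phi> h - real j * ell}"
        using mean[OF j] by auto
    qed measurable
    finally show ?thesis .
  qed
  have bound: "AE g in distr \<mu> borel (trunc b). \<bar>\<phi> g\<bar> \<le> b + D"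
    by (subst AE_distr_iff) (auto simp: phi_trunc_le b)
  have AEm: "AE h in C.conv b m. \<bar>\<phi> h - C.mean b m\<bar> + 4 * D \<le> ?c"
  proof -
    have AEb: "AE h in C.conv b m. \<bar>\<phi> h\<bar> \<le> D + real m * (b + 2 * D)"
      using C.AE_conv_bounded[OF bound, of m] by (simp add: add.assoc)
    have "\<bar>C.mean b m\<bar> \<le> (\<integral>h. \<bar>\<phi> h\<bar> \<partial>C.conv b m)" unfolding C.mean_def by (rule integral_abs_bound)
    also have "\<dots> \<le> (\<integral>h. D + real m * (b + 2 * D) \<partial>C.conv b m)"
      using AEb C.integrable_phi_conv by (intro integral_mono_AE) auto
    finally have "\<bar>C.mean b m\<bar> \<le> D + real m * (b + 2 * D)"
      using C.conv.prob_space[of b m] by simp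
    then show ?thesis using AEb by (auto elim!: eventually_mono)
  qed
  have trunc_part: "measure P {x \<in> space P. \<exists>j\<le>N. z + 4 * u < \<phi> (trunc_walk b j x) - real j * ell} \<le>
      2 * exp (real p * (\<theta>\<^sup>2 / 2 * exp (\<theta> * ?c) * W) - \<theta> * z)"
  proof -
    have "measure P {x \<in> space P. \<exists>j\<le>N. z + 4 * u < \<phi> (trunc_walk b j x) - real j * ell}
      \<le> 2 * measure (C.conv b N) {h. z + 4 * u - 2 * u - D < \<phi> h - real N * ell}"
      using cheb by (rule C.measure_maximum)
    also have "measure (C.conv b N) {h. z + 4 * u - 2 * u - D < \<phi> h - real N * ell} \<le>
        measure (C.conv b N) {h. z < \<phi> h - C.mean b N}"
      using mean[of N] Du by (intro C.conv.finite_measure_mono) auto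
    also have "\<dots> \<le> exp (real p * (\<theta>\<^sup>2 / 2 * exp (\<theta> * ?c) * W) - \<theta> * z)"
      unfolding N by (rule C.exponential_tail[OF \<theta> AEm W])
    finally show ?thesis by simp
  qed
  have rem_part: "measure P {x \<in> space P. u \<le> remainder b N x} \<le> real N * mean_excess b / u"
    using integral_Markov_inequality_measure[OF remainder_integrable[of b N], of "space P" u] u
    by (simp add: remainder_nonneg remainder_integral mean_excess_def)
  have "measure P {x \<in> space P. \<exists>j\<le>N. z + 5 * u < \<phi> (walk \<omega> j x) - real j * ell} \<le>
     measure P ({x \<in> space P. u \<le> remainder b N x} \<union> {x \<in> space P. \<exists>j\<le>N. z + 4 * u < \<phi> (trunc_walk b j x) - real j * ell})"
  proof (rule P.finite_measure_mono)
    show "{x \<in> space P. \<exists>j\<le>N. z + 5 * u < \<phi> (walk \<omega> j x) - real j * ell} \<subseteq>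
      {x \<in> space P. u \<le> remainder b N x} \<union> {x \<in> space P. \<exists>j\<le>N. z + 4 * u < \<phi> (trunc_walk b j x) - real j * ell}"
    proof
      fix x assume "x \<in> {x \<in> space P. \<exists>j\<le>N. z + 5 * u < \<phi> (walk \<omega> j x) - real j * ell}"
      then obtain j where j: "x \<in> space P" "j \<le> N" "z + 5 * u < \<phi> (walk \<omega> j x) - real j * ell" by blast
      have "\<bar>\<phi> (walk \<omega> j x) - \<phi> (trunc_walk b j x)\<bar> \<le> remainder b N x"
        using trunc_walk_distance[of j x b] remainder_mono[OF j(2), of b x] by linarith
      then have "u \<le> remainder b N x \<or> z + 4 * u < \<phi> (trunc_walk b j x) - real j * ell"
        using j(3) by linarith
      with j show "x \<in> {x \<in> space P. u \<le> remainder b N x} \<union>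
          {x \<in> space P. \<exists>j\<le>N. z + 4 * u < \<phi> (trunc_walk b j x) - real j * ell}" by blast
    qed
    have [measurable]: "trunc_walk b j \<in> P \<rightarrow>\<^sub>M borel" for j by (rule C.walk_measurable)
    show "{x \<in> space P. u \<le> remainder b N x} \<union>
      {x \<in> space P. \<exists>j\<le>N. z + 4 * u < \<phi> (trunc_walk b j x) - real j * ell} \<in> sets P" by measurable
  qed
  also have "\<dots> \<le> measure P {x \<in> space P. u \<le> remainder b N x} +
      measure P {x \<in> space P. \<exists>j\<le>N. z + 4 * u < \<phi> (trunc_walk b j x) - real j * ell}"
  proof (rule measure_Un_le)
    have [measurable]: "trunc_walk b j \<in> P \<rightarrow>\<^sub>M borel" for j by (rule C.walk_measurable)
    show "{x \<in> space P. \<exists>j\<le>N. z + 4 * u < \<phi> (trunc_walk b j x) - real j * ell} \<in> sets P" by measurable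
  qed measurable
  also have "\<dots> \<le> real N * mean_excess b / u + 2 * exp (real p * (\<theta>\<^sup>2 / 2 * exp (\<theta> * ?c) * W) - \<theta> * z)"
    by (intro add_mono rem_part trunc_part)
  finally show ?thesis .
qed

text \<open>
  The levels \<open>a1 < a2\<close> between \<open>sqrt sigma2\<close> and \<open>a\<close> leave room for three losses: \<open>a1\<close> absorbs the
  difference between the variance of a block of length \<open>m\<close> and \<open>m * sigma2\<close>, the quotient \<open>a2 / a1\<close> absorbs the
  factor \<open>exp (\<theta> * c)\<close> in the exponential moment, and \<open>a - a2\<close> provides the margin of
  \<open>maximum_tail_bound\<close>. Then the \<open>k\<close>-th exceptional event has probability at most a
  multiple of \<open>b k * mean_excess (b k) + k powr - (1 + \<delta>)\<close>.
\<close>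

theorem upper_at_scales:
  assumes r: "1 < r" and a: "sqrt sigma2 < a"
  shows "AE x in P. eventually (\<lambda>k. \<forall>j. real j \<le> r ^ k \<longrightarrow>
      \<phi> (walk \<omega> j x) - real j * ell \<le> sqrt 2 * a * sqrt (r ^ k * ln (real k))) sequentially"
proof -
  obtain a2 where a2: "sqrt sigma2 < a2" "a2 < a" using dense[OF a] by blast
  obtain a1 where a1: "sqrt sigma2 < a1" "a1 < a2" using dense[OF a2(1)] by blast
  have a1pos: "0 < a1" using a1(1) sigma2_nonneg real_sqrt_ge_zero[of sigma2] by linarith
  have sq: "sigma2 < a1\<^sup>2"
  proof -
    have "(sqrt sigma2)\<^sup>2 < a1\<^sup>2" using a1(1) sigma2_nonneg by (intro power_strict_mono) auto
    then show ?thesis using sigma2_nonneg by simp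
  qed
  obtain m where m: "m \<ge> 1" "var m + 8 * D * sqrt (var m) + 16 * D\<^sup>2 < real m * a1\<^sup>2"
  proof -
    have "(\<lambda>m. var m / real m + gap m) \<longlonglongrightarrow> sigma2 + 0" by (intro tendsto_add var_tendsto gap_tendsto)
    then have "eventually (\<lambda>m. var m / real m + gap m < a1\<^sup>2) sequentially"
      using sq by (intro order_tendstoD(2)) auto
    with eventually_ge_at_top[of 1] have "eventually (\<lambda>m. m \<ge> 1 \<and> var m / real m + gap m < a1\<^sup>2) sequentially"
      by eventually_elim auto
    then obtain m where m: "m \<ge> 1" "var m / real m + gap m < a1\<^sup>2"
      using eventually_happens'[OF sequentially_bot] by blast
    then have "var m + real m * gap m < real m * a1\<^sup>2" by (simp add: field_simps)
    then show thesis using that[of m] perturbation_le_gap[OF m(1)] m(1) by simp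
  qed
  obtain v where v: "var m < v" "v + 8 * D * sqrt v + 16 * D\<^sup>2 < real m * a1\<^sup>2"
  proof -
    let ?f = "\<lambda>v. v + 8 * D * sqrt v + 16 * D\<^sup>2"
    have "(?f \<longlongrightarrow> ?f (var m)) (at_right (var m))" by (intro tendsto_intros)
    then have "eventually (\<lambda>v. ?f v < real m * a1\<^sup>2) (at_right (var m))" using m(2) by (rule order_tendstoD(2))
    moreover have "eventually (\<lambda>v. var m < v) (at_right (var m))" by (rule eventually_at_right_less)
    ultimately have "eventually (\<lambda>v. var m < v \<and> ?f v < real m * a1\<^sup>2) (at_right (var m))" by eventually_elim auto
    then show thesis using that eventually_happens'[OF trivial_limit_at_right_real] by blast
  qed
  \<comment> \<open>\<open>Q0\<close> bounds the variance rates of the truncated walks, \<open>b k\<close> is the truncation level and \<open>\<theta> k\<close> the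
    exponent at scale \<open>k\<close>. The constant \<open>\<tau>\<close> is such that \<open>\<theta> k\<close> times the main part \<open>2 * m * b k\<close>
    of the bound for a block increment equals \<open>\<eta> / 2\<close>.\<close>
  define Q0 where "Q0 = (var 1 + 1) + 8 * D * sqrt (var 1 + 1) + 16 * D\<^sup>2"
  define \<epsilon> where "\<epsilon> = sqrt 2 * (a - a2) / 5"
  define \<eta> where "\<eta> = ln (a2 / a1)"
  define \<tau> where "\<tau> = \<eta> * a2 / (4 * sqrt 2 * real m)"
  define \<delta> where "\<delta> = (1 - a1 / a2) / 2"
  define T where "T k = sqrt (r ^ k * ln (real k))" for k :: nat
  define b where "b k = \<tau> * sqrt (r ^ k / ln (real k))" for k :: nat
  define p where "p k = nat \<lceil>r ^ k / real m\<rceil>" for k :: nat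
  define N where "N k = p k * m" for k
  define \<theta> where "\<theta> k = sqrt 2 * T k / (a2 * r ^ k)" for k
  have a2pos: "0 < a2" using a1pos a1(2) by simp
  have \<epsilon>: "0 < \<epsilon>" using a2 by (simp add: \<epsilon>_def)
  have \<eta>: "0 < \<eta>" using a1pos a1(2) by (simp add: \<eta>_def)
  have \<tau>: "0 < \<tau>" using \<eta> a2pos m(1) by (simp add: \<tau>_def)
  have \<delta>: "0 < \<delta>" using a2pos a1(2) by (simp add: \<delta>_def)
  have \<delta>_eq: "a1 / a2 = 1 - 2 * \<delta>"
  proof -
    have "q = 1 - 2 * ((1 - q) / 2)" for q :: real by argo
    then show ?thesis unfolding \<delta>_def .
  qed
  have rk: "0 < r ^ k" for k using r by simp
  have lnk: "0 < ln (real k)" if "k \<ge> 2" for k :: nat using that by simp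
  have N_upper: "real (N k) \<le> r ^ k + real m" for k
  proof -
    have "real (p k) \<le> r ^ k / real m + 1" unfolding p_def using rk[of k] by (simp add: of_nat_ceiling)
    then have "real (p k) * real m \<le> (r ^ k / real m + 1) * real m" by (intro mult_right_mono) auto
    also have "(r ^ k / real m + 1) * real m = r ^ k + real m" using m(1) by (simp add: distrib_right)
    finally show ?thesis by (simp add: N_def)
  qed
  have N_lower: "r ^ k \<le> real (N k)" for k
  proof -
    have "r ^ k / real m \<le> real (p k)" unfolding p_def by (rule real_nat_ceiling_ge)
    then show ?thesis using m(1) by (simp add: N_def field_simps)
  qed
  have N_upper2: "real (N k) \<le> (1 + real m) * r ^ k" for k
  proof -
    have "1 \<le> r ^ k" using r by (simp add: one_le_power)
    then have "real m * 1 \<le> real m * r ^ k" by (intro mult_left_mono) auto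
    then show ?thesis using N_upper[of k] by (simp add: algebra_simps)
  qed
  have T2: "(T k)\<^sup>2 = r ^ k * ln (real k)" if "k \<ge> 2" for k
    using lnk[OF that] rk[of k] by (simp add: T_def)
  have Tpos: "0 < T k" if "k \<ge> 2" for k using lnk[OF that] rk[of k] by (simp add: T_def)
  have bT: "b k * T k = \<tau> * r ^ k" if "k \<ge> 2" for k
  proof -
    have "sqrt (r ^ k / ln (real k)) * sqrt (r ^ k * ln (real k)) = sqrt ((r ^ k)\<^sup>2)"
      using lnk[OF that] by (simp add: real_sqrt_mult[symmetric] power2_eq_square)
    then show ?thesis using rk[of k] by (simp add: b_def T_def)
  qed
  have bpos: "0 < b k" if "k \<ge> 2" for k using lnk[OF that] rk[of k] \<tau> by (simp add: b_def)
  have b_top: "filterlim b at_top sequentially"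
    unfolding b_def using r \<tau> by real_asymp
  have T_top: "filterlim T at_top sequentially"
    unfolding T_def using r by real_asymp
  have \<theta>_0: "\<theta> \<longlonglongrightarrow> 0"
    unfolding \<theta>_def T_def using r a2pos by real_asymp
  have ln_top: "filterlim (\<lambda>k. ln (real k)) at_top sequentially" by real_asymp
  have ratio: "(\<lambda>k. sqrt (ln (real k) / ln (real (Suc k)))) \<longlonglongrightarrow> 1" by real_asymp
  have inv: "(\<lambda>k. real m / r ^ k) \<longlonglongrightarrow> 0" using r by real_asymp
  \<comment> \<open>Any number strictly between \<open>1\<close> and \<open>sqrt r\<close>, the limit of \<open>b (Suc k) / b k\<close>.\<close>
  define \<rho> where "\<rho> = sqrt (sqrt r)"
  have \<rho>: "1 < \<rho>" "\<rho> < sqrt r" using r by (auto simp: \<rho>_def real_less_rsqrt real_less_lsqrt power2_eq_square)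
  have "eventually (\<lambda>k. \<rho> / sqrt r < sqrt (ln (real k) / ln (real (Suc k)))) sequentially"
    using \<rho> r by (intro order_tendstoD(1)[OF ratio]) simp
  with eventually_ge_at_top[of 2]
  have "eventually (\<lambda>k. 0 \<le> b k \<and> \<rho> * b k \<le> b (Suc k)) sequentially"
  proof eventually_elim
    case (elim k)
    have "b (Suc k) = b k * (sqrt r * sqrt (ln (real k) / ln (real (Suc k))))"
    proof -
      have "r ^ Suc k / ln (real (Suc k)) = (r ^ k / ln (real k)) * (r * (ln (real k) / ln (real (Suc k))))"
        using lnk[OF elim(1)] by simp
      then show ?thesis unfolding b_def by (simp only: real_sqrt_mult mult.assoc)
    qed
    moreover have "b k * \<rho> \<le> b k * (sqrt r * sqrt (ln (real k) / ln (real (Suc k))))"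
      using elim(2) r bpos[OF elim(1)] by (intro mult_left_mono) (auto simp: field_simps)
    ultimately show ?case using bpos[OF elim(1)] by (simp add: mult.commute)
  qed
  then obtain K where K: "\<And>k. K \<le> k \<Longrightarrow> 0 \<le> b k \<and> \<rho> * b k \<le> b (Suc k)"
    by (auto simp: eventually_sequentially)
  have summ: "summable (\<lambda>k. b k * mean_excess (b k))" by (rule weighted_excess_summable[where b = b, OF \<rho>(1) K])
  define E where "E k = {x \<in> space P. \<exists>j\<le>N k. sqrt 2 * a2 * T k + 5 * (\<epsilon> * T k) < \<phi> (walk \<omega> j x) - real j * ell}" for k
  have [measurable]: "E k \<in> sets P" for k unfolding E_def by measurable
  have ev: "eventually (\<lambda>k. norm (measure P (E k)) \<le>
      (1 + real m) / (\<tau> * \<epsilon>) * (b k * mean_excess (b k)) + 2 * real k powr - (1 + \<delta>)) sequentially"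
  proof -
    have e1: "eventually (\<lambda>k. C.var (b k) m < v) sequentially" by (rule trunc_var_eventually[OF b_top v(1)])
    have e2: "eventually (\<lambda>k. C.var (b k) 1 < var 1 + 1) sequentially" by (rule trunc_var_eventually[OF b_top]) simp
    have e3: "eventually (\<lambda>k. 2 * (1 + real m) * Q0 / \<epsilon>\<^sup>2 \<le> ln (real k)) sequentially"
      using ln_top by (simp add: filterlim_at_top)
    have e4: "eventually (\<lambda>k. b k * mean_excess (b k) < \<tau> * \<epsilon> / (2 * (1 + real m))) sequentially"
      using \<tau> \<epsilon> by (intro order_tendstoD(2)[OF summable_LIMSEQ_zero[OF summ]]) (simp add: zero_less_divide_iff add_pos_nonneg)
    have e5: "eventually (\<lambda>k. 2 * D / \<epsilon> \<le> T k) sequentially"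
      using T_top by (simp add: filterlim_at_top)
    have "(\<lambda>k. \<theta> k * (4 * real m * D + 6 * D)) \<longlonglongrightarrow> 0 * (4 * real m * D + 6 * D)"
      by (intro tendsto_intros \<theta>_0)
    then have e6: "eventually (\<lambda>k. \<theta> k * (4 * real m * D + 6 * D) < \<eta> / 2) sequentially"
      using \<eta> by (intro order_tendstoD(2)) auto
    have "(\<lambda>k. (1 + real m / r ^ k) * (a1 / a2)) \<longlonglongrightarrow> (1 + 0) * (a1 / a2)"
      by (intro tendsto_intros inv)
    moreover have "(1 + 0) * (a1 / a2) < 1 - \<delta>" using \<delta> unfolding \<delta>_eq by simp
    ultimately have e7: "eventually (\<lambda>k. (1 + real m / r ^ k) * (a1 / a2) < 1 - \<delta>) sequentially"
      by (rule order_tendstoD(2))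
    from e1 e2 e3 e4 e5 e6 e7 eventually_ge_at_top[of 2] show ?thesis
    proof eventually_elim
      case (elim k)
      note k = \<open>2 \<le> k\<close>
      let ?u = "\<epsilon> * T k" and ?c = "2 * (D + real m * (b k + 2 * D)) + 4 * D"
      have u: "0 < ?u" using \<epsilon> Tpos[OF k] by simp
      have W: "C.var (b k) m + 8 * D * sqrt (C.var (b k) m) + 16 * D\<^sup>2 \<le> real m * a1\<^sup>2"
      proof -
        have "8 * D * sqrt (C.var (b k) m) \<le> 8 * D * sqrt v"
          using elim(1) D_nonneg by (intro mult_left_mono) auto
        then show ?thesis using elim(1) v(2) by linarith
      qed
      have rate: "C.var_rate (b k) \<le> Q0"
      proof -
        have "8 * D * sqrt (C.var (b k) 1) \<le> 8 * D * sqrt (var 1 + 1)"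
          using elim(2) D_nonneg by (intro mult_left_mono) auto
        then show ?thesis using elim(2) unfolding C.var_rate_def Q0_def by linarith
      qed
      have Q: "real (N k) * C.var_rate (b k) \<le> ?u\<^sup>2 / 2"
      proof -
        have "real (N k) * C.var_rate (b k) \<le> ((1 + real m) * r ^ k) * Q0"
          using N_upper2[of k] rate C.var_rate_nonneg[of "b k"] rk[of k] by (intro mult_mono) auto
        also have "\<dots> = r ^ k * ((1 + real m) * Q0)" by simp
        also have "(1 + real m) * Q0 \<le> \<epsilon>\<^sup>2 * ln (real k) / 2"
          using elim(3) \<epsilon> by (simp add: field_simps)
        also have "r ^ k * (\<epsilon>\<^sup>2 * ln (real k) / 2) = ?u\<^sup>2 / 2"
          by (simp add: power_mult_distrib T2[OF k])
        finally show ?thesis using rk[of k] by simp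
      qed
      have NB: "real (N k) * mean_excess (b k) \<le> T k * ((1 + real m) / \<tau> * (b k * mean_excess (b k)))"
      proof -
        have "real (N k) * mean_excess (b k) \<le> ((1 + real m) * r ^ k) * mean_excess (b k)"
          using N_upper2 mean_excess_nonneg by (intro mult_right_mono) auto
        also have "r ^ k = b k * T k / \<tau>" using bT[OF k] \<tau> by (simp add: field_simps)
        finally show ?thesis by (simp add: field_simps)
      qed
      have B: "real (N k) * mean_excess (b k) + D \<le> ?u"
      proof -
        have "(1 + real m) / \<tau> * (b k * mean_excess (b k)) \<le> (1 + real m) / \<tau> * (\<tau> * \<epsilon> / (2 * (1 + real m)))"
          using elim(4) \<tau> by (intro mult_left_mono) auto
        also have "\<dots> = \<epsilon> / 2"
        proof -
          have "y / \<tau> * (\<tau> * \<epsilon> / (2 * y)) = \<epsilon> / 2" if "0 < y" for y using \<tau> that by simp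
          from this[of "1 + real m"] show ?thesis by linarith
        qed
        finally have "T k * ((1 + real m) / \<tau> * (b k * mean_excess (b k))) \<le> T k * (\<epsilon> / 2)"
          using Tpos[OF k] by (intro mult_left_mono) auto
        moreover have "D \<le> T k * (\<epsilon> / 2)" using elim(5) \<epsilon> by (simp add: field_simps)
        moreover have "T k * (\<epsilon> / 2) + T k * (\<epsilon> / 2) = \<epsilon> * T k" by simp
        ultimately show ?thesis using NB by linarith
      qed
      have \<theta>0: "0 \<le> \<theta> k" using Tpos[OF k] a2pos rk[of k] by (simp add: \<theta>_def)
      have "\<theta> k * ?c \<le> \<eta>"
      proof -
        have "\<theta> k * b k = sqrt 2 * (b k * T k) / (a2 * r ^ k)" by (simp add: \<theta>_def)
        also have "\<dots> = sqrt 2 * \<tau> / a2" using r rk[of k] by (simp add: bT[OF k])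
        finally have "\<theta> k * b k = sqrt 2 * \<tau> / a2" .
        moreover have "2 * real m * (sqrt 2 * \<tau> / a2) = \<eta> / 2"
          using m(1) a2pos by (simp add: \<tau>_def field_simps)
        ultimately have "2 * real m * (\<theta> k * b k) = \<eta> / 2" by simp
        moreover have "\<theta> k * ?c = 2 * real m * (\<theta> k * b k) + \<theta> k * (4 * real m * D + 6 * D)"
          by (simp add: algebra_simps)
        ultimately show ?thesis using elim(6) by linarith
      qed
      then have exp_c: "exp (\<theta> k * ?c) \<le> a2 / a1"
        using a1pos a2pos by (simp add: \<eta>_def ln_ge_iff)
      have \<theta>2: "(\<theta> k)\<^sup>2 = 2 * ln (real k) / (a2\<^sup>2 * r ^ k)"
      proof -
        have cancel: "2 * (y * l) / (c * y\<^sup>2) = 2 * l / (c * y)" if "0 < y" for y l c :: real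
          using that by (simp add: power2_eq_square)
        have "(\<theta> k)\<^sup>2 = 2 * (T k)\<^sup>2 / (a2\<^sup>2 * (r ^ k)\<^sup>2)"
          by (simp only: \<theta>_def power_divide power_mult_distrib) simp
        also have "\<dots> = 2 * ln (real k) / (a2\<^sup>2 * r ^ k)"
          unfolding T2[OF k] by (rule cancel[OF rk])
        finally show ?thesis .
      qed
      have "real (p k) * ((\<theta> k)\<^sup>2 / 2 * exp (\<theta> k * ?c) * (real m * a1\<^sup>2)) =
          (real (N k) * ((\<theta> k)\<^sup>2 / 2) * a1\<^sup>2) * exp (\<theta> k * ?c)" by (simp add: N_def)
      also have "\<dots> \<le> ((r ^ k + real m) * ((\<theta> k)\<^sup>2 / 2) * a1\<^sup>2) * (a2 / a1)"
        using N_upper[of k] exp_c rk[of k] by (intro mult_mono) auto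
      also have "\<dots> = ((1 + real m / r ^ k) * (a1 / a2)) * ln (real k)"
        using r rk[of k] a1pos a2pos unfolding \<theta>2 by (simp add: field_simps power2_eq_square)
      also have "\<dots> \<le> (1 - \<delta>) * ln (real k)"
        using elim(7) lnk[OF k] by (intro mult_right_mono) auto
      finally have ex1: "real (p k) * ((\<theta> k)\<^sup>2 / 2 * exp (\<theta> k * ?c) * (real m * a1\<^sup>2)) \<le> (1 - \<delta>) * ln (real k)" .
      have "\<theta> k * (sqrt 2 * a2 * T k) = 2 * (T k)\<^sup>2 / r ^ k"
        using a2pos by (simp add: \<theta>_def power2_eq_square)
      also have "\<dots> = 2 * ln (real k)" using r rk[of k] by (simp add: T2[OF k])
      finally have ex2: "\<theta> k * (sqrt 2 * a2 * T k) = 2 * ln (real k)" .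
      have "measure P (E k) \<le> real (N k) * mean_excess (b k) / ?u +
          2 * exp (real (p k) * ((\<theta> k)\<^sup>2 / 2 * exp (\<theta> k * ?c) * (real m * a1\<^sup>2)) - \<theta> k * (sqrt 2 * a2 * T k))"
        unfolding E_def using bpos[OF k] by (intro maximum_tail_bound u W Q B \<theta>0 N_def) auto
      also have "\<dots> \<le> T k * ((1 + real m) / \<tau> * (b k * mean_excess (b k))) / ?u + 2 * exp ((1 - \<delta>) * ln (real k) - 2 * ln (real k))"
        using NB ex1 ex2 u by (intro add_mono mult_left_mono divide_right_mono) auto
      also have "T k * ((1 + real m) / \<tau> * (b k * mean_excess (b k))) / ?u = (1 + real m) / (\<tau> * \<epsilon>) * (b k * mean_excess (b k))"
        using Tpos[OF k] by simp
      also have "exp ((1 - \<delta>) * ln (real k) - 2 * ln (real k)) = real k powr - (1 + \<delta>)"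
        using k by (simp add: powr_def algebra_simps)
      finally show ?case by simp
    qed
  qed
  have sg: "summable (\<lambda>k. (1 + real m) / (\<tau> * \<epsilon>) * (b k * mean_excess (b k)) + 2 * real k powr - (1 + \<delta>))"
    using \<delta> by (intro summable_add summable_mult summ) (simp add: summable_real_powr_iff)
  have "summable (\<lambda>k. measure P (E k))"
    by (rule summable_comparison_test_ev[OF ev sg])
  then have "AE x in P. eventually (\<lambda>k. x \<in> space P - E k) sequentially"
    by (intro borel_cantelli_AE1) (simp_all add: P.emeasure_eq_measure)
  then show ?thesis
  proof eventually_elim
    case (elim x)
    then show ?case
    proof eventually_elim
      case (elim k)
      show ?case
      proof (intro allI impI)
        fix j assume "real j \<le> r ^ k"
        then have "j \<le> N k" using N_lower[of k] by (metis of_nat_le_iff order.trans)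
        with elim have "\<phi> (walk \<omega> j x) - real j * ell \<le> sqrt 2 * a2 * T k + 5 * (\<epsilon> * T k)"
          by (auto simp: E_def not_less)
        also have "\<dots> = (sqrt 2 * a2 + 5 * \<epsilon>) * T k" by (simp only: distrib_right mult.assoc)
        also have "5 * \<epsilon> = sqrt 2 * a - sqrt 2 * a2" by (simp add: \<epsilon>_def right_diff_distrib)
        also have "(sqrt 2 * a2 + (sqrt 2 * a - sqrt 2 * a2)) * T k = sqrt 2 * a * T k" by simp
        finally show "\<phi> (walk \<omega> j x) - real j * ell \<le> sqrt 2 * a * sqrt (r ^ k * ln (real k))"
          by (simp add: T_def)
      qed
    qed
  qed
qed

text \<open>
  A time \<open>n\<close> is compared with the scale \<open>r ^ k\<close> just above it. Passing from \<open>n\<close> to \<open>r ^ k\<close> and from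
  \<open>ln (ln n)\<close> to \<open>ln k\<close> costs a factor \<open>r\<close> in total, which is at one's disposal.
\<close>

theorem upper_iterated_logarithm:
  assumes a: "sqrt sigma2 < a"
  shows "AE x in P. eventually (\<lambda>n. \<phi> (walk \<omega> n x) - real n * ell
      \<le> a * sqrt (2 * real n * ln (ln (real n)))) sequentially"
proof -
  obtain a0 where a0: "sqrt sigma2 < a0" "a0 < a" using dense[OF a] by blast
  have a0pos: "0 < a0"
  proof -
    have "0 \<le> sqrt sigma2" using sigma2_nonneg by simp
    then show ?thesis using a0(1) by linarith
  qed
  define r where "r = a / a0"
  have r: "1 < r" using a0 a0pos by (simp add: r_def)
  have "(\<lambda>n. ln (ln (real n) / ln r + 1) / ln (ln (real n))) \<longlonglongrightarrow> 1"
    using r by real_asymp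
  moreover have "1 < r" by (rule r)
  ultimately have lim: "eventually (\<lambda>n. ln (ln (real n) / ln r + 1) / ln (ln (real n)) < r) sequentially"
    by (rule order_tendstoD(2))
  have lnln: "eventually (\<lambda>n. 0 < ln (ln (real n))) sequentially" by real_asymp
  show ?thesis
    using upper_at_scales[OF r a0(1)]
  proof eventually_elim
    case (elim x)
    then obtain K where K: "\<And>k j. K \<le> k \<Longrightarrow> real j \<le> r ^ k \<Longrightarrow>
        \<phi> (walk \<omega> j x) - real j * ell \<le> sqrt 2 * a0 * sqrt (r ^ k * ln (real k))"
      by (auto simp: eventually_sequentially)
    have "eventually (\<lambda>n. real (max K 1) \<le> ln (real n) / ln r) sequentially"
    proof -
      have "filterlim (\<lambda>n. ln (real n) / ln r) at_top sequentially" using r by real_asymp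
      then show ?thesis by (simp add: filterlim_at_top)
    qed
    with lim lnln eventually_ge_at_top[of 1] show ?case
    proof eventually_elim
      case (elim n)
      define q where "q = ln (real n) / ln r"
      define k where "k = nat \<lceil>q\<rceil>"
      have q1: "real K \<le> q" "1 \<le> q" using elim(4) by (simp_all add: q_def)
      have kq: "q \<le> real k" "real k \<le> q + 1" using q1(2) by (auto simp: k_def of_nat_ceiling real_nat_ceiling_ge)
      have lnr: "0 < ln r" using r by simp
      have rq: "r powr q = real n" using lnr r elim(3) by (simp add: q_def powr_def)
      have "real n \<le> r powr real k" unfolding rq[symmetric] using kq(1) r by (intro powr_mono) auto
      then have nk: "real n \<le> r ^ k" using r by (simp add: powr_realpow)
      have "r powr real k \<le> r powr (q + 1)" using kq(2) r by (intro powr_mono) auto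
      also have "\<dots> = real n * r" using r rq by (simp add: powr_add)
      finally have kn: "r ^ k \<le> real n * r" using r by (simp add: powr_realpow)
      have "K \<le> k" using q1(1) kq(1) by linarith
      from K[OF this nk] have "\<phi> (walk \<omega> n x) - real n * ell \<le> sqrt 2 * a0 * sqrt (r ^ k * ln (real k))" .
      also have "\<dots> \<le> sqrt 2 * a0 * sqrt ((real n * r) * (r * ln (ln (real n))))"
      proof (intro mult_left_mono real_sqrt_le_mono mult_mono kn)
        have "ln (real k) \<le> ln (q + 1)" using kq q1 by (intro ln_mono) auto
        also have "\<dots> \<le> r * ln (ln (real n))" using elim(1,2) by (simp add: q_def field_simps)
        finally show "ln (real k) \<le> r * ln (ln (real n))" .
      qed (use r a0pos kq q1 in auto)
      also have "\<dots> = a0 * r * sqrt (2 * real n * ln (ln (real n)))"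
      proof -
        have "sqrt ((real n * r) * (r * ln (ln (real n)))) = sqrt (r\<^sup>2 * (real n * ln (ln (real n))))"
          by (simp add: power2_eq_square algebra_simps)
        also have "\<dots> = r * sqrt (real n * ln (ln (real n)))" using r by (simp add: real_sqrt_mult)
        finally show ?thesis by (simp add: real_sqrt_mult mult.assoc)
      qed
      also have "a0 * r = a" using a0pos by (simp add: r_def)
      finally show ?case .
    qed
  qed
qed

end

section \<open>The lower half of the law of the iterated logarithm\<close>

lemma (in prob_space) second_borel_cantelli:
  fixes X :: "nat \<Rightarrow> 'a \<Rightarrow> real"
  assumes X: "indep_vars (\<lambda>_. borel) X UNIV"
    and ns: "\<not> summable (\<lambda>j. prob {x \<in> space M. c j \<le> X j x})"
  shows "AE x in M. \<exists>\<^sub>F j in sequentially. c j \<le> X j x"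
proof -
  have [measurable]: "X j \<in> borel_measurable M" for j using X by (simp add: indep_vars_def)
  define q where "q j = prob {x \<in> space M. c j \<le> X j x}" for j
  have AE_k: "AE x in M. \<exists>j\<ge>k. c j \<le> X j x" for k
  proof -
    define B where "B = {x \<in> space M. \<forall>j\<ge>k. X j x < c j}"
    have [measurable]: "B \<in> events" unfolding B_def by measurable
    have bound: "prob B \<le> exp (- (\<Sum>j<n. q (k + j)))" for n
    proof (cases "n = 0")
      case False
      let ?J = "(\<lambda>j. k + j) ` {..<n}"
      have "prob B \<le> prob (\<Inter>j\<in>?J. X j -` {..<c j} \<inter> space M)"
        using False by (intro finite_measure_mono) (auto simp: B_def)
      also have "\<dots> = (\<Prod>j\<in>?J. prob (X j -` {..<c j} \<inter> space M))"
        using False by (intro indep_varsD[OF X]) auto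
      also have "\<dots> = (\<Prod>j<n. 1 - q (k + j))"
      proof (subst prod.reindex)
        show "(\<Prod>j<n. ((\<lambda>j. prob (X j -` {..<c j} \<inter> space M)) \<circ> (+) k) j) = (\<Prod>j<n. 1 - q (k + j))"
        proof (rule prod.cong)
          fix j
          have "X (k + j) -` {..<c (k + j)} \<inter> space M = space M - {x \<in> space M. c (k + j) \<le> X (k + j) x}"
            by (auto simp: not_le)
          then show "((\<lambda>j. prob (X j -` {..<c j} \<inter> space M)) \<circ> (+) k) j = 1 - q (k + j)"
            by (simp add: q_def prob_compl)
        qed simp
      qed simp
      also have "\<dots> \<le> (\<Prod>j<n. exp (- q (k + j)))"
      proof (rule prod_mono)
        fix j
        have "q (k + j) \<le> 1" by (simp add: q_def)
        then show "0 \<le> 1 - q (k + j) \<and> 1 - q (k + j) \<le> exp (- q (k + j))"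
          using exp_ge_add_one_self[of "- q (k + j)"] by simp
      qed
      also have "\<dots> = exp (- (\<Sum>j<n. q (k + j)))" by (simp add: exp_sum[symmetric] sum_negf)
      finally show ?thesis .
    qed simp
    have "\<not> summable (\<lambda>j. q (k + j))"
      using ns summable_iff_shift[of q k] by (simp add: q_def[abs_def] add.commute)
    then have unb: "\<exists>n. z < (\<Sum>j<n. q (k + j))" for z
      using summableI_nonneg_bounded[of "\<lambda>j. q (k + j)" z] by (force simp: q_def not_le)
    have "prob B = 0"
    proof (rule ccontr)
      assume "prob B \<noteq> 0"
      then have pos: "0 < prob B" using measure_nonneg[of M B] by linarith
      obtain n where "- ln (prob B) < (\<Sum>j<n. q (k + j))" using unb by blast
      then have "exp (- (\<Sum>j<n. q (k + j))) < exp (ln (prob B))" by simp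
      with pos bound[of n] show False by simp
    qed
    then have "AE x in M. x \<notin> B" by (intro AE_not_in) (auto simp: null_sets_def emeasure_eq_measure)
    with AE_space show ?thesis by eventually_elim (auto simp: B_def not_less)
  qed
  have "AE x in M. \<forall>k. \<exists>j\<ge>k. c j \<le> X j x"
    unfolding AE_all_countable using AE_k by blast
  then show ?thesis by eventually_elim (auto simp: frequently_sequentially)
qed

text \<open>
  The density is at least its value at \<open>y + s\<close> on an interval of length \<open>s\<close>.
\<close>

lemma centered_gaussian_tail:
  assumes s: "0 < s" and y: "0 \<le> y"
  shows "exp (- ((y / s + 1)\<^sup>2 / 2)) / sqrt (2 * pi) \<le> measure (centered_gaussian s) {y<..}"
proof -
  interpret real_distribution "centered_gaussian s"
    by (rule real_distribution_centered_gaussian) (use s in simp)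
  define d where "d = normal_density 0 s (y + s)"
  have d0: "0 \<le> d" by (simp add: d_def)
  have mono: "d \<le> normal_density 0 s x" if "y < x" "x \<le> y + s" for x
  proof -
    have "x\<^sup>2 \<le> (y + s)\<^sup>2" using that y by (intro power_mono) auto
    then have "- (y + s)\<^sup>2 / (2 * s\<^sup>2) \<le> - x\<^sup>2 / (2 * s\<^sup>2)" using s by (intro divide_right_mono) auto
    then show ?thesis using s by (simp add: d_def normal_density_def divide_right_mono)
  qed
  have "ennreal (d * s) = (\<integral>\<^sup>+x. ennreal d * indicator {y<..y + s} x \<partial>lborel)"
    using s d0 by (simp add: nn_integral_cmult ennreal_mult)
  also have "\<dots> \<le> (\<integral>\<^sup>+x. ennreal (normal_density 0 s x) * indicator {y<..} x \<partial>lborel)"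
    by (intro nn_integral_mono) (auto simp: indicator_def mono intro!: ennreal_leI)
  also have "\<dots> = emeasure (centered_gaussian s) {y<..}"
    using s by (simp add: centered_gaussian_def emeasure_density)
  finally have "d * s \<le> measure (centered_gaussian s) {y<..}"
    using s d0 by (simp add: emeasure_eq_measure)
  moreover have "d * s = exp (- ((y / s + 1)\<^sup>2 / 2)) / sqrt (2 * pi)"
  proof -
    have "(y / s + 1)\<^sup>2 / 2 = (y + s)\<^sup>2 / (2 * s\<^sup>2)" using s by (simp add: power2_eq_square field_simps)
    then show ?thesis using s by (simp add: d_def normal_density_def real_sqrt_mult)
  qed
  ultimately show ?thesis by simp
qed

text \<open>
  The logarithm of the Gaussian tail at \<open>b * sqrt (2 * \<theta>)\<close> is \<open>- (b / s)\<^sup>2 * \<theta> + O(sqrt \<theta>)\<close>, and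
  \<open>b / s < 1\<close>.
\<close>

lemma gaussian_tail_beats_exponential:
  assumes s: "0 < s" and b: "0 < b" "b < s"
  obtains \<theta> where "0 < \<theta>" "exp (- \<theta>) < measure (centered_gaussian s) {b * sqrt (2 * \<theta>)<..}"
proof -
  define c where "c = b / s"
  have c: "0 < c" "c < 1" using b s by (auto simp: c_def)
  then have "0 < 1 - c\<^sup>2" by (simp add: power_less_one_iff abs_square_less_1)
  have top: "filterlim (\<lambda>\<theta>. (1 - c\<^sup>2) * \<theta> - (sqrt 2 * c * sqrt \<theta> + 1 / 2 + ln (sqrt (2 * pi)))) at_top at_top"
    using \<open>0 < 1 - c\<^sup>2\<close> c by real_asymp
  then have "eventually (\<lambda>\<theta>. 0 < (1 - c\<^sup>2) * \<theta> - (sqrt 2 * c * sqrt \<theta> + 1 / 2 + ln (sqrt (2 * pi)))) at_top"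
    unfolding filterlim_at_top_dense by blast
  then have "eventually (\<lambda>\<theta>. 0 < \<theta> \<and> 0 < (1 - c\<^sup>2) * \<theta> - (sqrt 2 * c * sqrt \<theta> + 1 / 2 + ln (sqrt (2 * pi)))) at_top"
    by (intro eventually_conj eventually_gt_at_top)
  then obtain \<theta> where \<theta>: "0 < \<theta>" "0 < (1 - c\<^sup>2) * \<theta> - (sqrt 2 * c * sqrt \<theta> + 1 / 2 + ln (sqrt (2 * pi)))"
    using eventually_happens'[OF trivial_limit_at_top_linorder] by blast
  have "(b * sqrt (2 * \<theta>) / s + 1)\<^sup>2 / 2 = c\<^sup>2 * \<theta> + sqrt 2 * c * sqrt \<theta> + 1 / 2"
  proof -
    have "b * sqrt (2 * \<theta>) / s = c * sqrt (2 * \<theta>)" by (simp add: c_def)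
    moreover have "(c * sqrt (2 * \<theta>) + 1)\<^sup>2 = c\<^sup>2 * (2 * \<theta>) + 2 * (c * sqrt (2 * \<theta>)) + 1"
      using \<theta>(1) by (simp add: power2_sum power_mult_distrib)
    ultimately show ?thesis by (simp add: real_sqrt_mult algebra_simps)
  qed
  then have "- \<theta> < - ((b * sqrt (2 * \<theta>) / s + 1)\<^sup>2 / 2) - ln (sqrt (2 * pi))"
  proof -
    assume eq: "(b * sqrt (2 * \<theta>) / s + 1)\<^sup>2 / 2 = c\<^sup>2 * \<theta> + sqrt 2 * c * sqrt \<theta> + 1 / 2"
    have "(1 - c\<^sup>2) * \<theta> = \<theta> - c\<^sup>2 * \<theta>" by (simp add: left_diff_distrib)
    with \<theta>(2) eq show ?thesis by linarith
  qed
  then have "exp (- \<theta>) < exp (- ((b * sqrt (2 * \<theta>) / s + 1)\<^sup>2 / 2) - ln (sqrt (2 * pi)))" by simp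
  also have "\<dots> = exp (- ((b * sqrt (2 * \<theta>) / s + 1)\<^sup>2 / 2)) / sqrt (2 * pi)"
    by (simp add: exp_diff)
  also have "\<dots> \<le> measure (centered_gaussian s) {b * sqrt (2 * \<theta>)<..}"
    using b \<theta>(1) by (intro centered_gaussian_tail s) simp
  finally show thesis using that \<theta>(1) by blast
qed

lemma centered_gaussian_atom: "0 < s \<Longrightarrow> measure (centered_gaussian s) {y} = 0"
proof -
  assume s: "0 < s"
  have "emeasure (centered_gaussian s) {y} = (\<integral>\<^sup>+x. ennreal (normal_density 0 s x) * indicator {y} x \<partial>lborel)"
    using s by (simp add: centered_gaussian_def emeasure_density)
  also have "\<dots> = (\<integral>\<^sup>+x. 0 \<partial>(lborel :: real measure))"
    by (rule nn_integral_cong_AE) (use AE_lborel_singleton[of y] in \<open>auto elim!: eventually_mono\<close>)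
  finally show ?thesis by (simp add: measure_def)
qed

context quasimorphism_walk
begin

text \<open>
  Two consecutive independent stretches both exceed their levels; joining them loses one defect.
\<close>

lemma upper_tail_supermultiplicative:
  "measure (conv n) {g. x \<le> \<phi> g - real n * ell} * measure (conv k) {g. y \<le> \<phi> g - real k * ell} \<le>
     measure (conv (n + k)) {g. x + y - D \<le> \<phi> g - real (n + k) * ell}"
proof -
  let ?A = "\<lambda>n x. {g. x \<le> \<phi> g - real n * ell}"
  have "ennreal (measure (conv n) (?A n x) * measure (conv k) (?A k y)) = emeasure (conv n) (?A n x) * emeasure (conv k) (?A k y)"
    by (simp add: conv.emeasure_eq_measure ennreal_mult)
  also have "\<dots> = (\<integral>\<^sup>+g. indicator (?A n x) g * emeasure (conv k) (?A k y) \<partial>conv n)"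
    by (subst nn_integral_multc) auto
  also have "\<dots> = (\<integral>\<^sup>+g. \<integral>\<^sup>+h. indicator (?A n x) g * indicator (?A k y) h \<partial>conv k \<partial>conv n)"
    by (subst nn_integral_cmult) auto
  also have "\<dots> \<le> (\<integral>\<^sup>+g. \<integral>\<^sup>+h. indicator (?A (n + k) (x + y - D)) (g + h) \<partial>conv k \<partial>conv n)"
  proof (intro nn_integral_mono)
    fix g h
    show "(indicator (?A n x) g * indicator (?A k y) h :: ennreal) \<le> indicator (?A (n + k) (x + y - D)) (g + h)"
      using quasi[of g h] by (auto simp: indicator_def algebra_simps abs_le_iff)
  qed
  also have "\<dots> = (\<integral>\<^sup>+z. indicator (?A (n + k) (x + y - D)) z \<partial>conv (n + k))"
    by (rule nn_integral_convolution_power_add[OF prob_space_axioms sets_mu, symmetric]) measurable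
  also have "\<dots> = ennreal (measure (conv (n + k)) (?A (n + k) (x + y - D)))"
    by (simp add: conv.emeasure_eq_measure)
  finally show ?thesis by simp
qed

lemma upper_tail_power:
  "measure (conv m) {g. x \<le> \<phi> g - real m * ell} ^ p \<le>
     measure (conv (p * m)) {g. real p * (x - D) - D \<le> \<phi> g - real (p * m) * ell}"
proof (induction p)
  case 0
  have "0 \<in> {g. - D \<le> \<phi> g}" using phi_0 by simp
  then show ?case by (simp add: measure_return)
next
  case (Suc p)
  let ?q = "measure (conv m) {g. x \<le> \<phi> g - real m * ell}"
  have "?q ^ Suc p \<le> measure (conv (p * m)) {g. real p * (x - D) - D \<le> \<phi> g - real (p * m) * ell} * ?q"
    unfolding power_Suc2 by (intro mult_right_mono Suc.IH) simp
  also have "\<dots> \<le> measure (conv (p * m + m)) {g. (real p * (x - D) - D) + x - D \<le> \<phi> g - real (p * m + m) * ell}"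
    by (rule upper_tail_supermultiplicative)
  also have "p * m + m = Suc p * m" by simp
  also have "(real p * (x - D) - D) + x - D = real (Suc p) * (x - D) - D" by (simp add: algebra_simps)
  finally show ?case .
qed

text \<open>
  For the threshold \<open>b * sqrt (2 * \<theta>)\<close> the central limit theorem yields a probability that is large enough to be
  raised to the power \<open>ln k / \<theta>\<close> with a non-summable result.
\<close>

lemma block_tail_eventually:
  assumes b: "0 < b" "b < sqrt sigma2"
  obtains \<theta> where "0 < \<theta>"
    and "eventually (\<lambda>m. exp (- \<theta>) \<le> measure (conv m) {g. b * sqrt (2 * \<theta>) * sqrt (real m) \<le> \<phi> g - real m * ell}) sequentially"
proof -
  let ?s = "sqrt sigma2"
  have s: "0 < ?s" using b by linarith
  from gaussian_tail_beats_exponential[OF s b] obtain \<theta> where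
    \<theta>: "0 < \<theta>" "exp (- \<theta>) < measure (centered_gaussian ?s) {b * sqrt (2 * \<theta>)<..}" by blast
  define y where "y = b * sqrt (2 * \<theta>)"
  define M where "M n = distr (conv n) borel (\<lambda>g. (\<phi> g - real n * ell) / sqrt (real n))" for n
  interpret G: real_distribution "centered_gaussian ?s"
    by (rule real_distribution_centered_gaussian) (use s in simp)
  have M: "real_distribution (M n)" for n
    unfolding M_def by (rule conv.real_distribution_distr) measurable
  have compl: "measure N {y<..} = 1 - cdf N y" if "real_distribution N" for N
  proof -
    interpret N: real_distribution N by fact
    have "{y<..} = space N - {..y}" by auto
    then show ?thesis using N.prob_compl[of "{..y}"] by (simp add: cdf_def)
  qed
  have "isCont (cdf (centered_gaussian ?s)) y"
    using s by (simp add: G.isCont_cdf centered_gaussian_atom)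
  then have "(\<lambda>n. cdf (M n) y) \<longlonglongrightarrow> cdf (centered_gaussian ?s) y"
    using conv_central_limit unfolding weak_conv_m_def weak_conv_def M_def by blast
  then have "(\<lambda>n. measure (M n) {y<..}) \<longlonglongrightarrow> measure (centered_gaussian ?s) {y<..}"
    unfolding compl[OF M] compl[OF G.real_distribution_axioms] by (intro tendsto_intros)
  then have "eventually (\<lambda>n. exp (- \<theta>) < measure (M n) {y<..}) sequentially"
    using \<theta>(2) unfolding y_def by (rule order_tendstoD(1))
  with eventually_gt_at_top[of 0]
  have "eventually (\<lambda>m. exp (- \<theta>) \<le> measure (conv m) {g. y * sqrt (real m) \<le> \<phi> g - real m * ell}) sequentially"
  proof eventually_elim
    case (elim n)
    have "measure (M n) {y<..} = measure (conv n) {g. y < (\<phi> g - real n * ell) / sqrt (real n)}"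
      unfolding M_def by (subst measure_distr) (auto intro!: arg_cong[where f = "measure (conv n)"])
    also have "\<dots> \<le> measure (conv n) {g. y * sqrt (real n) \<le> \<phi> g - real n * ell}"
      using elim(1) by (intro conv.finite_measure_mono) (auto simp: less_divide_eq)
    finally show ?case using elim(2) by simp
  qed
  then show thesis using that[OF \<theta>(1)] by (simp add: y_def)
qed

end

lemma iid_shift:
  assumes iid: "iid_increments \<mu> P \<omega>"
  shows "iid_increments \<mu> P (\<lambda>i. \<omega> (n + i))"
proof -
  interpret prob_space P using iid by (simp add: iid_increments_def)
  have ind: "indep_vars (\<lambda>_. borel) \<omega> UNIV" using iid by (simp add: iid_increments_def)
  have "indep_vars (\<lambda>i. PiM {n + i} (\<lambda>_. borel)) (\<lambda>i x. restrict (\<lambda>k. \<omega> k x) {n + i}) UNIV"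
    by (rule indep_vars_restrict[OF ind]) (auto simp: disjoint_family_on_def)
  then have "indep_vars (\<lambda>_. borel) (\<lambda>i x. (restrict (\<lambda>k. \<omega> k x) {n + i}) (n + i)) UNIV"
    by (rule indep_vars_compose2[where Y = "\<lambda>i s. s (n + i)"]) measurable
  then show ?thesis using iid by (simp add: iid_increments_def)
qed

context quasimorphism_random_walk
begin

lemma block_distr:
  assumes "A \<in> sets borel"
  shows "measure P {x \<in> space P. path_sum (\<lambda>i. \<omega> (n + i) x) k \<in> A} = measure (conv k) A"
proof -
  interpret S: quasimorphism_random_walk \<mu> \<phi> D P "\<lambda>i. \<omega> (n + i)"
    by (intro quasimorphism_random_walk.intro quasimorphism_walk_axioms quasimorphism_random_walk_axioms.intro iid_shift iid)
  show ?thesis using S.measure_walk[OF assms, of k] by (simp add: walk_path_sum)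
qed

lemma blocks_independent:
  assumes "\<And>k. N (Suc k) = N k + L k"
  shows "P.indep_vars (\<lambda>_. borel) (\<lambda>k x. \<phi> (path_sum (\<lambda>i. \<omega> (N k + i) x) (L k))) UNIV"
proof -
  let ?K = "\<lambda>k. {N k..<N k + L k}"
  have "incseq N" using assms by (intro incseq_SucI) simp
  have disj: "disjoint_family_on ?K UNIV"
  proof (unfold disjoint_family_on_def, intro ballI impI)
    fix i j :: nat assume "i \<noteq> j"
    then consider "Suc i \<le> j" | "Suc j \<le> i" by linarith
    then show "?K i \<inter> ?K j = {}"
    proof cases
      case 1
      then have "N (Suc i) \<le> N j" using \<open>incseq N\<close> by (simp add: incseqD)
      then show ?thesis using assms by auto
    next
      case 2
      then have "N (Suc j) \<le> N i" using \<open>incseq N\<close> by (simp add: incseqD)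
      then show ?thesis using assms by auto
    qed
  qed
  have ind: "P.indep_vars (\<lambda>_. borel) \<omega> UNIV" using iid by (simp add: iid_increments_def)
  have "P.indep_vars (\<lambda>k. PiM (?K k) (\<lambda>_. borel)) (\<lambda>k x. restrict (\<lambda>i. \<omega> i x) (?K k)) UNIV"
    by (rule P.indep_vars_restrict[OF ind _ disj]) simp
  moreover have "(\<lambda>s. \<phi> (path_sum (\<lambda>i. s (N k + i)) (L k))) \<in> borel_measurable (PiM (?K k) (\<lambda>_. borel))" for k
  proof -
    have "(\<lambda>s. path_sum (\<lambda>i. s (N k + i)) l) \<in> PiM (?K k) (\<lambda>_. borel :: 'a measure) \<rightarrow>\<^sub>M borel" if "l \<le> L k" for l
      using that
    proof (induction l)
      case (Suc l)
      then have [measurable]: "(\<lambda>s. s (N k + l)) \<in> PiM (?K k) (\<lambda>_. borel :: 'a measure) \<rightarrow>\<^sub>M borel"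
        by (intro measurable_component_singleton) auto
      have [measurable]: "(\<lambda>s. path_sum (\<lambda>i. s (N k + i)) l) \<in> PiM (?K k) (\<lambda>_. borel :: 'a measure) \<rightarrow>\<^sub>M borel"
        using Suc by simp
      show ?case unfolding path_sum_Suc by measurable
    qed simp
    from measurable_compose[OF this[OF order_refl] phi_measurable] show ?thesis .
  qed
  ultimately have "P.indep_vars (\<lambda>_. borel)
      (\<lambda>k x. \<phi> (path_sum (\<lambda>i. restrict (\<lambda>i. \<omega> i x) (?K k) (N k + i)) (L k))) UNIV"
    by (rule P.indep_vars_compose2[where Y = "\<lambda>k s. \<phi> (path_sum (\<lambda>i. s (N k + i)) (L k))"])
  moreover have "path_sum (\<lambda>i. restrict (\<lambda>i. \<omega> i x) (?K k) (N k + i)) (L k) = path_sum (\<lambda>i. \<omega> (N k + i) x) (L k)" for k x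
    unfolding path_sum_def by (intro arg_cong[where f = sum_list] map_cong) auto
  ultimately show ?thesis by simp
qed

text \<open>
  Symmetry: the upper bound for \<open>- \<phi>\<close> is a lower bound for \<open>\<phi>\<close>.
\<close>

lemma random_walk_uminus: "quasimorphism_random_walk \<mu> (\<lambda>g. - \<phi> g) D P \<omega>"
proof (intro quasimorphism_random_walk.intro quasimorphism_walk.intro quasimorphism_walk_axioms.intro
    quasimorphism_random_walk_axioms.intro)
  show "\<bar>- \<phi> (g + h) - - \<phi> g - - \<phi> h\<bar> \<le> D" for g h using quasi[of g h] by linarith
qed (use iid square_integrable sets_mu prob_space_axioms in auto)

lemma lower_envelope:
  assumes A: "sqrt sigma2 < A"
  shows "AE x in P. eventually (\<lambda>n. - (A * sqrt (2 * real n * ln (ln (real n))))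
      \<le> \<phi> (walk \<omega> n x) - real n * ell) sequentially"
proof -
  interpret M: quasimorphism_random_walk \<mu> "\<lambda>g. - \<phi> g" D P \<omega> by (rule random_walk_uminus)
  have mean: "M.mean n = - mean n" for n by (simp add: M.mean_def mean_def)
  have "M.var n = var n" for n
    unfolding M.var_def var_def mean by (intro Bochner_Integration.integral_cong) (auto simp: power2_eq_square algebra_simps)
  then have sigma: "M.sigma2 = sigma2" by (simp add: M.sigma2_def sigma2_def)
  have "M.ell + ell = 0"
  proof (rule ccontr)
    assume ne: "M.ell + ell \<noteq> 0"
    have le: "real n * \<bar>M.ell + ell\<bar> \<le> 2 * D" for n
    proof -
      have "\<bar>real n * (M.ell + ell)\<bar> \<le> 2 * D"
        using M.mean_ell[of n] mean_ell[of n] unfolding mean by (simp add: algebra_simps abs_le_iff)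
      then show ?thesis by (simp add: abs_mult)
    qed
    obtain n where "2 * D < real n * \<bar>M.ell + ell\<bar>"
      using reals_Archimedean3[of "\<bar>M.ell + ell\<bar>"] ne by auto
    with le[of n] show False by simp
  qed
  then have ell: "M.ell = - ell" by simp
  show ?thesis
    using M.upper_iterated_logarithm[of A] A unfolding sigma ell
    by (auto elim!: eventually_mono)
qed

text \<open>
  The stretch number \<open>k\<close> consists of \<open>p k\<close> blocks of length \<open>R ^ k\<close>, where \<open>p k\<close> is about \<open>ln k / \<theta>\<close>. The
  walk before the stretch has length at most a fraction \<open>1 / R\<close> of the whole, so by \<open>lower_envelope\<close>
  it can spoil the gain only by \<open>A / sqrt R\<close> relative to the normalization. The defects from joining
  \<open>p k\<close> blocks are of order \<open>ln k\<close> and hence negligible.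
\<close>

theorem lower_iterated_logarithm:
  assumes b0: "0 < b0" "b0 < sqrt sigma2"
  shows "AE x in P. \<exists>\<^sub>F n in sequentially. b0 * sqrt (2 * real n * ln (ln (real n)))
      \<le> \<phi> (walk \<omega> n x) - real n * ell"
proof -
  obtain b where b: "b0 < b" "b < sqrt sigma2" using dense[OF b0(2)] by blast
  have b_pos: "0 < b" using b0 b by simp
  obtain \<theta> where \<theta>: "0 < \<theta>" and block_tail: "eventually (\<lambda>m. exp (- \<theta>) \<le>
      measure (conv m) {g. b * sqrt (2 * \<theta>) * sqrt (real m) \<le> \<phi> g - real m * ell}) sequentially"
    using block_tail_eventually[OF b_pos b(2)] by blast
  define y where "y = b * sqrt (2 * \<theta>)"
  define A where "A = sqrt sigma2 + 1"
  have A: "sqrt sigma2 < A" "0 < A" using b b_pos by (auto simp: A_def)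
  obtain R :: nat where R: "2 \<le> R" "b0 < b * sqrt ((real R - 1) / real R) - A / sqrt (real R)"
  proof -
    have "(\<lambda>R::nat. b * sqrt ((real R - 1) / real R) - A / sqrt (real R)) \<longlonglongrightarrow> b"
      using b_pos A(2) by real_asymp
    then have "eventually (\<lambda>R. b0 < b * sqrt ((real R - 1) / real R) - A / sqrt (real R)) sequentially"
      using b(1) by (rule order_tendstoD(1))
    with eventually_ge_at_top[of 2]
    have "eventually (\<lambda>R. 2 \<le> R \<and> b0 < b * sqrt ((real R - 1) / real R) - A / sqrt (real R)) sequentially"
      by eventually_elim auto
    then show thesis using that eventually_happens'[OF sequentially_bot] by blast
  qed
  define B where "B = b * sqrt ((real R - 1) / real R)"
  define \<epsilon> where "\<epsilon> = (B - A / sqrt (real R) - b0) / 2"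
  \<comment> \<open>\<open>B\<close> is the constant that the stretch itself achieves relative to the full length. One \<open>\<epsilon>\<close> pays for replacing
    \<open>ln (ln n)\<close> by \<open>ln k\<close> through the factor \<open>\<rho>\<close>, the other one for the defects.\<close>
  define \<rho> where "\<rho> = B / (B - \<epsilon>)"
  have \<epsilon>: "0 < \<epsilon>" using R(2) by (simp add: \<epsilon>_def B_def)
  have AR: "0 < A / sqrt (real R)" using A(2) R(1) by simp
  have sum_eq: "B - 2 * \<epsilon> - A / sqrt (real R) = b0" unfolding \<epsilon>_def by argo
  have B\<epsilon>: "0 < B - \<epsilon>" using sum_eq \<epsilon> AR b0(1) by linarith
  have \<rho>: "1 < \<rho>" using \<epsilon> B\<epsilon> by (simp add: \<rho>_def)
  have B\<rho>: "B = (B - \<epsilon>) * \<rho>" using B\<epsilon> by (simp add: \<rho>_def)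
  define p where "p k = Suc (nat \<lceil>ln (real k) / \<theta>\<rceil>)" for k :: nat
  define L where "L k = p k * R ^ k" for k
  define N where "N k = (\<Sum>j<k. L j)" for k
  have ln_mono': "ln (real j) \<le> ln (real k)" if "j \<le> k" for j k :: nat
    using that by (cases "j = 0"; cases "k = 0") auto
  have ln0: "0 \<le> ln (real k)" for k using ln_mono'[of 0 k] by simp
  have p_lower: "ln (real k) / \<theta> \<le> real (p k)" for k
    unfolding p_def using real_nat_ceiling_ge[of "ln (real k) / \<theta>"] by simp
  have p_upper: "real (p k) \<le> ln (real k) / \<theta> + 2" for k
  proof -
    have "0 \<le> ln (real k) / \<theta>" using ln0 \<theta> by simp
    then have "real (nat \<lceil>ln (real k) / \<theta>\<rceil>) \<le> ln (real k) / \<theta> + 1" by (simp add: of_nat_ceiling)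
    then show ?thesis by (simp add: p_def)
  qed
  have p_mono: "p j \<le> p k" if "j \<le> k" for j k
    unfolding p_def using ln_mono'[OF that] \<theta>
    by (intro Suc_le_mono[THEN iffD2] nat_mono ceiling_mono divide_right_mono) auto
  have N_Suc: "N (Suc k) = N k + L k" for k by (simp add: N_def)
  have L1: "1 \<le> L k" for k
  proof -
    have "0 < L k" using R(1) by (simp add: L_def p_def)
    then show ?thesis by simp
  qed
  have N_ge: "k \<le> N k" for k
  proof (induction k)
    case (Suc k)
    then show ?case using L1[of k] by (simp add: N_Suc)
  qed simp
  have NL: "(real R - 1) * real (N k) \<le> real (L k)" for k
  proof (induction k)
    case (Suc k)
    have "(real R - 1) * real (N (Suc k)) \<le> real R * real (L k)"
      using Suc by (simp add: N_Suc algebra_simps)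
    also have "\<dots> = real (p k) * real (R ^ Suc k)" by (simp add: L_def)
    also have "\<dots> \<le> real (p (Suc k)) * real (R ^ Suc k)"
      using p_mono[of k "Suc k"] by (intro mult_right_mono) auto
    finally show ?case by (simp add: L_def)
  qed (simp add: N_def)
  have n_upper: "(real R - 1) / real R * real (N (Suc k)) \<le> real (L k)" for k
    using NL[of k] R(1) by (simp add: N_Suc field_simps)
  have n_prev: "real (N k) \<le> real (N (Suc k)) / real R" for k
    using NL[of k] R(1) by (simp add: N_Suc field_simps)
  have n_upper2: "real (N (Suc k)) \<le> 2 * real (L k)" for k
  proof -
    have "1 * real (N k) \<le> (real R - 1) * real (N k)" using R(1) by (intro mult_right_mono) auto
    then show ?thesis using NL[of k] by (simp add: N_Suc)
  qed
  have n_lower: "real R ^ k \<le> real (N (Suc k))" for k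
  proof -
    have "1 * R ^ k \<le> p k * R ^ k" by (intro mult_right_mono) (auto simp: p_def)
    then have "R ^ k \<le> L k" unfolding L_def by (simp only: mult_1)
    then have "R ^ k \<le> N (Suc k)" unfolding N_Suc by (rule trans_le_add2)
    then show ?thesis by (metis of_nat_le_iff of_nat_power)
  qed
  define X where "X k x = \<phi> (path_sum (\<lambda>i. \<omega> (N k + i) x) (L k))" for k x
  define c where "c k = real (p k) * (y * sqrt (real (R ^ k)) - D) - D + real (L k) * ell" for k
  have R1: "1 < real R" using R(1) by simp
  have "filterlim (\<lambda>k. R ^ k) sequentially sequentially"
    using R(1) by (intro filterlim_subseq strict_monoI power_strict_increasing) auto
  from eventually_compose_filterlim[OF block_tail this]
  have prob_large: "eventually (\<lambda>k. exp (- (2 * \<theta>)) * inverse (real k) \<le> P.prob {x \<in> space P. c k \<le> X k x}) sequentially"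
    using eventually_ge_at_top[of 1]
  proof eventually_elim
    case (elim k)
    have "- (2 * \<theta>) - ln (real k) \<le> real (p k) * (- \<theta>)"
      using p_upper[of k] \<theta> by (simp add: field_simps)
    then have "exp (- (2 * \<theta>) - ln (real k)) \<le> exp (- \<theta>) ^ p k"
      by (simp add: exp_of_nat_mult[symmetric])
    moreover have "exp (- (2 * \<theta>) - ln (real k)) = exp (- (2 * \<theta>)) * inverse (real k)"
      using elim(2) by (simp add: exp_diff divide_inverse)
    moreover have "exp (- \<theta>) ^ p k \<le> measure (conv (R ^ k)) {g. y * sqrt (real (R ^ k)) \<le> \<phi> g - real (R ^ k) * ell} ^ p k"
      using elim(1) by (intro power_mono) (auto simp: y_def)
    moreover note upper_tail_power[of "R ^ k" "y * sqrt (real (R ^ k))" "p k"]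
    moreover have "{x \<in> space P. c k \<le> X k x} = {x \<in> space P. path_sum (\<lambda>i. \<omega> (N k + i) x) (L k) \<in>
        {g. real (p k) * (y * sqrt (real (R ^ k)) - D) - D \<le> \<phi> g - real (p k * R ^ k) * ell}}"
      by (auto simp: X_def c_def L_def algebra_simps)
    then have "P.prob {x \<in> space P. c k \<le> X k x} = measure (conv (p k * R ^ k))
        {g. real (p k) * (y * sqrt (real (R ^ k)) - D) - D \<le> \<phi> g - real (p k * R ^ k) * ell}"
      by (simp only: L_def[symmetric]) (subst block_distr, auto)
    ultimately show ?case by linarith
  qed
  have "\<not> summable (\<lambda>k. P.prob {x \<in> space P. c k \<le> X k x})"
  proof
    assume "summable (\<lambda>k. P.prob {x \<in> space P. c k \<le> X k x})"
    moreover have "eventually (\<lambda>k. norm (exp (- (2 * \<theta>)) * inverse (real k)) \<le> P.prob {x \<in> space P. c k \<le> X k x}) sequentially"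
      using prob_large by (rule eventually_mono) simp
    ultimately have "summable (\<lambda>k. exp (- (2 * \<theta>)) * inverse (real k))"
      by (rule summable_comparison_test_ev[rotated])
    then have "summable (\<lambda>k. inverse (real k))" by (subst (asm) summable_cmult_iff) simp
    then show False using not_summable_harmonic[where 'a = real] by blast
  qed
  then have often: "AE x in P. \<exists>\<^sub>F k in sequentially. c k \<le> X k x"
    unfolding X_def by (intro P.second_borel_cantelli blocks_independent N_Suc)
  have f1: "eventually (\<lambda>k. ln (ln (2 * ((ln (real k) / \<theta> + 2) * real R ^ k))) \<le> \<rho>\<^sup>2 * ln (real k)) sequentially"
  proof -
    have "(\<lambda>k. ln (ln (2 * ((ln (real k) / \<theta> + 2) * real R ^ k))) / ln (real k)) \<longlonglongrightarrow> 1"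
      using \<theta> R1 by real_asymp
    moreover have "1 < \<rho>\<^sup>2" using \<rho> by simp
    ultimately have "eventually (\<lambda>k. ln (ln (2 * ((ln (real k) / \<theta> + 2) * real R ^ k))) / ln (real k) < \<rho>\<^sup>2) sequentially"
      by (rule order_tendstoD(2))
    with eventually_ge_at_top[of 2] show ?thesis
      by eventually_elim (simp add: divide_less_eq)
  qed
  have f2: "eventually (\<lambda>k. 1 \<le> ln (ln (real R ^ k))) sequentially"
    using R1 by real_asymp
  have f3: "eventually (\<lambda>k. (ln (real k) / \<theta> + 4) * D \<le> \<epsilon> * sqrt (real R ^ k)) sequentially"
  proof -
    have "(\<lambda>k. (ln (real k) / \<theta> + 4) / sqrt (real R ^ k)) \<longlonglongrightarrow> 0" using \<theta> R1 by real_asymp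
    then have "(\<lambda>k. (ln (real k) / \<theta> + 4) / sqrt (real R ^ k) * D) \<longlonglongrightarrow> 0 * D" by (intro tendsto_intros)
    then have "eventually (\<lambda>k. (ln (real k) / \<theta> + 4) / sqrt (real R ^ k) * D < \<epsilon>) sequentially"
      using \<epsilon> by (intro order_tendstoD(2)) auto
    then show ?thesis
    proof eventually_elim
      case (elim k)
      have "0 < sqrt (real R ^ k)" using R1 by simp
      with elim show ?case by (simp add: field_simps)
    qed
  qed
  show ?thesis
    using often lower_envelope[OF A(1)]
  proof eventually_elim
    case (elim x)
    have "filterlim N sequentially sequentially"
      using N_ge by (auto simp: filterlim_at_top eventually_sequentially intro: order.trans)
    from eventually_compose_filterlim[OF elim(2) this]
    have ev: "eventually (\<lambda>k. c k \<le> X k x \<longrightarrow> b0 * sqrt (2 * real (N (Suc k)) * ln (ln (real (N (Suc k)))))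
        \<le> \<phi> (walk \<omega> (N (Suc k)) x) - real (N (Suc k)) * ell) sequentially"
      using f1 f2 f3 eventually_ge_at_top[of 3]
    proof eventually_elim
      case (elim k)
      show ?case
      proof
        assume ck: "c k \<le> X k x"
        let ?n = "N (Suc k)"
        define LL where "LL = ln (ln (real ?n))"
        define V where "V = sqrt (2 * real ?n * LL)"
        have Rk: "0 < real R ^ k" using R1 by simp
        have n3: "3 \<le> N k" using N_ge[of k] elim(5) by linarith
        have Nn: "N k \<le> ?n" by (simp add: N_Suc)
        have lnN: "0 < ln (real (N k))" using n3 by simp
        have LL_ge: "1 \<le> LL"
        proof -
          have "0 < ln (real R ^ k)" using R1 elim(5) by (simp add: ln_realpow)
          then have "ln (ln (real R ^ k)) \<le> LL" unfolding LL_def by (intro ln_mono n_lower Rk)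
          then show ?thesis using elim(3) by simp
        qed
        have LL_le: "LL \<le> \<rho>\<^sup>2 * ln (real k)"
        proof -
          have "real (L k) \<le> (ln (real k) / \<theta> + 2) * real R ^ k"
            using mult_right_mono[OF p_upper[of k], of "real R ^ k"] by (simp add: L_def)
          then have "real ?n \<le> 2 * ((ln (real k) / \<theta> + 2) * real R ^ k)" using n_upper2[of k] by linarith
          moreover have "0 < ln (real ?n)" using n3 Nn by simp
          ultimately have "LL \<le> ln (ln (2 * ((ln (real k) / \<theta> + 2) * real R ^ k)))"
            unfolding LL_def using n3 Nn by (intro ln_mono) (auto intro: order.strict_trans2)
          then show ?thesis using elim(2) by simp
        qed
        have prev: "sqrt (2 * real (N k) * ln (ln (real (N k)))) \<le> V / sqrt (real R)"
        proof -
          have "ln (ln (real (N k))) \<le> LL"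
            unfolding LL_def using n3 Nn lnN by (intro ln_mono) auto
          then have "2 * real (N k) * ln (ln (real (N k))) \<le> 2 * (real ?n / real R) * LL"
            using n_prev[of k] LL_ge n3
            by (intro order.trans[OF mult_left_mono mult_right_mono]) auto
          then have "sqrt (2 * real (N k) * ln (ln (real (N k)))) \<le> sqrt (2 * (real ?n / real R) * LL)" by simp
          also have "\<dots> = V / sqrt (real R)" by (simp add: V_def real_sqrt_divide[symmetric])
          finally show ?thesis .
        qed
        have main: "(B - \<epsilon>) * V \<le> real (p k) * (y * sqrt (real (R ^ k)))"
        proof -
          have "B * sqrt (2 * real ?n * ln (real k)) = b * sqrt (((real R - 1) / real R * real ?n) * (2 * ln (real k)))"
            unfolding B_def by (simp add: real_sqrt_mult[symmetric] algebra_simps)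
          also have "\<dots> \<le> b * sqrt (real (L k) * (2 * ln (real k)))"
            using n_upper[of k] ln0[of k] b_pos by (intro mult_left_mono real_sqrt_le_mono mult_right_mono) auto
          also have "real (L k) * (2 * ln (real k)) = (2 * \<theta>) * (real (L k) * (ln (real k) / \<theta>))"
            using \<theta> by simp
          also have "b * sqrt \<dots> \<le> b * sqrt ((2 * \<theta>) * (real (L k) * real (p k)))"
            using p_lower[of k] \<theta> b_pos by (intro mult_left_mono real_sqrt_le_mono) auto
          also have "\<dots> = y * sqrt ((real (p k))\<^sup>2 * real (R ^ k))"
            by (simp add: y_def L_def real_sqrt_mult power2_eq_square)
          also have "\<dots> = real (p k) * (y * sqrt (real (R ^ k)))" by (simp add: real_sqrt_mult)
          finally have 1: "B * sqrt (2 * real ?n * ln (real k)) \<le> real (p k) * (y * sqrt (real (R ^ k)))" .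
          have "V \<le> sqrt (\<rho>\<^sup>2 * (2 * real ?n * ln (real k)))"
            unfolding V_def using mult_left_mono[OF LL_le, of "2 * real ?n"] by (simp add: algebra_simps)
          also have "\<dots> = \<rho> * sqrt (2 * real ?n * ln (real k))" using \<rho> by (simp add: real_sqrt_mult)
          finally have "(B - \<epsilon>) * V \<le> (B - \<epsilon>) * (\<rho> * sqrt (2 * real ?n * ln (real k)))"
            using B\<epsilon> by (intro mult_left_mono) auto
          also have "\<dots> = ((B - \<epsilon>) * \<rho>) * sqrt (2 * real ?n * ln (real k))" by simp
          also have "\<dots> = B * sqrt (2 * real ?n * ln (real k))" by (simp only: B\<rho>[symmetric])
          finally show ?thesis using 1 by simp
        qed
        have err: "real (p k) * D + 2 * D \<le> \<epsilon> * V"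
        proof -
          have "real (p k) * D \<le> (ln (real k) / \<theta> + 2) * D"
            using p_upper[of k] D_nonneg by (intro mult_right_mono)
          then have "real (p k) * D + 2 * D \<le> \<epsilon> * sqrt (real R ^ k)"
            using elim(4) by (simp add: algebra_simps)
          also have "\<dots> \<le> \<epsilon> * V"
          proof -
            have "real R ^ k \<le> 2 * real ?n" using n_lower[of k] by linarith
            then have "real R ^ k * 1 \<le> 2 * real ?n * LL"
              using LL_ge by (intro mult_mono) auto
            then show ?thesis unfolding V_def using \<epsilon> by (intro mult_left_mono real_sqrt_le_mono) auto
          qed
          finally show ?thesis .
        qed
        have "walk \<omega> ?n x = walk \<omega> (N k) x + path_sum (\<lambda>i. \<omega> (N k + i) x) (L k)"
          by (simp add: walk_path_sum N_Suc path_sum_add)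
        then have "\<phi> (walk \<omega> (N k) x) + X k x - D \<le> \<phi> (walk \<omega> ?n x)"
          using quasi[of "walk \<omega> (N k) x" "path_sum (\<lambda>i. \<omega> (N k + i) x) (L k)"] by (simp add: X_def abs_le_iff)
        moreover have "- (A * (V / sqrt (real R))) \<le> \<phi> (walk \<omega> (N k) x) - real (N k) * ell"
          using elim(1) mult_left_mono[OF prev, of A] A(2) by linarith
        moreover have "real ?n * ell = real (N k) * ell + real (L k) * ell" by (simp add: N_Suc algebra_simps)
        moreover have "real (p k) * (y * sqrt (real (R ^ k)) - D) = real (p k) * (y * sqrt (real (R ^ k))) - real (p k) * D"
          by (simp add: right_diff_distrib)
        ultimately have "(B - \<epsilon>) * V - \<epsilon> * V - A * (V / sqrt (real R)) \<le> \<phi> (walk \<omega> ?n x) - real ?n * ell"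
          using ck main err unfolding c_def by linarith
        moreover have "(B - \<epsilon>) * V - \<epsilon> * V - A * (V / sqrt (real R)) = (B - 2 * \<epsilon> - A / sqrt (real R)) * V"
          by (simp add: algebra_simps)
        ultimately show "b0 * sqrt (2 * real ?n * ln (ln (real ?n))) \<le> \<phi> (walk \<omega> ?n x) - real ?n * ell"
          unfolding sum_eq V_def LL_def by simp
      qed
    qed
    from elim(1) ev have "\<exists>\<^sub>F k in sequentially. b0 * sqrt (2 * real (N (Suc k)) * ln (ln (real (N (Suc k)))))
        \<le> \<phi> (walk \<omega> (N (Suc k)) x) - real (N (Suc k)) * ell"
      by (rule frequently_rev_mp)
    then show ?case
      unfolding frequently_sequentially
    proof (intro allI)
      fix m
      assume "\<forall>m. \<exists>k\<ge>m. b0 * sqrt (2 * real (N (Suc k)) * ln (ln (real (N (Suc k)))))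
        \<le> \<phi> (walk \<omega> (N (Suc k)) x) - real (N (Suc k)) * ell"
      then obtain k where "m \<le> k" "b0 * sqrt (2 * real (N (Suc k)) * ln (ln (real (N (Suc k)))))
        \<le> \<phi> (walk \<omega> (N (Suc k)) x) - real (N (Suc k)) * ell" by blast
      then show "\<exists>n\<ge>m. b0 * sqrt (2 * real n * ln (ln (real n))) \<le> \<phi> (walk \<omega> n x) - real n * ell"
        using N_ge[of "Suc k"] by (intro exI[of _ "N (Suc k)"]) auto
    qed
  qed
qed

theorem iterated_logarithm_sigma:
  assumes s: "0 < sigma2"
  shows "iterated_logarithm \<mu> \<phi> P \<omega> (sqrt sigma2)"
  unfolding iterated_logarithm_def
proof
  let ?s = "sqrt sigma2"
  let ?V = "\<lambda>n. sqrt (2 * real n * ln (ln (real n)))"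
  let ?S = "\<lambda>x n. \<phi> (walk \<omega> n x) - real n * ell"
  show s0: "0 < ?s" using s by simp
  have V: "eventually (\<lambda>n. 0 < ?V n) sequentially"
  proof -
    have "eventually (\<lambda>n. 0 < ln (ln (real n))) sequentially" by real_asymp
    then show ?thesis using eventually_gt_at_top[of 0] by eventually_elim simp
  qed
  have up: "AE x in P. \<forall>i. eventually (\<lambda>n. ?S x n \<le> (?s + 1 / real (Suc i)) * ?V n) sequentially"
    unfolding AE_all_countable by (intro allI upper_iterated_logarithm) simp
  have low: "AE x in P. \<forall>i. \<exists>\<^sub>F n in sequentially. ?s * (1 - 1 / real (i + 2)) * ?V n \<le> ?S x n"
    unfolding AE_all_countable
  proof (intro allI lower_iterated_logarithm)
    fix i :: nat
    have q: "0 < 1 - 1 / real (i + 2)" "1 - 1 / real (i + 2) < 1" by simp_all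
    show "0 < ?s * (1 - 1 / real (i + 2))" by (intro mult_pos_pos s0 q)
    show "?s * (1 - 1 / real (i + 2)) < ?s" using mult_strict_left_mono[OF q(2) s0] by simp
  qed
  show "AE x in P. limsup (\<lambda>n. ereal (?S x n / ?V n)) = ereal ?s"
    using up low
  proof eventually_elim
    case (elim x)
    let ?l = "limsup (\<lambda>n. ereal (?S x n / ?V n))"
    have le: "?l \<le> ereal (?s + 1 / real (Suc i))" for i
    proof (rule Limsup_bounded)
      show "eventually (\<lambda>n. ereal (?S x n / ?V n) \<le> ereal (?s + 1 / real (Suc i))) sequentially"
        using V elim(1)[rule_format, of i] by eventually_elim (simp add: pos_divide_le_eq)
    qed
    have ge: "ereal (?s * (1 - 1 / real (i + 2))) \<le> ?l" for i
    proof (rule ccontr)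
      assume "\<not> ereal (?s * (1 - 1 / real (i + 2))) \<le> ?l"
      then have "eventually (\<lambda>n. ereal (?S x n / ?V n) < ereal (?s * (1 - 1 / real (i + 2)))) sequentially"
        by (intro Limsup_lessD) (simp add: not_le)
      with V have "eventually (\<lambda>n. \<not> ?s * (1 - 1 / real (i + 2)) * ?V n \<le> ?S x n) sequentially"
        by eventually_elim (simp add: pos_divide_less_eq not_le)
      with elim(2)[rule_format, of i] show False by (simp add: frequently_def)
    qed
    have lim_plus: "(\<lambda>i. c + 1 / real (Suc i)) \<longlonglongrightarrow> c" for c by real_asymp
    have lim_times: "(\<lambda>i. c * (1 - 1 / real (i + 2))) \<longlonglongrightarrow> c" for c by real_asymp
    show "?l = ereal ?s"
    proof (rule antisym)
      have "(\<lambda>i. ereal (?s + 1 / real (Suc i))) \<longlonglongrightarrow> ereal ?s" by (intro tendsto_ereal) (rule lim_plus)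
      then show "?l \<le> ereal ?s" by (rule LIMSEQ_le_const) (use le in auto)
      have "(\<lambda>i. ereal (?s * (1 - 1 / real (i + 2)))) \<longlonglongrightarrow> ereal ?s"
        by (intro tendsto_ereal) (rule lim_times)
      then show "ereal ?s \<le> ?l" by (rule LIMSEQ_le_const2) (use ge in auto)
    qed
  qed
qed

theorem central_limit_sigma: "central_limit \<mu> \<phi> P \<omega> (sqrt sigma2)"
proof -
  have "distr P borel (\<lambda>x. (\<phi> (walk \<omega> n x) - real n * ell) / sqrt (real n)) =
      distr (conv n) borel (\<lambda>g. (\<phi> g - real n * ell) / sqrt (real n))" for n
    unfolding walk_distr[symmetric] by (subst distr_distr) (auto simp: comp_def)
  then show ?thesis unfolding central_limit_def using conv_central_limit by simp
qed

end

theorem theorem1p1: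
  fixes \<mu> :: "'a :: {topological_group_add, t2_space, second_countable_topology} measure"
    and \<phi> :: "'a \<Rightarrow> real"
    and P :: "'w measure"
    and \<omega> :: "nat \<Rightarrow> 'w \<Rightarrow> 'a"
  assumes "locally_compact_space (euclidean :: 'a topology)"
    and "prob_space \<mu>" and "regular_borel_measure \<mu>"
    and "spread_out \<mu>"
    and "\<phi> \<in> borel_measurable borel"
    and "quasimorphism \<phi>"
    and "integrable \<mu> (\<lambda>g. (\<phi> g)\<^sup>2)"
    and "iid_increments \<mu> P \<omega>"
  shows "\<exists>\<sigma>\<ge>0. central_limit \<mu> \<phi> P \<omega> \<sigma> \<and>
               (\<sigma> > 0 \<longleftrightarrow> \<not> tame \<mu> \<phi>) \<and>
               (\<not> tame \<mu> \<phi> \<longrightarrow> iterated_logarithm \<mu> \<phi> P \<omega> \<sigma>)"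
proof -
  obtain D where D: "\<And>g h. \<bar>\<phi> (g + h) - \<phi> g - \<phi> h\<bar> \<le> D"
    using assms(6) unfolding quasimorphism_def by blast
  interpret quasimorphism_random_walk \<mu> \<phi> D P \<omega>
    by (intro quasimorphism_random_walk.intro quasimorphism_walk.intro quasimorphism_walk_axioms.intro
        quasimorphism_random_walk_axioms.intro)
      (use assms D in \<open>simp_all add: regular_borel_measure_def\<close>)
  have "0 < sqrt sigma2 \<longleftrightarrow> \<not> tame \<mu> \<phi>"
    using sigma2_nonneg by (auto simp: tame_iff)
  then show ?thesis
    using central_limit_sigma iterated_logarithm_sigma sigma2_nonneg
    by (intro exI[of _ "sqrt sigma2"]) auto
qed

end
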